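(* Let $\nu$ be the uniform probability measure on $\{-1,1\}$ and $\psi\equiv0$. Let $\theta:\{-1,1\}^p\to\mathbb{R}$ be a random function satisfying $\mathbb{E}\|\theta\|_\infty^2<\infty$, $\mathbb{E}\,\mathrm{Lip}(\theta)<\infty$, invariance of its law under permutations of the inputs, and the symmetry property $\theta(\sigma)=\theta(-\sigma)$ for all $\sigma\in\{-1,1\}^p$. (i) If $0<\beta<\infty$ and $\min\bigl(1,6\beta\,\mathbb{E}[\|\theta\|_\infty e^{4\beta\|\theta\|_\infty}]\bigr)\alpha p(p-1)\le1$, then, in $L^1$ as $N\to\infty$, $$F_N(\beta)\to F(\beta)=\alpha\,\mathbb{E}\log\sum_{\sigma\in\{-1,1\}^p}e^{\beta\theta(\sigma)}-\alpha p\log2 .$$ (ii) If $\alpha p(p-1)\le1$, then, in $L^1$ as $N\to\infty$, $$\mathrm{GSE}_N\to\mathrm{GSE}=\alpha\,\mathbb{E}\max_{\sigma\in\{-1,1\}^p}\theta(\sigma).$$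
   Context: Let $p\ge2$ be an integer and $\alpha>0$. $\mathrm{Lip}(\theta)=\sup_{x\ne y}|\theta(x)-\theta(y)|/\|x-y\|_2$ over $x,y\in\{-1,1\}^p$. Let $(\theta_k)_{k\ge1}$ be i.i.d. copies of $\theta$, let $\pi(\alpha N)$ be Poisson with mean $\alpha N$, and for each $k$ let $\{I(k,1),\dots,I(k,p)\}$ be a uniformly random $p$-element subset of $[N]=\{1,\dots,N\}$; all independent. With $\psi\equiv0$, for $\sigma\in\{-1,1\}^N$, $$H_N(\sigma)=\sum_{k\le\pi(\alpha N)}\theta_k(\sigma_{I(k,1)},\dots,\sigma_{I(k,p)}),$$ $$F_N(\beta)=\frac1N\log\int e^{\beta H_N(\sigma)}\,\nu^{\otimes N}(d\sigma),\qquad \mathrm{GSE}_N=\frac1N\max_{\sigma\in\{-1,1\}^N}H_N(\sigma).$$ *)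

theory Defs
  imports "HOL-Probability.Probability"
begin

text \<open>
  Configurations in \<open>{-1,1}\<^sup>n\<close> are extensional functions on \<open>{1..n}\<close>, and a function
  \<open>{-1,1}\<^sup>p \<rightarrow> \<real>\<close> is an extensional function on \<open>cube p\<close>, so that a random function
  is a random element of \<open>fun_space p\<close>.
\<close>

definition cube :: "nat \<Rightarrow> (nat \<Rightarrow> real) set" where
  "cube n = {1..n} \<rightarrow>\<^sub>E {-1, 1}"

definition fun_space :: "nat \<Rightarrow> ((nat \<Rightarrow> real) \<Rightarrow> real) measure" where
  "fun_space p = PiM (cube p) (\<lambda>_. borel)"

definition sup_norm :: "nat \<Rightarrow> ((nat \<Rightarrow> real) \<Rightarrow> real) \<Rightarrow> real" where
  "sup_norm p f = Max ((\<lambda>x. \<bar>f x\<bar>) ` cube p)"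

definition Lip :: "nat \<Rightarrow> ((nat \<Rightarrow> real) \<Rightarrow> real) \<Rightarrow> real" where
  "Lip p f = Sup {\<bar>f x - f y\<bar> / L2_set (\<lambda>i. x i - y i) {1..p} | x y.
                    x \<in> cube p \<and> y \<in> cube p \<and> x \<noteq> y}"

definition perm_invariant_law ::
    "nat \<Rightarrow> 'a measure \<Rightarrow> ('a \<Rightarrow> (nat \<Rightarrow> real) \<Rightarrow> real) \<Rightarrow> bool" where
  "perm_invariant_law p M \<theta> \<longleftrightarrow>
     (\<forall>\<tau>. \<tau> permutes {1..p} \<longrightarrow>
        distr M (fun_space p) (\<lambda>\<omega>. \<lambda>\<sigma>\<in>cube p. \<theta> \<omega> (\<sigma> \<circ> \<tau>)) = distr M (fun_space p) \<theta>)"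

text \<open>Names for the independent sources of randomness in the model of size \<open>N\<close>.\<close>

datatype source = Coupling nat | Clause nat | Count

text \<open>
  The disorder: \<open>\<Theta> k\<close> is the function \<open>\<theta>\<^sub>k\<close>, \<open>K N\<close> is the Poisson number \<open>\<pi>(\<alpha>N)\<close>
  of terms, and \<open>I N k i\<close> is the index \<open>I(k,i)\<close> in the model of size \<open>N\<close>.
  Only the law of the set \<open>{I(k,1),...,I(k,p)}\<close> is prescribed, so any enumeration of
  the random set (random or not) is allowed, as long as the enumerating tuples satisfy the
  independence condition. Joint independence is required for each \<open>N\<close> separately; it is
  stated through the generated sigma-algebras because the value types differ.
  Sizes \<open>N < p\<close>, where there is no \<open>p\<close>-element subset, are left unconstrained.
\<close>

locale diluted_disorder = prob_space M for M :: "'a measure" +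
  fixes p :: nat and \<alpha> :: real
    and \<theta> :: "'a \<Rightarrow> (nat \<Rightarrow> real) \<Rightarrow> real"
    and \<Theta> :: "nat \<Rightarrow> 'a \<Rightarrow> (nat \<Rightarrow> real) \<Rightarrow> real"
    and K :: "nat \<Rightarrow> 'a \<Rightarrow> nat"
    and I :: "nat \<Rightarrow> nat \<Rightarrow> 'a \<Rightarrow> nat \<Rightarrow> nat"
  assumes measurable_theta: "\<theta> \<in> M \<rightarrow>\<^sub>M fun_space p"
    and measurable_Theta: "\<And>k. k \<ge> 1 \<Longrightarrow> \<Theta> k \<in> M \<rightarrow>\<^sub>M fun_space p"
    and law_Theta: "\<And>k. k \<ge> 1 \<Longrightarrow> distr M (fun_space p) (\<Theta> k) = distr M (fun_space p) \<theta>"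
    and measurable_K: "\<And>N. N \<ge> p \<Longrightarrow> K N \<in> M \<rightarrow>\<^sub>M count_space UNIV"
    and law_K: "\<And>N. N \<ge> p \<Longrightarrow>
      distr M (count_space UNIV) (K N) = measure_pmf (poisson_pmf (\<alpha> * real N))"
    and measurable_I: "\<And>N k. N \<ge> p \<Longrightarrow> k \<ge> 1 \<Longrightarrow>
      I N k \<in> M \<rightarrow>\<^sub>M PiM {1..p} (\<lambda>_. count_space {1..N})"
    and law_I: "\<And>N k. N \<ge> p \<Longrightarrow> k \<ge> 1 \<Longrightarrow>
      distr M (count_space UNIV) (\<lambda>\<omega>. I N k \<omega> ` {1..p})
        = measure_pmf (pmf_of_set {S. S \<subseteq> {1..N} \<and> card S = p})"
    and indep: "\<And>N. N \<ge> p \<Longrightarrow>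
      indep_sets
        (\<lambda>s. case s of
           Coupling k \<Rightarrow> sets (vimage_algebra (space M) (\<Theta> k) (fun_space p))
         | Clause k \<Rightarrow>
             sets (vimage_algebra (space M) (I N k) (PiM {1..p} (\<lambda>_. count_space {1..N})))
         | Count \<Rightarrow> sets (vimage_algebra (space M) (K N) (count_space UNIV)))
        (Coupling ` {1..} \<union> Clause ` {1..} \<union> {Count})"

definition hamiltonian ::
    "nat \<Rightarrow> (nat \<Rightarrow> (nat \<Rightarrow> real) \<Rightarrow> real) \<Rightarrow> nat \<Rightarrow> (nat \<Rightarrow> nat \<Rightarrow> nat) \<Rightarrow> (nat \<Rightarrow> real) \<Rightarrow> real" where
  "hamiltonian p \<Theta> K I \<sigma> = (\<Sum>k=1..K. \<Theta> k (\<lambda>i\<in>{1..p}. \<sigma> (I k i)))"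

definition free_energy ::
    "real measure \<Rightarrow> nat \<Rightarrow> real \<Rightarrow> ((nat \<Rightarrow> real) \<Rightarrow> real) \<Rightarrow> real" where
  "free_energy \<nu> N \<beta> H = 1 / real N * ln (\<integral>\<sigma>. exp (\<beta> * H \<sigma>) \<partial>PiM {1..N} (\<lambda>_. \<nu>))"

definition ground_state_energy :: "nat \<Rightarrow> ((nat \<Rightarrow> real) \<Rightarrow> real) \<Rightarrow> real" where
  "ground_state_energy N H = 1 / real N * Max (H ` cube N)"

text \<open>
  The integrability clause excludes the Bochner convention that a non-integrable
  function has integral zero.
\<close>

definition tendsto_L1 :: "'a measure \<Rightarrow> (nat \<Rightarrow> 'a \<Rightarrow> real) \<Rightarrow> real \<Rightarrow> bool" where
  "tendsto_L1 M X c \<longleftrightarrow>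
     (\<forall>\<^sub>F N in sequentially. integrable M (X N)) \<and>
     (\<lambda>N. \<integral>\<omega>. \<bar>X N \<omega> - c\<bar> \<partial>M) \<longlonglongrightarrow> 0"

end

theory Submission
  imports Defs
begin

text \<open>
  Write \<open>Z n\<close> for the partition function of the first \<open>n\<close> clauses, \<open>s k\<close> for the sup norm of
  \<open>\<theta>\<^sub>k\<close> and \<open>L k\<close> for the logarithm of the mean of \<open>exp (\<beta> \<theta>\<^sub>k)\<close> over the cube. Suppose that
  each new clause met \<open>p\<close> different components of the hypergraph of the clauses already present.
  Because \<open>\<theta>\<close> is even, flipping the spins of a whole component preserves the Gibbs weight, so the
  \<open>p\<close> spins of the new clause would be independent and uniform, \<open>ln (Z k / Z (k - 1))\<close> would equal
  \<open>L k\<close>, and the law of large numbers would give the limit \<open>\<alpha> E L\<close>. The whole work is to show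
  that the clauses which do not behave like this are negligible.

  At high temperature the hypergraph may have a giant component, but not every clause transmits
  information. Write \<open>exp (\<beta> \<theta>\<^sub>k)\<close> as its lower bound \<open>exp (- \<beta> s k)\<close> plus a nonnegative even
  remainder and expand the product over the clauses (a Fortuin-Kasteleyn representation): the Gibbs
  measure becomes a mixture, over sets \<open>A\<close> of open clauses, of measures under which the components of
  \<open>A\<close> are independent and each of them is symmetric under the flip of its spins. Given all the
  others, a clause is open with probability at most \<open>q k = 1 - exp (- 2 \<beta> s k)\<close>, so that \<open>A\<close> is
  dominated by independent percolation
  (\<open>centered_expectation_le_perc\<close>). Hence the increment \<open>ln (Z k / Z (k - 1))\<close> differs from \<open>L k\<close> by
  at most \<open>exp (2 \<beta> s k)\<close> times the probability that two vertices of clause \<open>k\<close> are connected in the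
  percolation (\<open>log_increment_le_cycle_weight\<close>).

  That probability is bounded by a sum over trails, paths that use no clause twice, of products
  of the \<open>q\<close>'s. The clauses along a trail are distinct, so the expectation over the disorder
  factorizes (\<open>nn_integral_trails\<close>), and the trail sum becomes a geometric series with ratio at most
  \<open>n E q p (p - 1) / N\<close> when \<open>n\<close> clauses are present. For \<open>n \<le> (1 - \<epsilon>) \<alpha> N\<close> the ratio is at
  most \<open>1 - \<epsilon>\<close> as soon as \<open>E q \<alpha> p (p - 1) \<le> 1\<close>, and the probability is of order
  \<open>1 / (\<epsilon> N)\<close>. The remaining clauses, about \<open>\<epsilon> \<alpha> N\<close> in number, change \<open>ln Z\<close> by at most
  \<open>\<beta> s k\<close> each; this is how the boundary case of equality is included.

  Both alternatives in the hypothesis of (i) imply \<open>E q \<alpha> p (p - 1) \<le> 1\<close>, since \<open>q \<le> 1\<close> and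
  \<open>q \<le> 2 \<beta> s\<close>. Under the hypothesis of (ii) the result (i) is therefore available at every \<open>\<beta>\<close>,
  and (ii) follows by letting \<open>\<beta>\<close> grow, because \<open>F\<^sub>N(\<beta>) / \<beta>\<close> and the ground state energy differ by
  at most \<open>ln 2 / \<beta>\<close>, uniformly in \<open>N\<close> and in the disorder, and similarly for the limits.
\<close>

section \<open>Percolation\<close>

text \<open>
  The mean of \<open>\<phi>\<close> over the random subset of \<open>S\<close> that contains each \<open>k\<close> independently with
  probability \<open>q k\<close>. It is written as a finite sum because \<open>q\<close> will itself be a function of the
  disorder.
\<close>

definition perc :: "('k \<Rightarrow> real) \<Rightarrow> 'k set \<Rightarrow> ('k set \<Rightarrow> real) \<Rightarrow> real" where
  "perc q S \<phi> = (\<Sum>A\<in>Pow S. (\<Prod>k\<in>A. q k) * (\<Prod>k\<in>S - A. 1 - q k) * \<phi> A)"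

lemma perc_empty [simp]: "perc q {} \<phi> = \<phi> {}"
  by (simp add: perc_def)

lemma perc_cong:
  assumes "\<And>A. A \<subseteq> S \<Longrightarrow> \<phi> A = \<psi> A"
  shows "perc q S \<phi> = perc q S \<psi>"
  unfolding perc_def by (rule sum.cong) (use assms in auto)

lemma perc_insert:
  assumes "finite S" "k \<notin> S"
  shows "perc q (insert k S) \<phi> = (1 - q k) * perc q S \<phi> + q k * perc q S (\<lambda>A. \<phi> (insert k A))"
proof -
  let ?t = "\<lambda>A. (\<Prod>l\<in>A. q l) * (\<Prod>l\<in>insert k S - A. 1 - q l) * \<phi> A"
  have inj: "inj_on (insert k) (Pow S)"
    using assms(2) by (auto simp: inj_on_def)
  have "perc q (insert k S) \<phi> = sum ?t (Pow S) + sum ?t (insert k ` Pow S)"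
    unfolding perc_def Pow_insert
    by (rule sum.union_disjoint) (use assms in auto)
  also have "sum ?t (Pow S) = (1 - q k) * perc q S \<phi>"
    unfolding perc_def sum_distrib_left
  proof (rule sum.cong[OF refl])
    fix A assume A: "A \<in> Pow S"
    then have "insert k S - A = insert k (S - A)" using assms(2) by auto
    then show "?t A = (1 - q k) * ((\<Prod>l\<in>A. q l) * (\<Prod>l\<in>S - A. 1 - q l) * \<phi> A)"
      using assms by simp
  qed
  also have "sum ?t (insert k ` Pow S) = q k * perc q S (\<lambda>A. \<phi> (insert k A))"
    unfolding perc_def sum_distrib_left sum.reindex[OF inj] comp_def
  proof (rule sum.cong[OF refl])
    fix A assume A: "A \<in> Pow S"
    then have "insert k S - insert k A = S - A" "k \<notin> A" "finite A"
      using assms by (auto intro: finite_subset)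
    then show "?t (insert k A)
        = q k * ((\<Prod>l\<in>A. q l) * (\<Prod>l\<in>S - A. 1 - q l) * \<phi> (insert k A))"
      by simp
  qed
  finally show ?thesis .
qed

lemma perc_mono:
  assumes "\<And>k. k \<in> S \<Longrightarrow> 0 \<le> q k" "\<And>k. k \<in> S \<Longrightarrow> q k \<le> 1"
    and "\<And>A. A \<subseteq> S \<Longrightarrow> \<phi> A \<le> \<psi> A"
  shows "perc q S \<phi> \<le> perc q S \<psi>"
  unfolding perc_def
  by (intro sum_mono mult_left_mono mult_nonneg_nonneg prod_nonneg) (use assms in auto)

lemma perc_add: "perc q S (\<lambda>A. \<phi> A + \<psi> A) = perc q S \<phi> + perc q S \<psi>"
  by (simp add: perc_def distrib_left sum.distrib)

lemma perc_sum: "perc q S (\<lambda>A. \<Sum>x\<in>X. \<phi> x A) = (\<Sum>x\<in>X. perc q S (\<phi> x))"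
  unfolding perc_def sum_distrib_left by (rule sum.swap)

lemma perc_scale: "perc q S (\<lambda>A. c * \<phi> A) = c * perc q S \<phi>"
  by (simp add: perc_def sum_distrib_left mult_ac)

lemma perc_const: "finite S \<Longrightarrow> perc q S (\<lambda>_. c) = c"
  by (induction S rule: finite_induct) (auto simp: perc_insert algebra_simps)

lemma perc_open_edge:
  assumes "finite S" "k \<in> S"
  shows "perc q S (\<lambda>A. of_bool (k \<in> A) * \<psi> (A - {k})) = q k * perc q (S - {k}) \<psi>"
proof -
  have "perc q (insert k (S - {k})) (\<lambda>A. of_bool (k \<in> A) * \<psi> (A - {k}))
      = (1 - q k) * perc q (S - {k}) (\<lambda>_. 0) + q k * perc q (S - {k}) \<psi>"
    using assms(1)
    by (subst perc_insert)
      (auto intro!: arg_cong2[where f="(+)"] perc_cong simp: insert_Diff_if subset_Diff_insert)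
  moreover have "insert k (S - {k}) = S" using assms(2) by auto
  ultimately show ?thesis using assms(1) by (simp add: perc_const)
qed

section \<open>Connectivity in hypergraphs\<close>

definition link :: "('k \<Rightarrow> 'v set) \<Rightarrow> 'k set \<Rightarrow> ('v \<times> 'v) set" where
  "link E A = {(x, y). \<exists>k\<in>A. x \<in> E k \<and> y \<in> E k}"

definition connected_by :: "('k \<Rightarrow> 'v set) \<Rightarrow> 'k set \<Rightarrow> 'v \<Rightarrow> 'v \<Rightarrow> bool" where
  "connected_by E A x y \<longleftrightarrow> (x, y) \<in> (link E A)\<^sup>*"

lemma connected_by_empty [simp]: "connected_by E {} x y \<longleftrightarrow> x = y"
  by (simp add: connected_by_def link_def)

lemma connected_by_mono: "connected_by E A x y \<Longrightarrow> A \<subseteq> B \<Longrightarrow> connected_by E B x y"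
  unfolding connected_by_def
  by (erule rev_subsetD, rule rtrancl_mono) (auto simp: link_def)

lemma connected_by_trans:
  "connected_by E A x y \<Longrightarrow> connected_by E A y z \<Longrightarrow> connected_by E A x z"
  unfolding connected_by_def by (rule rtrancl_trans)

lemma connected_by_edge: "k \<in> A \<Longrightarrow> x \<in> E k \<Longrightarrow> y \<in> E k \<Longrightarrow> connected_by E A x y"
  unfolding connected_by_def link_def by blast

text \<open>
  Cut a path from \<open>x\<close> to \<open>y\<close> after its last step through the edge \<open>k\<close>.
\<close>

lemma connected_by_last_visit:
  assumes "connected_by E A x y"
  shows "connected_by E (A - {k}) x y \<or> (\<exists>v\<in>E k. connected_by E (A - {k}) v y)"
  using assms unfolding connected_by_def
proof (induction rule: converse_rtrancl_induct)
  case (step x z)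
  from step.hyps(1) obtain l where l: "l \<in> A" "x \<in> E l" "z \<in> E l" by (auto simp: link_def)
  show ?case
  proof (cases "l = k")
    case True
    then show ?thesis using step.IH l by auto
  next
    case False
    then have "(x, z) \<in> link E (A - {k})" using l by (auto simp: link_def)
    then show ?thesis using step.IH by (meson converse_rtrancl_into_rtrancl)
  qed
qed simp

text \<open>
  A path can be made to use its first edge only once: leave \<open>E k\<close> at the last vertex at which the path
  visits it. If that vertex is \<open>x\<close> itself, then \<open>k\<close> was superfluous and induction on the set of edges
  applies to \<open>A - {k}\<close>.
\<close>

lemma connected_by_first_edge:
  assumes "finite A" "connected_by E A x y" "x \<noteq> y"
  shows "\<exists>k\<in>A. x \<in> E k \<and> (\<exists>v\<in>E k - {x}. connected_by E (A - {k}) v y)"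
  using assms
proof (induction A rule: finite_psubset_induct)
  case (psubset A)
  from psubset.prems obtain z where "(x, z) \<in> link E A"
    unfolding connected_by_def by (meson converse_rtranclE)
  then obtain k where k: "k \<in> A" "x \<in> E k" by (auto simp: link_def)
  from connected_by_last_visit[OF psubset.prems(1), of k]
  obtain v where v: "v \<in> E k" "connected_by E (A - {k}) v y" using k by auto
  show ?case
  proof (cases "v = x")
    case False
    then show ?thesis using v k by auto
  next
    case True
    with psubset.IH[of "A - {k}"] psubset.prems k v obtain l w where
      "l \<in> A - {k}" "x \<in> E l" "w \<in> E l - {x}" "connected_by E (A - {k} - {l}) w y"
      by auto
    moreover then have "connected_by E (A - {l}) w y"
      by (auto elim: connected_by_mono)
    ultimately show ?thesis by blast
  qed
qed

text \<open>
  The sum, over the trails of at most \<open>d\<close> steps from \<open>x\<close> to \<open>y\<close>, of the products of the weights of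
  their steps. Each step moves to a different vertex and removes the label that it uses, so the
  labels along a trail are distinct.
\<close>

primrec trails :: "('k \<Rightarrow> 'v \<Rightarrow> 'v \<Rightarrow> real) \<Rightarrow> 'v set \<Rightarrow> nat \<Rightarrow> 'k set \<Rightarrow> 'v \<Rightarrow> 'v \<Rightarrow> real" where
  "trails a V 0 S x y = of_bool (x = y)"
| "trails a V (Suc d) S x y
    = of_bool (x = y) + (\<Sum>k\<in>S. \<Sum>v\<in>V - {x}. a k x v * trails a V d (S - {k}) v y)"

text \<open>
  A union bound over trails. Since the labels of a trail are distinct, the probability that all of
  them are open is the product of the \<open>q k\<close>.
\<close>

lemma perc_connected_le_trails:
  assumes "finite V" "finite S" "card S \<le> d"
    and "\<And>k. k \<in> S \<Longrightarrow> E k \<subseteq> V"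
    and "\<And>k. k \<in> S \<Longrightarrow> 0 \<le> q k" "\<And>k. k \<in> S \<Longrightarrow> q k \<le> 1"
  shows "perc q S (\<lambda>A. of_bool (connected_by E A x y))
    \<le> trails (\<lambda>k u v. q k * of_bool (u \<in> E k \<and> v \<in> E k)) V d S x y"
  using assms(2-)
proof (induction d arbitrary: S x)
  case 0
  then show ?case by simp
next
  case (Suc d)
  let ?a = "\<lambda>k u v. q k * of_bool (u \<in> E k \<and> v \<in> E k)"
  let ?\<psi> = "\<lambda>v A. of_bool (connected_by E A v y) :: real"
  have "perc q S (?\<psi> x) \<le> perc q S (\<lambda>A. of_bool (x = y) + (\<Sum>k\<in>S. \<Sum>v\<in>V - {x}.
      of_bool (x \<in> E k \<and> v \<in> E k) * (of_bool (k \<in> A) * ?\<psi> v (A - {k}))))"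
  proof (rule perc_mono)
    fix A assume A: "A \<subseteq> S"
    let ?r = "\<lambda>k v. of_bool (x \<in> E k \<and> v \<in> E k) * (of_bool (k \<in> A) * ?\<psi> v (A - {k}))"
    have nn: "0 \<le> (\<Sum>k\<in>S. \<Sum>v\<in>V - {x}. ?r k v)" by (intro sum_nonneg) auto
    show "?\<psi> x A \<le> of_bool (x = y) + (\<Sum>k\<in>S. \<Sum>v\<in>V - {x}. ?r k v)"
    proof (cases "connected_by E A x y \<and> x \<noteq> y")
      case True
      moreover have "finite A" using A Suc.prems(1) by (rule finite_subset)
      ultimately obtain k v where kv: "k \<in> A" "x \<in> E k" "v \<in> E k - {x}"
        "connected_by E (A - {k}) v y"
        using connected_by_first_edge by meson
      have kS: "k \<in> S" "v \<in> V - {x}" using kv A Suc.prems(3) by auto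
      have "1 = ?r k v" using kv by simp
      also have "\<dots> \<le> (\<Sum>v\<in>V - {x}. ?r k v)"
        by (rule member_le_sum) (use kS assms(1) in auto)
      also have "\<dots> \<le> (\<Sum>k\<in>S. \<Sum>v\<in>V - {x}. ?r k v)"
        by (rule member_le_sum[where f="\<lambda>k. \<Sum>v\<in>V - {x}. ?r k v"])
          (use kS Suc.prems(1) in \<open>auto intro!: sum_nonneg\<close>)
      finally show ?thesis using True by simp
    qed (use nn in auto)
  qed (use Suc.prems in auto)
  also have "\<dots> = of_bool (x = y) + (\<Sum>k\<in>S. \<Sum>v\<in>V - {x}.
      ?a k x v * perc q (S - {k}) (?\<psi> v))"
    unfolding perc_add perc_sum perc_const[OF Suc.prems(1)]
  proof (intro arg_cong2[where f="(+)"] refl sum.cong)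
    fix k v assume "k \<in> S"
    then show "perc q S (\<lambda>A. of_bool (x \<in> E k \<and> v \<in> E k) * (of_bool (k \<in> A) * ?\<psi> v (A - {k})))
        = ?a k x v * perc q (S - {k}) (?\<psi> v)"
      using perc_open_edge[OF Suc.prems(1), of k q "?\<psi> v"] by (simp only: perc_scale) simp
  qed
  also have "\<dots> \<le> of_bool (x = y) + (\<Sum>k\<in>S. \<Sum>v\<in>V - {x}.
      ?a k x v * trails ?a V d (S - {k}) v y)"
    using Suc.prems
    by (intro add_left_mono sum_mono mult_left_mono Suc.IH)
      (auto simp: card_Diff_singleton)
  finally show ?case by simp
qed

section \<open>Flips and the Fortuin-Kasteleyn expansion\<close>

definition flip :: "nat set \<Rightarrow> (nat \<Rightarrow> real) \<Rightarrow> nat \<Rightarrow> real" where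
  "flip C \<sigma> = (\<lambda>x. if x \<in> C then - \<sigma> x else \<sigma> x)"

lemma flip_flip [simp]: "flip C (flip C \<sigma>) = \<sigma>"
  by (auto simp: flip_def)

lemma flip_in_cube: "C \<subseteq> {1..n} \<Longrightarrow> \<sigma> \<in> cube n \<Longrightarrow> flip C \<sigma> \<in> cube n"
  unfolding cube_def flip_def PiE_def Pi_def extensional_def
  by (auto simp: minus_equation_iff)

lemma finite_cube [simp]: "finite (cube n)"
  by (simp add: cube_def finite_PiE)

lemma card_cube: "card (cube n) = 2 ^ n"
  by (simp add: cube_def card_PiE numeral_2_eq_2)

lemma cube_nonempty [simp]: "cube n \<noteq> {}"
  by (auto simp: cube_def PiE_eq_empty_iff)

lemma sum_cube_flip:
  assumes "C \<subseteq> {1..n}"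
  shows "(\<Sum>\<sigma>\<in>cube n. h (flip C \<sigma>)) = (\<Sum>\<sigma>\<in>cube n. h \<sigma>)"
  by (rule sum.reindex_bij_witness[of _ "flip C" "flip C"])
    (use assms in \<open>auto intro: flip_in_cube simp del: One_nat_def\<close>)

definition entangled :: "('k \<Rightarrow> 'v set) \<Rightarrow> 'v set \<Rightarrow> 'k set \<Rightarrow> bool" where
  "entangled E V A \<longleftrightarrow> (\<exists>x\<in>V. \<exists>y\<in>V - {x}. connected_by E A x y)"

lemma entangled_mono: "entangled E V A \<Longrightarrow> A \<subseteq> B \<Longrightarrow> entangled E V B"
  unfolding entangled_def by (meson connected_by_mono)

text \<open>
  Invariance under the flips that do not separate the vertices of the edge \<open>e\<close>. An even function of
  the spins in \<open>e\<close> has this property, and flips of unions of components are of this kind for every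
  edge.
\<close>

definition flip_invariant :: "nat \<Rightarrow> nat set \<Rightarrow> ((nat \<Rightarrow> real) \<Rightarrow> real) \<Rightarrow> bool" where
  "flip_invariant n e g \<longleftrightarrow> (\<forall>C\<subseteq>{1..n}. e \<subseteq> C \<or> e \<inter> C = {} \<longrightarrow>
     (\<forall>\<sigma>\<in>cube n. g (flip C \<sigma>) = g \<sigma>))"

text \<open>
  Flipping the union of the components of the vertices in \<open>T\<close> leaves the weight unchanged and, if no
  two vertices of \<open>V\<close> are connected, acts on \<open>V\<close> as the flip of \<open>T\<close>. Averaging over all \<open>T \<subseteq> V\<close>
  therefore replaces \<open>G\<close> by its mean over the flips of \<open>V\<close>, which is \<open>0\<close>.
\<close>

lemma centered_sum_eq_0:
  fixes w G :: "(nat \<Rightarrow> real) \<Rightarrow> real"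
  assumes V: "V \<subseteq> {1..n}"
    and E: "\<And>k. k \<in> U \<Longrightarrow> E k \<subseteq> {1..n}"
    and inv: "\<And>k. k \<in> U \<Longrightarrow> flip_invariant n (E k) (g k)"
    and w: "\<And>\<sigma>. w \<sigma> = (\<Prod>k\<in>U. g k \<sigma>)"
    and local: "\<And>\<sigma> \<tau>. \<sigma> \<in> cube n \<Longrightarrow> \<tau> \<in> cube n \<Longrightarrow> (\<And>x. x \<in> V \<Longrightarrow> \<sigma> x = \<tau> x) \<Longrightarrow> G \<sigma> = G \<tau>"
    and centered: "\<And>\<sigma>. \<sigma> \<in> cube n \<Longrightarrow> (\<Sum>T\<in>Pow V. G (flip T \<sigma>)) = 0"
    and sep: "\<not> entangled E V U"
  shows "(\<Sum>\<sigma>\<in>cube n. w \<sigma> * G \<sigma>) = 0"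
proof -
  have *: "(\<Sum>\<sigma>\<in>cube n. w \<sigma> * G (flip T \<sigma>)) = (\<Sum>\<sigma>\<in>cube n. w \<sigma> * G \<sigma>)" if T: "T \<subseteq> V" for T
  proof -
    define C where "C = {x. \<exists>t\<in>T. connected_by E U t x}"
    have C: "C \<subseteq> {1..n}"
    proof
      fix x assume "x \<in> C"
      then obtain t where t: "t \<in> T" "(t, x) \<in> (link E U)\<^sup>*"
        by (auto simp: C_def connected_by_def)
      from t(2) show "x \<in> {1..n}"
      proof (cases rule: rtranclE)
        case base
        then show ?thesis using t(1) T V by blast
      next
        case (step y)
        then show ?thesis using E unfolding link_def by blast
      qed
    qed
    have closed: "E k \<subseteq> C \<or> E k \<inter> C = {}" if "k \<in> U" for k
    proof (rule ccontr)
      assume "\<not> ?thesis"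
      then obtain x y t where "x \<in> E k" "y \<in> E k" "y \<notin> C" "t \<in> T" "connected_by E U t x"
        unfolding C_def by blast
      moreover then have "connected_by E U t y"
        using connected_by_trans connected_by_edge[OF that] by meson
      ultimately show False unfolding C_def by blast
    qed
    have "w (flip C \<sigma>) = w \<sigma>" if "\<sigma> \<in> cube n" for \<sigma>
      unfolding w using inv closed C that by (intro prod.cong) (auto simp: flip_invariant_def)
    moreover have "G (flip C \<sigma>) = G (flip T \<sigma>)" if "\<sigma> \<in> cube n" for \<sigma>
    proof (rule local)
      fix x assume x: "x \<in> V"
      have "x \<in> C \<longleftrightarrow> x \<in> T"
        using sep x T by (auto simp: C_def entangled_def connected_by_def)
      then show "flip C \<sigma> x = flip T \<sigma> x" by (simp add: flip_def)
    qed (use that C T V in \<open>auto intro: flip_in_cube simp del: One_nat_def\<close>)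
    ultimately have "(\<Sum>\<sigma>\<in>cube n. w \<sigma> * G (flip T \<sigma>))
        = (\<Sum>\<sigma>\<in>cube n. w (flip C \<sigma>) * G (flip C \<sigma>))"
      by (intro sum.cong) auto
    also have "\<dots> = (\<Sum>\<sigma>\<in>cube n. w \<sigma> * G \<sigma>)"
      using sum_cube_flip[OF C, of "\<lambda>\<sigma>. w \<sigma> * G \<sigma>"] .
    finally show ?thesis .
  qed
  have "real (card (Pow V)) * (\<Sum>\<sigma>\<in>cube n. w \<sigma> * G \<sigma>)
      = (\<Sum>T\<in>Pow V. \<Sum>\<sigma>\<in>cube n. w \<sigma> * G (flip T \<sigma>))"
    using * by simp
  also have "\<dots> = (\<Sum>\<sigma>\<in>cube n. w \<sigma> * (\<Sum>T\<in>Pow V. G (flip T \<sigma>)))"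
    unfolding sum_distrib_left by (rule sum.swap)
  also have "\<dots> = 0" using centered by simp
  finally show ?thesis using V by (auto simp: card_Pow dest: finite_subset)
qed

text \<open>
  The Fortuin-Kasteleyn expansion together with its domination by independent percolation, in one
  induction. The edges in \<open>U\<close> have already been opened and carry the weight \<open>g k - m k\<close>; the edges in
  \<open>S\<close> are undecided. Deciding one more edge writes the measure as a mixture of a closed part, to which
  the edge contributes the constant \<open>m k\<close>, and an open part. By the hypothesis on \<open>q\<close> the open part has proportion at most
  \<open>q k\<close>, and since being entangled is increasing in the set of open edges, raising the proportion to
  \<open>q k\<close> can only increase the bound.
\<close>

lemma centered_expectation_le_perc:
  fixes g :: "'k \<Rightarrow> (nat \<Rightarrow> real) \<Rightarrow> real" and G :: "(nat \<Rightarrow> real) \<Rightarrow> real"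
  assumes "finite S" "finite U" "S \<inter> U = {}"
    and V: "V \<subseteq> {1..n}"
    and E: "\<And>k. k \<in> U \<union> S \<Longrightarrow> E k \<subseteq> {1..n}"
    and inv: "\<And>k. k \<in> U \<union> S \<Longrightarrow> flip_invariant n (E k) (g k)"
    and m: "\<And>k. k \<in> U \<union> S \<Longrightarrow> 0 \<le> m k"
      "\<And>k \<sigma>. k \<in> U \<union> S \<Longrightarrow> \<sigma> \<in> cube n \<Longrightarrow> m k \<le> g k \<sigma>"
    and q: "\<And>k. k \<in> U \<union> S \<Longrightarrow> 0 \<le> q k" "\<And>k. k \<in> U \<union> S \<Longrightarrow> q k \<le> 1"
      "\<And>k \<sigma>. k \<in> U \<union> S \<Longrightarrow> \<sigma> \<in> cube n \<Longrightarrow> (1 - q k) * (g k \<sigma> - m k) \<le> q k * m k"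
    and local: "\<And>\<sigma> \<tau>. \<sigma> \<in> cube n \<Longrightarrow> \<tau> \<in> cube n \<Longrightarrow> (\<And>x. x \<in> V \<Longrightarrow> \<sigma> x = \<tau> x) \<Longrightarrow> G \<sigma> = G \<tau>"
    and centered: "\<And>\<sigma>. \<sigma> \<in> cube n \<Longrightarrow> (\<Sum>T\<in>Pow V. G (flip T \<sigma>)) = 0"
    and D: "\<And>\<sigma>. \<sigma> \<in> cube n \<Longrightarrow> \<bar>G \<sigma>\<bar> \<le> D"
  shows "\<bar>\<Sum>\<sigma>\<in>cube n. (\<Prod>k\<in>U. g k \<sigma> - m k) * (\<Prod>k\<in>S. g k \<sigma>) * G \<sigma>\<bar>
    \<le> D * perc q S (\<lambda>A. of_bool (entangled E V (U \<union> A)))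
        * (\<Sum>\<sigma>\<in>cube n. (\<Prod>k\<in>U. g k \<sigma> - m k) * (\<Prod>k\<in>S. g k \<sigma>))"
  using assms(1-3) E inv m q
proof (induction S arbitrary: U rule: finite_induct)
  case empty
  let ?w = "\<lambda>\<sigma>. \<Prod>k\<in>U. g k \<sigma> - m k"
  show ?case
  proof (cases "entangled E V U")
    case True
    have "\<bar>\<Sum>\<sigma>\<in>cube n. ?w \<sigma> * G \<sigma>\<bar> \<le> (\<Sum>\<sigma>\<in>cube n. \<bar>?w \<sigma> * G \<sigma>\<bar>)"
      by (rule sum_abs)
    also have "\<dots> \<le> (\<Sum>\<sigma>\<in>cube n. ?w \<sigma> * D)"
      unfolding abs_mult
    proof (intro sum_mono mult_mono)
      fix \<sigma> assume s: "\<sigma> \<in> cube n"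
      have "0 \<le> ?w \<sigma>" using empty.prems s by (intro prod_nonneg) auto
      then show "\<bar>?w \<sigma>\<bar> \<le> ?w \<sigma>" "0 \<le> ?w \<sigma>" by auto
    qed (use D in auto)
    finally show ?thesis using True by (simp add: sum_distrib_left mult_ac)
  next
    case False
    have "(\<Sum>\<sigma>\<in>cube n. ?w \<sigma> * G \<sigma>) = 0"
    proof (rule centered_sum_eq_0[where g="\<lambda>k \<sigma>. g k \<sigma> - m k", OF V _ _ refl local centered False])
      fix k assume k: "k \<in> U"
      show "E k \<subseteq> {1..n}" using empty.prems(3) k by blast
      show "flip_invariant n (E k) (\<lambda>\<sigma>. g k \<sigma> - m k)"
        using empty.prems(4)[of k] k by (simp add: flip_invariant_def)
    qed
    then show ?thesis using False by simp
  qed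
next
  case (insert k S)
  let ?w = "\<lambda>U S \<sigma>. (\<Prod>k\<in>U. g k \<sigma> - m k) * (\<Prod>k\<in>S. g k \<sigma>)"
  let ?P = "\<lambda>U. perc q S (\<lambda>A. of_bool (entangled E V (U \<union> A)))"
  let ?Z = "\<lambda>U. \<Sum>\<sigma>\<in>cube n. ?w U S \<sigma>"
  let ?U = "insert k U"
  have kU: "k \<notin> U" using insert.prems by auto
  have split: "?w U (insert k S) \<sigma> = m k * ?w U S \<sigma> + ?w ?U S \<sigma>" for \<sigma>
    using insert.hyps insert.prems(1) kU by (simp add: algebra_simps)
  have D0: "0 \<le> D" using D cube_nonempty[of n] by (meson abs_ge_zero all_not_in_conv order_trans)
  have P: "?P U \<le> ?P ?U"
    by (rule perc_mono) (use insert.prems in \<open>auto intro: entangled_mono\<close>)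
  have "(1 - q k) * ?Z ?U = (\<Sum>\<sigma>\<in>cube n. (1 - q k) * (g k \<sigma> - m k) * ?w U S \<sigma>)"
    using insert.prems(1) kU by (simp add: sum_distrib_left mult_ac)
  also have "\<dots> \<le> (\<Sum>\<sigma>\<in>cube n. q k * m k * ?w U S \<sigma>)"
  proof (intro sum_mono mult_right_mono)
    fix \<sigma> assume s: "\<sigma> \<in> cube n"
    show "(1 - q k) * (g k \<sigma> - m k) \<le> q k * m k" using insert.prems s by auto
    have "0 \<le> g l \<sigma>" if "l \<in> S" for l
      using insert.prems(5,6)[of l] s that by force
    then show "0 \<le> ?w U S \<sigma>" 
      using insert.prems s by (intro mult_nonneg_nonneg prod_nonneg) auto
  qed
  also have "\<dots> = q k * m k * ?Z U" by (simp add: sum_distrib_left)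
  finally have dom: "(1 - q k) * ?Z ?U \<le> q k * m k * ?Z U" .
  have IH: "\<bar>\<Sum>\<sigma>\<in>cube n. ?w W S \<sigma> * G \<sigma>\<bar> \<le> D * ?P W * ?Z W"
    if W: "W \<in> {U, ?U}" for W
  proof (rule insert.IH)
    show "finite W" "S \<inter> W = {}" using W insert.prems(1,2) insert.hyps by auto
    have sub: "l \<in> U \<union> insert k S" if "l \<in> W \<union> S" for l
      using W that by auto
    fix l assume l: "l \<in> W \<union> S"
    note prems = insert.prems(3-9)[OF sub[OF l]]
    show "E l \<subseteq> {1..n}" "flip_invariant n (E l) (g l)" "0 \<le> m l" "0 \<le> q l" "q l \<le> 1"
      by (fact prems)+
    show "m l \<le> g l \<sigma>" "(1 - q l) * (g l \<sigma> - m l) \<le> q l * m l" if "\<sigma> \<in> cube n" for \<sigma>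
      by (fact prems(4)[OF that] prems(7)[OF that])+
  qed
  have expand: "(\<Sum>\<sigma>\<in>cube n. ?w U (insert k S) \<sigma> * G \<sigma>)
      = m k * (\<Sum>\<sigma>\<in>cube n. ?w U S \<sigma> * G \<sigma>) + (\<Sum>\<sigma>\<in>cube n. ?w ?U S \<sigma> * G \<sigma>)"
    by (simp only: split distrib_right sum.distrib sum_distrib_left mult.assoc)
  have "\<bar>\<Sum>\<sigma>\<in>cube n. ?w U (insert k S) \<sigma> * G \<sigma>\<bar>
      \<le> m k * \<bar>\<Sum>\<sigma>\<in>cube n. ?w U S \<sigma> * G \<sigma>\<bar> + \<bar>\<Sum>\<sigma>\<in>cube n. ?w ?U S \<sigma> * G \<sigma>\<bar>"
    unfolding expand using insert.prems(5)[of k]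
    by (intro order_trans[OF abs_triangle_ineq] add_mono) (simp_all add: abs_mult)
  also have "\<dots> \<le> m k * (D * ?P U * ?Z U) + D * ?P ?U * ?Z ?U"
    by (intro add_mono mult_left_mono IH insert.prems(5)) simp_all
  also have "\<dots> \<le> D * ((1 - q k) * ?P U + q k * ?P ?U) * (m k * ?Z U + ?Z ?U)"
  proof -
    have *: "c * (D * x * z) + D * y * t \<le> D * ((1 - r) * x + r * y) * (c * z + t)"
      if "x \<le> y" "(1 - r) * t \<le> r * c * z" for x y z t r c
    proof -
      have "0 \<le> D * (y - x) * (r * c * z - (1 - r) * t)"
        using D0 that by (intro mult_nonneg_nonneg) auto
      then show ?thesis by (simp add: algebra_simps)
    qed
    show ?thesis using P dom by (rule *)
  qed
  also have "m k * ?Z U + ?Z ?U = (\<Sum>\<sigma>\<in>cube n. ?w U (insert k S) \<sigma>)"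
    unfolding split by (simp add: sum.distrib sum_distrib_left)
  also have "(1 - q k) * ?P U + q k * ?P ?U
      = perc q (insert k S) (\<lambda>A. of_bool (entangled E V (U \<union> A)))"
    using insert.hyps by (subst perc_insert) auto
  finally show ?case .
qed

lemma perc_entangled_le_trails:
  assumes "V \<subseteq> {1..n}" "finite S" "card S \<le> d"
    and "\<And>k. k \<in> S \<Longrightarrow> E k \<subseteq> {1..n}"
    and "\<And>k. k \<in> S \<Longrightarrow> 0 \<le> q k" "\<And>k. k \<in> S \<Longrightarrow> q k \<le> 1"
  shows "perc q S (\<lambda>A. of_bool (entangled E V A))
    \<le> (\<Sum>x\<in>{1..n::nat}. \<Sum>y\<in>{1..n} - {x}. of_bool (x \<in> V \<and> y \<in> V)
          * trails (\<lambda>k u v. q k * of_bool (u \<in> E k \<and> v \<in> E k)) {1..n} d S x y)"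
proof -
  let ?c = "\<lambda>x y A. of_bool (x \<in> V \<and> y \<in> V) * of_bool (connected_by E A x y) :: real"
  have "perc q S (\<lambda>A. of_bool (entangled E V A))
      \<le> perc q S (\<lambda>A. \<Sum>x\<in>{1..n}. \<Sum>y\<in>{1..n} - {x}. ?c x y A)"
  proof (rule perc_mono)
    fix A
    show "of_bool (entangled E V A) \<le> (\<Sum>x\<in>{1..n}. \<Sum>y\<in>{1..n} - {x}. ?c x y A)"
    proof (cases "entangled E V A")
      case True
      then obtain x y where xy: "x \<in> V" "y \<in> V - {x}" "connected_by E A x y"
        by (auto simp: entangled_def)
      then have "1 = ?c x y A" by simp
      also have "\<dots> \<le> (\<Sum>y\<in>{1..n} - {x}. ?c x y A)"
        by (rule member_le_sum) (use xy assms(1) in auto)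
      also have "\<dots> \<le> (\<Sum>x\<in>{1..n}. \<Sum>y\<in>{1..n} - {x}. ?c x y A)"
        by (rule member_le_sum[where f="\<lambda>x. \<Sum>y\<in>{1..n} - {x}. ?c x y A"])
          (use xy assms(1) in \<open>auto intro!: sum_nonneg\<close>)
      finally show ?thesis using True by simp
    qed (auto intro!: sum_nonneg)
  qed (use assms in auto)
  also have "\<dots> = (\<Sum>x\<in>{1..n}. \<Sum>y\<in>{1..n} - {x}. of_bool (x \<in> V \<and> y \<in> V)
      * perc q S (\<lambda>A. of_bool (connected_by E A x y)))"
    by (simp only: perc_sum perc_scale)
  also have "\<dots> \<le> (\<Sum>x\<in>{1..n::nat}. \<Sum>y\<in>{1..n} - {x}. of_bool (x \<in> V \<and> y \<in> V)
          * trails (\<lambda>k u v. q k * of_bool (u \<in> E k \<and> v \<in> E k)) {1..n} d S x y)"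
    using assms by (intro sum_mono mult_left_mono perc_connected_le_trails) auto
  finally show ?thesis .
qed

section \<open>Free energy of a fixed disorder\<close>

lemma abs_le_sup_norm: "x \<in> cube p \<Longrightarrow> \<bar>f x\<bar> \<le> sup_norm p f"
  unfolding sup_norm_def by (intro Max_ge) auto

lemma sup_norm_nonneg: "0 \<le> sup_norm p f"
  by (meson abs_ge_zero abs_le_sup_norm cube_nonempty equals0I order_trans)

definition log_mean_exp :: "real \<Rightarrow> nat \<Rightarrow> ((nat \<Rightarrow> real) \<Rightarrow> real) \<Rightarrow> real" where
  "log_mean_exp \<beta> n f = ln ((\<Sum>\<sigma>\<in>cube n. exp (\<beta> * f \<sigma>)) / 2 ^ n)"

lemma mean_le_bounds:
  fixes h :: "(nat \<Rightarrow> real) \<Rightarrow> real"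
  assumes "\<And>\<sigma>. \<sigma> \<in> cube n \<Longrightarrow> lo \<le> h \<sigma>" "\<And>\<sigma>. \<sigma> \<in> cube n \<Longrightarrow> h \<sigma> \<le> hi"
  shows "lo \<le> (\<Sum>\<sigma>\<in>cube n. h \<sigma>) / 2 ^ n" "(\<Sum>\<sigma>\<in>cube n. h \<sigma>) / 2 ^ n \<le> hi"
  using sum_bounded_below[of "cube n" lo h] sum_bounded_above[of "cube n" h hi] assms
  by (simp_all add: card_cube field_simps)

lemma exp_clause_bounds:
  assumes "\<beta> > 0" "x \<in> cube p"
  shows "exp (- (\<beta> * sup_norm p f)) \<le> exp (\<beta> * f x)" "exp (\<beta> * f x) \<le> exp (\<beta> * sup_norm p f)"
proof -
  have "\<bar>\<beta> * f x\<bar> \<le> \<beta> * sup_norm p f"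
    using assms abs_le_sup_norm[of x p f] by (simp add: abs_mult)
  then show "exp (- (\<beta> * sup_norm p f)) \<le> exp (\<beta> * f x)" "exp (\<beta> * f x) \<le> exp (\<beta> * sup_norm p f)"
    by auto
qed

lemma abs_log_mean_exp_le:
  assumes "\<beta> > 0"
  shows "\<bar>log_mean_exp \<beta> p f\<bar> \<le> \<beta> * sup_norm p f"
proof -
  let ?a = "(\<Sum>\<sigma>\<in>cube p. exp (\<beta> * f \<sigma>)) / 2 ^ p"
  have b: "exp (- (\<beta> * sup_norm p f)) \<le> ?a" "?a \<le> exp (\<beta> * sup_norm p f)"
    by (rule mean_le_bounds; rule exp_clause_bounds[OF assms]; assumption)+
  have a: "0 < ?a" using less_le_trans[OF exp_gt_zero b(1)] .
  have "- (\<beta> * sup_norm p f) \<le> ln ?a" using b(1) a by (subst ln_ge_iff) auto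
  moreover have "ln ?a \<le> ln (exp (\<beta> * sup_norm p f))" using b(2) a by (subst ln_le_cancel_iff) auto
  ultimately show ?thesis unfolding log_mean_exp_def ln_exp by (intro abs_leI) linarith+
qed

definition partition_function ::
    "real \<Rightarrow> nat \<Rightarrow> nat \<Rightarrow> (nat \<Rightarrow> (nat \<Rightarrow> real) \<Rightarrow> real) \<Rightarrow> (nat \<Rightarrow> nat \<Rightarrow> nat) \<Rightarrow> nat \<Rightarrow> real" where
  "partition_function \<beta> p N \<Theta> I n = (\<Sum>\<sigma>\<in>cube N. exp (\<beta> * hamiltonian p \<Theta> n I \<sigma>))"

lemma restrict_in_cube:
  assumes "\<sigma> \<in> cube N" "\<iota> ` {1..p} \<subseteq> {1..N}"
  shows "(\<lambda>i\<in>{1..p}. \<sigma> (\<iota> i)) \<in> cube p"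
  unfolding cube_def
proof (intro PiE_I)
  fix i assume "i \<in> {1..p}"
  moreover then have "\<iota> i \<in> {1..N}" using assms(2) by blast
  then have "\<sigma> (\<iota> i) \<in> {-1, 1}" using assms(1) unfolding cube_def by (rule PiE_mem[rotated])
  ultimately show "(\<lambda>i\<in>{1..p}. \<sigma> (\<iota> i)) i \<in> {-1, 1}" by (simp only: restrict_apply if_True)
qed (simp only: restrict_apply if_False)

lemma flip_invariant_clause:
  assumes "\<iota> ` {1..p} \<subseteq> {1..N}"
    and sym: "\<And>\<sigma>. \<sigma> \<in> cube p \<Longrightarrow> f \<sigma> = f (\<lambda>i\<in>{1..p}. - \<sigma> i)"
  shows "flip_invariant N (\<iota> ` {1..p}) (\<lambda>\<sigma>. exp (\<beta> * f (\<lambda>i\<in>{1..p}. \<sigma> (\<iota> i))))"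
  unfolding flip_invariant_def
proof (intro allI impI ballI)
  fix C \<sigma> assume C: "C \<subseteq> {1..N}" "\<iota> ` {1..p} \<subseteq> C \<or> \<iota> ` {1..p} \<inter> C = {}" and s: "\<sigma> \<in> cube N"
  let ?r = "\<lambda>i\<in>{1..p}. \<sigma> (\<iota> i)"
  have r: "?r \<in> cube p" using restrict_in_cube assms(1) s by blast
  from C(2) have "f (\<lambda>i\<in>{1..p}. flip C \<sigma> (\<iota> i)) = f ?r"
  proof
    assume "\<iota> ` {1..p} \<subseteq> C"
    then have "(\<lambda>i\<in>{1..p}. flip C \<sigma> (\<iota> i)) = (\<lambda>i\<in>{1..p}. - ?r i)"
      by (auto simp: flip_def fun_eq_iff restrict_def image_subset_iff)
    then show ?thesis using sym[OF r] by simp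
  next
    assume "\<iota> ` {1..p} \<inter> C = {}"
    then have "\<iota> i \<notin> C" if "i \<in> {1..p}" for i using that by blast
    then have "(\<lambda>i\<in>{1..p}. flip C \<sigma> (\<iota> i)) = ?r"
      by (intro restrict_ext) (simp only: flip_def if_False)
    then show ?thesis by simp
  qed
  then show "exp (\<beta> * f (\<lambda>i\<in>{1..p}. flip C \<sigma> (\<iota> i))) = exp (\<beta> * f ?r)" by simp
qed

text \<open>
  The flips of the \<open>p\<close> vertices of a clause turn any configuration on them into every element of the
  cube exactly once.
\<close>

lemma sum_over_flips:
  fixes h :: "(nat \<Rightarrow> real) \<Rightarrow> real"
  assumes "\<sigma> \<in> cube N" "\<iota> ` {1..p} \<subseteq> {1..N}" "inj_on \<iota> {1..p}"
  shows "(\<Sum>T\<in>Pow (\<iota> ` {1..p}). h (\<lambda>i\<in>{1..p}. flip T \<sigma> (\<iota> i))) = (\<Sum>\<tau>\<in>cube p. h \<tau>)"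
proof (rule sum.reindex_bij_witness[of _
      "\<lambda>\<tau>. {\<iota> i | i. i \<in> {1..p} \<and> \<tau> i \<noteq> \<sigma> (\<iota> i)}" "\<lambda>T. \<lambda>i\<in>{1..p}. flip T \<sigma> (\<iota> i)"])
  have pm: "\<sigma> (\<iota> i) = 1 \<or> \<sigma> (\<iota> i) = -1" if "i \<in> {1..p}" for i
    using PiE_mem[OF assms(1)[unfolded cube_def], of "\<iota> i"] assms(2) that by blast
  fix T assume T: "T \<in> Pow (\<iota> ` {1..p})"
  then have T': "T \<subseteq> {1..N}" using assms(2) by blast
  have ne: "(\<lambda>i\<in>{1..p}. flip T \<sigma> (\<iota> i)) i \<noteq> \<sigma> (\<iota> i) \<longleftrightarrow> \<iota> i \<in> T" if "i \<in> {1..p}" for i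
    using pm[OF that] that by (auto simp: flip_def)
  show "{\<iota> i | i. i \<in> {1..p} \<and> (\<lambda>i\<in>{1..p}. flip T \<sigma> (\<iota> i)) i \<noteq> \<sigma> (\<iota> i)} = T"
    using T ne by blast
  show "(\<lambda>i\<in>{1..p}. flip T \<sigma> (\<iota> i)) \<in> cube p"
    by (rule restrict_in_cube[OF flip_in_cube[OF T' assms(1)] assms(2)])
next
  have pm: "\<sigma> (\<iota> i) = 1 \<or> \<sigma> (\<iota> i) = -1" if "i \<in> {1..p}" for i
    using PiE_mem[OF assms(1)[unfolded cube_def], of "\<iota> i"] assms(2) that by blast
  fix \<tau> assume t: "\<tau> \<in> cube p"
  then have tm: "\<tau> i = 1 \<or> \<tau> i = -1" if "i \<in> {1..p}" for i
    using PiE_mem[OF t[unfolded cube_def] that] by blast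
  let ?T = "{\<iota> i | i. i \<in> {1..p} \<and> \<tau> i \<noteq> \<sigma> (\<iota> i)}"
  have mem: "\<iota> i \<in> ?T \<longleftrightarrow> \<tau> i \<noteq> \<sigma> (\<iota> i)" if "i \<in> {1..p}" for i
    using that assms(3) by (auto dest: inj_onD)
  show "(\<lambda>i\<in>{1..p}. flip ?T \<sigma> (\<iota> i)) = \<tau>"
  proof
    fix i
    show "(\<lambda>i\<in>{1..p}. flip ?T \<sigma> (\<iota> i)) i = \<tau> i"
    proof (cases "i \<in> {1..p}")
      case True
      have "flip ?T \<sigma> (\<iota> i) = \<tau> i"
        unfolding flip_def mem[OF True] using pm[OF True] tm[OF True] by auto
      then show ?thesis using True by simp
    next
      case False
      then show ?thesis using t unfolding cube_def by (auto simp: PiE_def extensional_def)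
    qed
  qed
  show "?T \<in> Pow (\<iota> ` {1..p})" by auto
qed auto

lemma abs_ln_diff_le:
  fixes a b lo hi P :: real
  assumes "0 < lo" "lo \<le> a" "lo \<le> b" "\<bar>a - b\<bar> \<le> (hi - lo) * P" "0 \<le> P"
  shows "\<bar>ln a - ln b\<bar> \<le> hi / lo * P"
proof -
  have *: "ln x - ln y \<le> hi / lo * P"
    if "lo \<le> x" "lo \<le> y" "x - y \<le> (hi - lo) * P" for x y
  proof -
    have "ln x - ln y = ln (x / y)" using that assms(1) by (simp add: ln_div)
    also have "\<dots> \<le> x / y - 1" using that assms(1) by (intro ln_le_minus_one) auto
    also have "\<dots> = (x - y) / y" using that assms(1) by (simp add: field_simps)
    also have "\<dots> \<le> max 0 (x - y) / y" using that assms(1) by (intro divide_right_mono) auto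
    also have "\<dots> \<le> max 0 (x - y) / lo" using that assms(1) by (intro divide_left_mono) auto
    also have "\<dots> \<le> (hi * P) / lo"
    proof (intro divide_right_mono)
      have "0 \<le> (hi - lo) * P" using assms(4) by linarith
      moreover have "(hi - lo) * P \<le> hi * P" using assms(1,5) by (simp add: mult_right_mono)
      ultimately show "max 0 (x - y) \<le> hi * P" using that by auto
    qed (use assms in auto)
    finally show ?thesis by simp
  qed
  have "a - b \<le> (hi - lo) * P" "b - a \<le> (hi - lo) * P" using assms(4) by linarith+
  then show ?thesis using *[OF assms(2,3)] *[OF assms(3,2)] by (intro abs_leI) simp_all
qed

definition valid_disorder ::
    "nat \<Rightarrow> nat \<Rightarrow> (nat \<Rightarrow> (nat \<Rightarrow> real) \<Rightarrow> real) \<Rightarrow> (nat \<Rightarrow> nat \<Rightarrow> nat) \<Rightarrow> bool" where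
  "valid_disorder p N \<Theta> I \<longleftrightarrow> (\<forall>k\<ge>1. I k ` {1..p} \<subseteq> {1..N} \<and> inj_on (I k) {1..p} \<and>
     (\<forall>\<sigma>\<in>cube p. \<Theta> k \<sigma> = \<Theta> k (\<lambda>i\<in>{1..p}. - \<sigma> i)))"

text \<open>
  With \<open>lo\<close> and \<open>hi\<close> the bounds \<open>exp (- \<beta> s)\<close> and \<open>exp (\<beta> s)\<close> of the clause weight, \<open>s\<close> being the sup
  norm, this is \<open>1 - lo / hi\<close>.
\<close>

definition opening_prob :: "real \<Rightarrow> nat \<Rightarrow> ((nat \<Rightarrow> real) \<Rightarrow> real) \<Rightarrow> real" where
  "opening_prob \<beta> p f = 1 - exp (- 2 * \<beta> * sup_norm p f)"

text \<open>
  An upper bound for the percolation probability that clause \<open>Suc n\<close> contains two vertices which are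
  already connected through the first \<open>n\<close> clauses, that is, for the probability that it closes a
  cycle.
\<close>

definition cycle_weight ::
    "real \<Rightarrow> nat \<Rightarrow> nat \<Rightarrow> (nat \<Rightarrow> (nat \<Rightarrow> real) \<Rightarrow> real) \<Rightarrow> (nat \<Rightarrow> nat \<Rightarrow> nat) \<Rightarrow> nat \<Rightarrow> real" where
  "cycle_weight \<beta> p N \<Theta> I n = (\<Sum>x\<in>{1..N}. \<Sum>y\<in>{1..N} - {x}.
     of_bool (x \<in> I (Suc n) ` {1..p} \<and> y \<in> I (Suc n) ` {1..p}) *
     trails (\<lambda>k u v. opening_prob \<beta> p (\<Theta> k) * of_bool (u \<in> I k ` {1..p} \<and> v \<in> I k ` {1..p}))
       {1..N} n {1..n} x y)"

lemma partition_function_pos: "0 < partition_function \<beta> p N \<Theta> I n"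
  unfolding partition_function_def by (intro sum_pos) auto

lemma partition_function_eq:
  "partition_function \<beta> p N \<Theta> I n
    = (\<Sum>\<sigma>\<in>cube N. \<Prod>k\<in>{1..n}. exp (\<beta> * \<Theta> k (\<lambda>i\<in>{1..p}. \<sigma> (I k i))))"
  unfolding partition_function_def hamiltonian_def sum_distrib_left by (simp add: exp_sum)

lemma partition_function_Suc_bounds:
  fixes n :: nat
  assumes "\<beta> > 0" "valid_disorder p N \<Theta> I"
  defines "s \<equiv> sup_norm p (\<Theta> (Suc n))"
    and "Z \<equiv> partition_function \<beta> p N \<Theta> I"
  shows "exp (- (\<beta> * s)) * Z n \<le> Z (Suc n)" "Z (Suc n) \<le> exp (\<beta> * s) * Z n"
proof -
  let ?w = "\<lambda>\<sigma>. \<Prod>k\<in>{1..n}. exp (\<beta> * \<Theta> k (\<lambda>i\<in>{1..p}. \<sigma> (I k i)))"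
  let ?g = "\<lambda>\<sigma>. exp (\<beta> * \<Theta> (Suc n) (\<lambda>i\<in>{1..p}. \<sigma> (I (Suc n) i)))"
  have Z: "Z (Suc n) = (\<Sum>\<sigma>\<in>cube N. ?g \<sigma> * ?w \<sigma>)"
    by (simp add: Z_def partition_function_eq mult.commute)
  have g: "exp (- (\<beta> * s)) \<le> ?g \<sigma>" "?g \<sigma> \<le> exp (\<beta> * s)" if "\<sigma> \<in> cube N" for \<sigma>
    using exp_clause_bounds[OF assms(1) restrict_in_cube[OF that], of "I (Suc n)" p] assms(2)
    unfolding s_def valid_disorder_def by (auto simp del: exp_le_cancel_iff)
  have w: "0 \<le> ?w \<sigma>" for \<sigma> by (intro prod_nonneg) auto
  show "exp (- (\<beta> * s)) * Z n \<le> Z (Suc n)" "Z (Suc n) \<le> exp (\<beta> * s) * Z n"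
    unfolding Z unfolding Z_def partition_function_eq sum_distrib_left
    by (intro sum_mono mult_right_mono g w; assumption)+
qed

lemma abs_ln_partition_function_Suc_le:
  assumes "\<beta> > 0" "valid_disorder p N \<Theta> I"
  shows "\<bar>ln (partition_function \<beta> p N \<Theta> I (Suc n)) - ln (partition_function \<beta> p N \<Theta> I n)\<bar>
    \<le> \<beta> * sup_norm p (\<Theta> (Suc n))"
proof -
  let ?Z = "partition_function \<beta> p N \<Theta> I" and ?s = "sup_norm p (\<Theta> (Suc n))"
  have pos: "0 < ?Z n" "0 < ?Z (Suc n)" by (rule partition_function_pos)+
  have "ln (exp (- (\<beta> * ?s)) * ?Z n) \<le> ln (?Z (Suc n))"
    using partition_function_Suc_bounds(1)[OF assms] pos by (subst ln_le_cancel_iff) auto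
  moreover have "ln (?Z (Suc n)) \<le> ln (exp (\<beta> * ?s) * ?Z n)"
    using partition_function_Suc_bounds(2)[OF assms] pos by (subst ln_le_cancel_iff) auto
  ultimately show ?thesis using pos by (simp add: ln_mult)
qed

text \<open>
  The quotient \<open>Z (Suc n) / Z n\<close> is the Gibbs mean of the new clause weight \<open>g\<close>. Centering \<open>g\<close> at its
  uniform mean \<open>a\<close> gives a function that averages to \<open>0\<close> over the flips of the clause and is bounded by
  the oscillation of \<open>g\<close>, so percolation bounds the distance from the quotient to \<open>a\<close>.
\<close>

lemma log_increment_le_cycle_weight:
  assumes "\<beta> > 0" and valid: "valid_disorder p N \<Theta> I"
  shows "\<bar>ln (partition_function \<beta> p N \<Theta> I (Suc n)) - ln (partition_function \<beta> p N \<Theta> I n)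
      - log_mean_exp \<beta> p (\<Theta> (Suc n))\<bar>
    \<le> exp (2 * \<beta> * sup_norm p (\<Theta> (Suc n))) * cycle_weight \<beta> p N \<Theta> I n"
proof -
  let ?Z = "partition_function \<beta> p N \<Theta> I" and ?s = "sup_norm p (\<Theta> (Suc n))"
  let ?E = "\<lambda>k. I k ` {1..p}"
  let ?g = "\<lambda>k \<sigma>. exp (\<beta> * \<Theta> k (\<lambda>i\<in>{1..p}. \<sigma> (I k i)))"
  let ?m = "\<lambda>k. exp (- (\<beta> * sup_norm p (\<Theta> k)))"
  let ?q = "\<lambda>k. opening_prob \<beta> p (\<Theta> k)"
  let ?S = "{1..n}" and ?V = "?E (Suc n)"
  let ?lo = "exp (- (\<beta> * ?s))" and ?hi = "exp (\<beta> * ?s)"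
  define a where "a = (\<Sum>\<tau>\<in>cube p. exp (\<beta> * \<Theta> (Suc n) \<tau>)) / 2 ^ p"
  define G where "G \<sigma> = ?g (Suc n) \<sigma> - a" for \<sigma>
  define P where "P = perc ?q ?S (\<lambda>A. of_bool (entangled ?E ?V ({} \<union> A)))"
  have I: "?E k \<subseteq> {1..N}" "inj_on (I k) {1..p}" if "k \<ge> 1" for k
    using valid that by (auto simp: valid_disorder_def)
  have q01: "0 \<le> ?q k" "?q k \<le> 1" for k
    using assms(1) sup_norm_nonneg[of p "\<Theta> k"] by (simp_all add: opening_prob_def)
  have g: "?m k \<le> ?g k \<sigma>" "?g k \<sigma> \<le> exp (\<beta> * sup_norm p (\<Theta> k))"
    if "\<sigma> \<in> cube N" "k \<ge> 1" for k \<sigma>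
    using exp_clause_bounds[OF assms(1) restrict_in_cube[OF that(1) I(1)[OF that(2)]], of "\<Theta> k"]
    by (auto simp del: exp_le_cancel_iff)
  have a: "?lo \<le> a" "a \<le> ?hi"
    unfolding a_def by (rule mean_le_bounds; rule exp_clause_bounds[OF assms(1)]; assumption)+
  have Zn: "?Z n = (\<Sum>\<sigma>\<in>cube N. (\<Prod>k\<in>{}. ?g k \<sigma> - ?m k) * (\<Prod>k\<in>?S. ?g k \<sigma>))"
    by (simp add: partition_function_eq)
  have ZG: "?Z (Suc n) - a * ?Z n
      = (\<Sum>\<sigma>\<in>cube N. (\<Prod>k\<in>{}. ?g k \<sigma> - ?m k) * (\<Prod>k\<in>?S. ?g k \<sigma>) * G \<sigma>)"
    unfolding partition_function_eq G_def
    by (simp add: algebra_simps sum_distrib_left sum_subtractf)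
  have bound: "\<bar>\<Sum>\<sigma>\<in>cube N. (\<Prod>k\<in>{}. ?g k \<sigma> - ?m k) * (\<Prod>k\<in>?S. ?g k \<sigma>) * G \<sigma>\<bar>
      \<le> (?hi - ?lo) * P * (\<Sum>\<sigma>\<in>cube N. (\<Prod>k\<in>{}. ?g k \<sigma> - ?m k) * (\<Prod>k\<in>?S. ?g k \<sigma>))"
    unfolding P_def
  proof (rule centered_expectation_le_perc)
    fix k assume "k \<in> {} \<union> ?S"
    then have k: "k \<ge> 1" by simp
    show "?E k \<subseteq> {1..N}" using I k by blast
    show "flip_invariant N (?E k) (?g k)"
      using valid k unfolding valid_disorder_def by (intro flip_invariant_clause) blast+
    show "0 \<le> ?m k" by simp
    show "0 \<le> ?q k" "?q k \<le> 1" by (rule q01)+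
    fix \<sigma> assume s: "\<sigma> \<in> cube N"
    show "?m k \<le> ?g k \<sigma>" by (rule g(1)[OF s k])
    let ?b = "\<beta> * sup_norm p (\<Theta> k)"
    have "(1 - ?q k) * (?g k \<sigma> - ?m k) \<le> exp (- 2 * ?b) * (exp ?b - exp (- ?b))"
      using g(2)[OF s k] by (simp add: opening_prob_def mult.assoc del: exp_le_cancel_iff)
    also have "\<dots> = ?q k * ?m k"
      by (simp add: opening_prob_def algebra_simps flip: exp_add)
    finally show "(1 - ?q k) * (?g k \<sigma> - ?m k) \<le> ?q k * ?m k" .
  next
    show "?V \<subseteq> {1..N}" using I by simp
  next
    fix \<sigma> \<tau> :: "nat \<Rightarrow> real" assume "\<And>x. x \<in> ?V \<Longrightarrow> \<sigma> x = \<tau> x"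
    then have "(\<lambda>i\<in>{1..p}. \<sigma> (I (Suc n) i)) = (\<lambda>i\<in>{1..p}. \<tau> (I (Suc n) i))"
      by (auto simp: fun_eq_iff restrict_def)
    then show "G \<sigma> = G \<tau>" by (simp add: G_def)
  next
    fix \<sigma> assume s: "\<sigma> \<in> cube N"
    have "(\<Sum>T\<in>Pow ?V. G (flip T \<sigma>)) = (\<Sum>T\<in>Pow ?V. ?g (Suc n) (flip T \<sigma>)) - 2 ^ p * a"
      using I[of "Suc n"] by (simp add: G_def sum_subtractf card_Pow card_image)
    also have "(\<Sum>T\<in>Pow ?V. ?g (Suc n) (flip T \<sigma>)) = (\<Sum>\<tau>\<in>cube p. exp (\<beta> * \<Theta> (Suc n) \<tau>))"
      using I[of "Suc n"] s by (intro sum_over_flips) auto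
    finally show "(\<Sum>T\<in>Pow ?V. G (flip T \<sigma>)) = 0" by (simp add: a_def)
    have "?lo \<le> ?g (Suc n) \<sigma>" "?g (Suc n) \<sigma> \<le> ?hi" using g[OF s, of "Suc n"] by (auto simp del: exp_le_cancel_iff)
    then show "\<bar>G \<sigma>\<bar> \<le> ?hi - ?lo" using a unfolding G_def by linarith
  qed auto
  have "\<bar>?Z (Suc n) - a * ?Z n\<bar> \<le> (?hi - ?lo) * P * ?Z n"
    using bound unfolding ZG Zn[symmetric] .
  moreover have pos: "0 < ?Z n" "0 < ?Z (Suc n)" by (rule partition_function_pos)+
  ultimately have "\<bar>?Z (Suc n) / ?Z n - a\<bar> \<le> (?hi - ?lo) * P"
    by (simp add: field_simps abs_le_iff)
  moreover have "?lo \<le> ?Z (Suc n) / ?Z n"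
    using partition_function_Suc_bounds(1)[OF assms, of n] pos by (simp add: field_simps)
  moreover have "0 \<le> P"
    using perc_mono[of ?S ?q "\<lambda>_. 0" "\<lambda>A. of_bool (entangled ?E ?V ({} \<union> A))"] q01
    by (simp add: P_def perc_const)
  ultimately have "\<bar>ln (?Z (Suc n) / ?Z n) - ln a\<bar> \<le> ?hi / ?lo * P"
    using a by (intro abs_ln_diff_le) auto
  also have "ln (?Z (Suc n) / ?Z n) - ln a = ln (?Z (Suc n)) - ln (?Z n) - log_mean_exp \<beta> p (\<Theta> (Suc n))"
    using pos by (simp add: ln_div log_mean_exp_def a_def)
  also have "?hi / ?lo = exp (2 * \<beta> * ?s)"
    by (simp flip: exp_diff)
  also have "exp (2 * \<beta> * ?s) * P \<le> exp (2 * \<beta> * ?s) * cycle_weight \<beta> p N \<Theta> I n"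
  proof (intro mult_left_mono)
    show "P \<le> cycle_weight \<beta> p N \<Theta> I n"
      unfolding P_def cycle_weight_def Un_empty_left
      by (rule perc_entangled_le_trails) (use I q01 in auto)
  qed simp
  finally show ?thesis .
qed

lemma trails_nonneg:
  assumes "\<And>k u v. 0 \<le> a k u v"
  shows "0 \<le> trails a V d S x y"
  by (induction d arbitrary: S x) (auto intro!: add_nonneg_nonneg sum_nonneg mult_nonneg_nonneg assms)

lemma opening_prob_nonneg: "\<beta> > 0 \<Longrightarrow> 0 \<le> opening_prob \<beta> p f"
  using sup_norm_nonneg[of p f] by (simp add: opening_prob_def)

lemma cycle_weight_nonneg: "\<beta> > 0 \<Longrightarrow> 0 \<le> cycle_weight \<beta> p N \<Theta> I n"
  unfolding cycle_weight_def
  by (intro sum_nonneg mult_nonneg_nonneg trails_nonneg) (auto intro: opening_prob_nonneg)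

text \<open>
  Only second moments of the sup norm are available, so the factor \<open>exp (2 * \<beta> * s)\<close> must not be
  integrated. It is used for \<open>s \<le> R\<close>; for larger \<open>s\<close> the trivial bound \<open>2 * \<beta> * s\<close> is at most
  \<open>2 * \<beta> / R * s\<^sup>2\<close>.
\<close>

lemma log_increment_le_truncated:
  assumes "\<beta> > 0" "valid_disorder p N \<Theta> I" "R > 0"
  shows "\<bar>ln (partition_function \<beta> p N \<Theta> I (Suc n)) - ln (partition_function \<beta> p N \<Theta> I n)
      - log_mean_exp \<beta> p (\<Theta> (Suc n))\<bar>
    \<le> 2 * \<beta> / R * (sup_norm p (\<Theta> (Suc n)))\<^sup>2 + exp (2 * \<beta> * R) * cycle_weight \<beta> p N \<Theta> I n"
    (is "?X \<le> _ * ?s\<^sup>2 + _ * ?c")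
proof (cases "?s \<le> R")
  case True
  have "?X \<le> exp (2 * \<beta> * ?s) * ?c" by (rule log_increment_le_cycle_weight[OF assms(1,2)])
  also have "\<dots> \<le> exp (2 * \<beta> * R) * ?c"
    using True assms(1) by (intro mult_right_mono cycle_weight_nonneg) auto
  also have "\<dots> \<le> 2 * \<beta> / R * ?s\<^sup>2 + exp (2 * \<beta> * R) * ?c" using assms by simp
  finally show ?thesis .
next
  case False
  have "?X \<le> \<beta> * ?s + \<beta> * ?s"
    using abs_ln_partition_function_Suc_le[OF assms(1,2), of n] abs_log_mean_exp_le[OF assms(1), of p "\<Theta> (Suc n)"]
    by linarith
  also have "\<dots> = 2 * \<beta> / R * (?s * R)" using assms by simp
  also have "\<dots> \<le> 2 * \<beta> / R * ?s\<^sup>2"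
    unfolding power2_eq_square using False assms by (intro mult_left_mono) auto
  also have "\<dots> \<le> 2 * \<beta> / R * ?s\<^sup>2 + exp (2 * \<beta> * R) * ?c"
    using cycle_weight_nonneg[OF assms(1)] by simp
  finally show ?thesis .
qed

lemma abs_telescope_le:
  fixes f g :: "nat \<Rightarrow> real"
  assumes "\<And>n. \<bar>f (Suc n) - f n\<bar> \<le> g (Suc n)"
  shows "\<bar>f b - f a\<bar> \<le> (\<Sum>k\<in>{min a b<..max a b}. g k)"
proof -
  have *: "a \<le> b \<Longrightarrow> \<bar>f b - f a\<bar> \<le> (\<Sum>k\<in>{a<..b}. g k)" for a b
  proof (induction b rule: dec_induct)
    case (step n)
    have "{a<..Suc n} = insert (Suc n) {a<..n}" using step by auto
    then show ?case using step assms[of n] by simp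
  qed simp
  show ?thesis using *[of a b] *[of b a] by (cases "a \<le> b") (auto simp: min_def max_def abs_minus_commute)
qed

text \<open>
  The increments of the first \<open>m\<close> clauses are compared with their ideal values, and the clauses between
  \<open>m\<close> and the true number \<open>K\<close> are estimated trivially. A deterministic \<open>m\<close> is what later permits
  taking expectations clause by clause.
\<close>

lemma abs_ln_partition_function_diff_le:
  assumes "\<beta> > 0" "valid_disorder p N \<Theta> I" "R > 0"
  shows "\<bar>ln (partition_function \<beta> p N \<Theta> I K / 2 ^ N) - (\<Sum>k=1..m. log_mean_exp \<beta> p (\<Theta> k))\<bar>
    \<le> \<beta> * (\<Sum>k\<in>{min m K<..max m K}. sup_norm p (\<Theta> k))
      + (\<Sum>k=1..m. 2 * \<beta> / R * (sup_norm p (\<Theta> k))\<^sup>2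
                    + exp (2 * \<beta> * R) * cycle_weight \<beta> p N \<Theta> I (k - 1))"
proof -
  let ?Z = "partition_function \<beta> p N \<Theta> I"
  let ?L = "\<lambda>k. log_mean_exp \<beta> p (\<Theta> k)"
  let ?b = "\<lambda>k. 2 * \<beta> / R * (sup_norm p (\<Theta> k))\<^sup>2 + exp (2 * \<beta> * R) * cycle_weight \<beta> p N \<Theta> I (k - 1)"
  define f where "f n = ln (?Z n) - (\<Sum>k=1..n. ?L k)" for n
  have Z0: "?Z 0 = 2 ^ N" by (simp add: partition_function_def hamiltonian_def card_cube)
  have "\<bar>f m - f 0\<bar> \<le> (\<Sum>k\<in>{min 0 m<..max 0 m}. ?b k)"
  proof (rule abs_telescope_le)
    fix n
    have "f (Suc n) - f n = ln (?Z (Suc n)) - ln (?Z n) - ?L (Suc n)" by (simp add: f_def)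
    then show "\<bar>f (Suc n) - f n\<bar> \<le> ?b (Suc n)"
      using log_increment_le_truncated[OF assms, of n] by simp
  qed
  moreover have "\<bar>ln (?Z K) - ln (?Z m)\<bar> \<le> (\<Sum>k\<in>{min m K<..max m K}. \<beta> * sup_norm p (\<Theta> k))"
    by (rule abs_telescope_le[where f="\<lambda>n. ln (?Z n)"], rule abs_ln_partition_function_Suc_le[OF assms(1,2)])
  moreover have "{min 0 m<..max 0 m} = {1..m}" by auto
  moreover have "ln (?Z K / 2 ^ N) = ln (?Z K) - ln (2 ^ N)"
    using partition_function_pos by (subst ln_div) (simp_all add: less_imp_neq[THEN not_sym])
  ultimately show ?thesis
    unfolding f_def Z0 sum_distrib_left by simp
qed

section \<open>Moments of the Poisson law\<close>

lemma poisson_second_moment: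
  assumes "0 < r"
  shows "(\<integral>\<^sup>+n. ennreal ((real n - r)\<^sup>2) \<partial>measure_pmf (poisson_pmf r)) = ennreal r"
proof -
  let ?w = "\<lambda>n. r ^ n / fact n * exp (- r)"
  have 0: "(\<lambda>n. ?w n) sums 1"
  proof -
    have "(\<lambda>n. r ^ n /\<^sub>R fact n * exp (- r)) sums (exp r * exp (- r))"
      by (intro sums_mult2 exp_converges)
    then show ?thesis by (simp add: field_simps flip: exp_add)
  qed
  have shift: "real (Suc n) * ?w (Suc n) = r * ?w n" for n
    by (simp add: field_simps del: of_nat_Suc)
  have 1: "(\<lambda>n. real n * ?w n) sums r"
  proof -
    have "(\<lambda>n. real (Suc n) * ?w (Suc n)) sums r"
      unfolding shift using sums_mult[OF 0, of r] by simp
    then show ?thesis by (subst (asm) sums_Suc_iff) simp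
  qed
  have 2: "(\<lambda>n. real n * (real n - 1) * ?w n) sums r\<^sup>2"
  proof -
    have "real (Suc n) * (real (Suc n) - 1) * ?w (Suc n) = r * (real n * ?w n)" for n
    proof -
      have "real (Suc n) * (real (Suc n) - 1) * ?w (Suc n) = real n * (real (Suc n) * ?w (Suc n))"
        by simp
      then show ?thesis unfolding shift by simp
    qed
    then have "(\<lambda>n. real (Suc n) * (real (Suc n) - 1) * ?w (Suc n)) sums r\<^sup>2"
      using sums_mult[OF 1, of r] by (simp only: power2_eq_square)
    then show ?thesis by (subst (asm) sums_Suc_iff) simp
  qed
  have "(\<lambda>n. real n * (real n - 1) * ?w n + (1 - 2 * r) * (real n * ?w n) + r\<^sup>2 * ?w n)
      sums (r\<^sup>2 + (1 - 2 * r) * r + r\<^sup>2 * 1)"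
    by (intro sums_add sums_mult 0 1 2)
  moreover have "x * (x - 1) * w + (1 - 2 * r) * (x * w) + r\<^sup>2 * w = w * (x - r)\<^sup>2" for x w
    by (simp add: algebra_simps power2_eq_square)
  moreover have "r\<^sup>2 + (1 - 2 * r) * r + r\<^sup>2 * 1 = r"
    by (simp add: algebra_simps power2_eq_square)
  ultimately have s: "(\<lambda>n. ?w n * (real n - r)\<^sup>2) sums r" by (simp only:)
  have "(\<integral>\<^sup>+n. ennreal ((real n - r)\<^sup>2) \<partial>measure_pmf (poisson_pmf r))
      = (\<Sum>n. ennreal (?w n * (real n - r)\<^sup>2))"
    unfolding nn_integral_measure_pmf nn_integral_count_space_nat pmf_poisson[OF assms]
    by (simp only: ennreal_mult'' zero_le_power2)
  also have "\<dots> = ennreal r"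
    using assms by (intro suminf_ennreal_eq s) auto
  finally show ?thesis .
qed

lemma abs_le_square_div_add: "\<bar>x::real\<bar> \<le> x\<^sup>2 / t + t" if "t > 0"
proof -
  have "\<bar>x\<bar> * t \<le> x\<^sup>2 + t * t"
  proof (cases "\<bar>x\<bar> \<le> t")
    case True
    then have "\<bar>x\<bar> * t \<le> t * t" using that by (intro mult_right_mono) auto
    then show ?thesis using zero_le_power2[of x] by linarith
  next
    case False
    then have "\<bar>x\<bar> * t \<le> \<bar>x\<bar> * \<bar>x\<bar>" by (intro mult_left_mono) auto
    also have "\<dots> = x\<^sup>2" by (simp add: power2_eq_square)
    also have "\<dots> \<le> x\<^sup>2 + t * t" by simp
    finally show ?thesis .
  qed
  then show ?thesis using that by (simp add: field_simps)
qed

lemma nn_integral_abs_le_of_second_moment: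
  assumes "X \<in> borel_measurable M" "prob_space M"
    and "(\<integral>\<^sup>+\<omega>. ennreal ((X \<omega>)\<^sup>2) \<partial>M) \<le> ennreal v" "0 < v"
  shows "(\<integral>\<^sup>+\<omega>. ennreal \<bar>X \<omega>\<bar> \<partial>M) \<le> ennreal (2 * sqrt v)"
proof -
  let ?t = "sqrt v"
  have t: "?t > 0" using assms by simp
  have [measurable]: "X \<in> borel_measurable M" by fact
  have "(\<integral>\<^sup>+\<omega>. ennreal \<bar>X \<omega>\<bar> \<partial>M) \<le> (\<integral>\<^sup>+\<omega>. ennreal ((X \<omega>)\<^sup>2) * ennreal (1 / ?t) + ennreal ?t \<partial>M)"
    using t abs_le_square_div_add[OF t]
    by (intro nn_integral_mono) (simp add: divide_inverse flip: ennreal_mult'' ennreal_plus)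
  also have "\<dots> = (\<integral>\<^sup>+\<omega>. ennreal ((X \<omega>)\<^sup>2) \<partial>M) * ennreal (1 / ?t) + ennreal ?t"
    using assms(2) by (simp add: nn_integral_add nn_integral_multc prob_space.emeasure_space_1)
  also have "\<dots> \<le> ennreal v * ennreal (1 / ?t) + ennreal ?t"
    by (intro add_right_mono mult_right_mono assms(3)) simp
  also have "\<dots> = ennreal (v / ?t + ?t)" using assms t by (simp flip: ennreal_mult'' ennreal_plus)
  also have "v / ?t + ?t = 2 * ?t" using assms(4) by (simp add: real_div_sqrt)
  finally show ?thesis .
qed

section \<open>Trails of a constant weight\<close>

text \<open>
  Every step of a trail has at most \<open>card S * (card V - 1)\<close> continuations, so the sum is dominated by
  the geometric series with ratio \<open>r\<close>; the bound \<open>1 / (1 - r)\<close> is a fixed point of the recursion.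
\<close>

lemma trails_const_sum_le:
  assumes "finite V" "finite S" "0 \<le> c" "r < 1" "0 \<le> r" "x \<in> V"
    and "real (card S) * (real (card V) - 1) * c \<le> r"
  shows "(\<Sum>y\<in>V. trails (\<lambda>_ _ _. c) V d S x y) \<le> 1 / (1 - r)"
  using assms(2,6,7)
proof (induction d arbitrary: S x)
  case 0
  then show ?case using assms by (simp add: sum.delta of_bool_def)
next
  case (Suc d)
  let ?t = "trails (\<lambda>_ _ _. c) V d"
  have V1: "0 \<le> real (card V) - 1" "real (card (V - {x})) = real (card V) - 1"
    using Suc.prems(2) card_gt_0_iff[of V] assms(1)
    by (auto simp: Suc_le_eq card_Diff_singleton of_nat_diff)
  have "(\<Sum>y\<in>V. trails (\<lambda>_ _ _. c) V (Suc d) S x y)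
      = (\<Sum>y\<in>V. of_bool (x = y)) + (\<Sum>k\<in>S. \<Sum>v\<in>V - {x}. c * (\<Sum>y\<in>V. ?t (S - {k}) v y))"
    by (simp only: trails.simps sum.distrib sum_distrib_left sum.swap[of _ _ V])
  also have "(\<Sum>y\<in>V. of_bool (x = y)) = (1::real)"
    using Suc.prems(2) assms(1) by (simp add: sum.delta of_bool_def)
  also have "(\<Sum>k\<in>S. \<Sum>v\<in>V - {x}. c * (\<Sum>y\<in>V. ?t (S - {k}) v y)) \<le> (\<Sum>k\<in>S. \<Sum>v\<in>V - {x}. c * (1 / (1 - r)))"
  proof (intro sum_mono mult_left_mono Suc.IH)
    fix k v assume k: "k \<in> S" "v \<in> V - {x}"
    have "real (card (S - {k})) * (real (card V) - 1) * c \<le> real (card S) * (real (card V) - 1) * c"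
      using V1 assms(3) Suc.prems(1) by (intro mult_right_mono) (auto intro: card_mono)
    then show "real (card (S - {k})) * (real (card V) - 1) * c \<le> r" using Suc.prems(3) by linarith
  qed (use Suc.prems assms(3) in auto)
  also have "\<dots> = (real (card S) * (real (card V) - 1) * c) * (1 / (1 - r))" by (simp add: V1(2))
  also have "\<dots> \<le> r * (1 / (1 - r))" using assms(4) Suc.prems(3) by (intro mult_right_mono) auto
  also have "1 + r * (1 / (1 - r)) = 1 / (1 - r)" using assms(4) by (simp add: field_simps)
  finally show ?case by simp
qed

lemma measurable_trails:
  assumes "\<And>k u v. k \<in> S \<Longrightarrow> u \<in> V \<Longrightarrow> v \<in> V \<Longrightarrow> (\<lambda>\<omega>. a \<omega> k u v) \<in> borel_measurable M"
    and "x \<in> V"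
  shows "(\<lambda>\<omega>. trails (a \<omega>) V d S x y) \<in> borel_measurable M"
  using assms
proof (induction d arbitrary: S x)
  case (Suc d)
  show ?case unfolding trails.simps
    by (intro borel_measurable_add borel_measurable_sum borel_measurable_times Suc.IH)
      (use Suc.prems in auto)
qed simp

section \<open>The sources of randomness\<close>

lemma borel_measurable_sup_norm [measurable]: "sup_norm p \<in> borel_measurable (fun_space p)"
  unfolding sup_norm_def fun_space_def by (intro borel_measurable_Max borel_measurable_abs) auto

lemma borel_measurable_log_mean_exp [measurable]:
  "log_mean_exp \<beta> p \<in> borel_measurable (fun_space p)"
proof -
  have [measurable]: "(\<lambda>f. f \<sigma>) \<in> borel_measurable (fun_space p)" if "\<sigma> \<in> cube p" for \<sigma>
    unfolding fun_space_def using that by (rule measurable_component_singleton)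
  show ?thesis unfolding log_mean_exp_def by measurable
qed

lemma borel_measurable_opening_prob [measurable]:
  "opening_prob \<beta> p \<in> borel_measurable (fun_space p)"
  unfolding opening_prob_def by measurable

lemma card_subsets_containing_pair:
  fixes V :: "'v set"
  assumes "finite V" "x \<in> V" "y \<in> V" "x \<noteq> y" "2 \<le> p"
  shows "card {S. S \<subseteq> V \<and> card S = p \<and> x \<in> S \<and> y \<in> S} = (card V - 2) choose (p - 2)"
proof -
  let ?W = "V - {x, y}"
  have "bij_betw (\<lambda>T. T \<union> {x, y}) {T. T \<subseteq> ?W \<and> card T = p - 2}
      {S. S \<subseteq> V \<and> card S = p \<and> x \<in> S \<and> y \<in> S}"
  proof (rule bij_betwI[where g="\<lambda>S. S - {x, y}"])
    show "(\<lambda>T. T \<union> {x, y}) \<in> {T. T \<subseteq> ?W \<and> card T = p - 2}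
        \<rightarrow> {S. S \<subseteq> V \<and> card S = p \<and> x \<in> S \<and> y \<in> S}"
    proof
      fix T assume T: "T \<in> {T. T \<subseteq> ?W \<and> card T = p - 2}"
      then have "finite T" using assms(1) by (auto intro: finite_subset)
      moreover have "T \<inter> {x, y} = {}" using T by auto
      ultimately have "card (T \<union> {x, y}) = p" using T assms by (subst card_Un_disjoint) auto
      then show "T \<union> {x, y} \<in> {S. S \<subseteq> V \<and> card S = p \<and> x \<in> S \<and> y \<in> S}"
        using T assms by auto
    qed
    show "(\<lambda>S. S - {x, y}) \<in> {S. S \<subseteq> V \<and> card S = p \<and> x \<in> S \<and> y \<in> S}
        \<rightarrow> {T. T \<subseteq> ?W \<and> card T = p - 2}"
    proof
      fix S assume S: "S \<in> {S. S \<subseteq> V \<and> card S = p \<and> x \<in> S \<and> y \<in> S}"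
      then have "card (S - {x, y}) = card S - card {x, y}" by (intro card_Diff_subset) auto
      then show "S - {x, y} \<in> {T. T \<subseteq> ?W \<and> card T = p - 2}" using S assms by auto
    qed
  qed auto
  then have "card {S. S \<subseteq> V \<and> card S = p \<and> x \<in> S \<and> y \<in> S} = card {T. T \<subseteq> ?W \<and> card T = p - 2}"
    by (simp add: bij_betw_same_card)
  also have "\<dots> = card ?W choose (p - 2)" using assms(1) by (intro n_subsets) auto
  also have "card ?W = card V - 2" using assms by (subst card_Diff_subset) auto
  finally show ?thesis .
qed

lemma choose_pair_ratio:
  assumes "2 \<le> p" "p \<le> n"
  shows "real ((n - 2) choose (p - 2)) / real (n choose p)
    = real p * (real p - 1) / (real n * (real n - 1))"
proof -
  obtain q where q: "p = Suc (Suc q)" using assms by (metis Suc_le_D numeral_2_eq_2 Suc_le_mono)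
  obtain m where m: "n = Suc (Suc m)" using assms by (metis Suc_le_D numeral_2_eq_2 Suc_le_mono le_trans)
  have 1: "real (Suc (Suc q)) * real (Suc (Suc m) choose Suc (Suc q)) = real (Suc (Suc m)) * real (Suc m choose Suc q)"
    using Suc_times_binomial[of "Suc q" "Suc m"] by (metis of_nat_mult)
  have 2: "real (Suc q) * real (Suc m choose Suc q) = real (Suc m) * real (m choose q)"
    using Suc_times_binomial[of q m] by (metis of_nat_mult)
  have pos: "0 < real (Suc (Suc m) choose Suc (Suc q))" using assms q m by (simp del: binomial_Suc_Suc)
  have "real (m choose q) * (real (Suc (Suc m)) * real (Suc m))
      = real (Suc (Suc q)) * real (Suc q) * real (Suc (Suc m) choose Suc (Suc q))"
    using 1 2 by (metis mult.assoc mult.commute)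
  then show ?thesis using pos unfolding q m
    by (simp add: frac_eq_eq divide_simps mult_ac del: binomial_Suc_Suc)
qed

context diluted_disorder
begin

definition source_alg :: "nat \<Rightarrow> source \<Rightarrow> 'a measure" where
  "source_alg N s = (case s of
      Coupling k \<Rightarrow> vimage_algebra (space M) (\<Theta> k) (fun_space p)
    | Clause k \<Rightarrow> vimage_algebra (space M) (I N k) (PiM {1..p} (\<lambda>_. count_space {1..N}))
    | Count \<Rightarrow> vimage_algebra (space M) (K N) (count_space UNIV))"

abbreviation sources :: "source set" where
  "sources \<equiv> Coupling ` {1..} \<union> Clause ` {1..} \<union> {Count}"

lemma sets_source_alg_subset:
  assumes "N \<ge> p" "s \<in> sources"
  shows "sets (source_alg N s) \<subseteq> sets M"
proof -
  have *: "sets (vimage_algebra (space M) f L) \<subseteq> sets M" if "f \<in> M \<rightarrow>\<^sub>M L" for f and L :: "'x measure"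
    unfolding sets_vimage_algebra using that by (intro sets.sigma_sets_subset) (auto intro: measurable_sets)
  from assms(2) consider k where "s = Coupling k" "k \<ge> 1" | k where "s = Clause k" "k \<ge> 1" | "s = Count"
    by auto
  then show ?thesis
    using *[OF measurable_Theta] *[OF measurable_I[OF assms(1)]] *[OF measurable_K[OF assms(1)]]
    unfolding source_alg_def by cases simp_all
qed

lemma space_source_alg [simp]: "space (source_alg N s) = space M"
  by (simp add: source_alg_def split: source.split)

lemma measurable_of_source:
  assumes "N \<ge> p" "s \<in> sources" "Y \<in> source_alg N s \<rightarrow>\<^sub>M L"
  shows "Y \<in> M \<rightarrow>\<^sub>M L"
  by (rule measurable_mono[THEN subsetD, OF order_refl _ _ _ assms(3)])
    (use sets_source_alg_subset[OF assms(1,2)] in auto)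

lemma indep_vars_sources:
  assumes "N \<ge> p" "T \<subseteq> sources" "\<And>s. s \<in> T \<Longrightarrow> Y s \<in> source_alg N s \<rightarrow>\<^sub>M L s"
  shows "indep_vars L Y T"
  unfolding indep_vars_def2
proof (intro conjI ballI)
  fix s assume "s \<in> T"
  then show "random_variable (L s) (Y s)"
    using measurable_of_source[OF assms(1) _ assms(3)] assms(2) by blast
next
  have "indep_sets (\<lambda>s. sets (source_alg N s)) sources"
    using indep[OF assms(1)]
    by (rule back_subst[where P="\<lambda>F. indep_sets F _"]) (auto simp: source_alg_def fun_eq_iff split: source.split)
  then show "indep_sets (\<lambda>s. {Y s -` A \<inter> space M | A. A \<in> sets (L s)}) T"
  proof (rule indep_sets_mono[OF _ assms(2)])
    fix s assume s: "s \<in> T"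
    show "{Y s -` A \<inter> space M | A. A \<in> sets (L s)} \<subseteq> sets (source_alg N s)"
      using measurable_sets[OF assms(3)[OF s]] by auto
  qed
qed

lemma nn_integral_prod_sources:
  assumes "N \<ge> p" "finite T" "T \<subseteq> sources"
    and "\<And>s. s \<in> T \<Longrightarrow> Y s \<in> borel_measurable (source_alg N s)"
  shows "(\<integral>\<^sup>+\<omega>. (\<Prod>s\<in>T. Y s \<omega>) \<partial>M) = (\<Prod>s\<in>T. \<integral>\<^sup>+\<omega>. Y s \<omega> \<partial>M)"
  by (rule indep_vars_nn_integral[OF assms(2) indep_vars_sources[OF assms(1,3,4)]]) auto

lemma measurable_coupling_source:
  "k \<ge> 1 \<Longrightarrow> f \<in> fun_space p \<rightarrow>\<^sub>M L \<Longrightarrow> (\<lambda>\<omega>. f (\<Theta> k \<omega>)) \<in> source_alg N (Coupling k) \<rightarrow>\<^sub>M L"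
  using measurable_space[OF measurable_Theta, of k]
  by (auto simp: source_alg_def intro!: measurable_compose[OF measurable_vimage_algebra1, of "\<Theta> k"])

lemma measurable_count_source: "(\<lambda>\<omega>. f (K N \<omega>)) \<in> source_alg N Count \<rightarrow>\<^sub>M L" if "f \<in> UNIV \<rightarrow> space L"
  using that by (auto simp: source_alg_def intro!: measurable_compose[OF measurable_vimage_algebra1, of "K N"])

lemma measurable_clause_source:
  assumes "N \<ge> p" "k \<ge> 1" "f \<in> UNIV \<rightarrow> space L"
  shows "(\<lambda>\<omega>. f (I N k \<omega>)) \<in> source_alg N (Clause k) \<rightarrow>\<^sub>M L"
proof -
  have "I N k \<in> space M \<rightarrow> space (PiM {1..p} (\<lambda>_. count_space {1..N}))"
    using measurable_space[OF measurable_I[OF assms(1,2)]] by auto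
  moreover have "f \<in> PiM {1..p} (\<lambda>_. count_space {1..N}) \<rightarrow>\<^sub>M L"
    using assms(3) by (subst count_space_PiM_finite) auto
  ultimately show ?thesis
    unfolding source_alg_def by (auto intro!: measurable_compose[OF measurable_vimage_algebra1, of "I N k"])
qed

lemma nn_integral_Theta:
  assumes "k \<ge> 1" and [measurable]: "f \<in> borel_measurable (fun_space p)"
  shows "(\<integral>\<^sup>+\<omega>. f (\<Theta> k \<omega>) \<partial>M) = (\<integral>\<^sup>+\<omega>. f (\<theta> \<omega>) \<partial>M)"
proof -
  have "(\<integral>\<^sup>+x. f x \<partial>distr M (fun_space p) (\<Theta> k)) = (\<integral>\<^sup>+\<omega>. f (\<Theta> k \<omega>) \<partial>M)"
    by (intro nn_integral_distr measurable_Theta assms(1)) simp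
  moreover have "(\<integral>\<^sup>+x. f x \<partial>distr M (fun_space p) \<theta>) = (\<integral>\<^sup>+\<omega>. f (\<theta> \<omega>) \<partial>M)"
    by (intro nn_integral_distr measurable_theta) simp
  ultimately show ?thesis by (simp add: law_Theta[OF assms(1)])
qed

text \<open>
  There are \<open>(N - 2) choose (p - 2)\<close> clauses through two given vertices, out of \<open>N choose p\<close>.
\<close>

lemma clause_pair_prob:
  assumes "2 \<le> p" "p \<le> N" "k \<ge> 1" "x \<in> {1..N}" "y \<in> {1..N}" "x \<noteq> y"
  shows "(\<integral>\<^sup>+\<omega>. of_bool (x \<in> I N k \<omega> ` {1..p} \<and> y \<in> I N k \<omega> ` {1..p}) \<partial>M)
    = ennreal (real p * (real p - 1) / (real N * (real N - 1)))"
proof -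
  let ?F = "{S. S \<subseteq> {1..N} \<and> card S = p}"
  have fin: "finite ?F" by (rule finite_subset[of _ "Pow {1..N}"]) auto
  have card: "card ?F = N choose p" by (simp add: n_subsets)
  then have ne: "?F \<noteq> {}" using assms(2) by (metis card.empty binomial_eq_0_iff not_less)
  have meas: "(\<lambda>\<omega>. I N k \<omega> ` {1..p}) \<in> M \<rightarrow>\<^sub>M count_space UNIV"
    by (rule measurable_of_source[OF assms(2) _ measurable_clause_source[OF assms(2,3)]]) (use assms in auto)
  have "(\<integral>\<^sup>+\<omega>. of_bool (x \<in> I N k \<omega> ` {1..p} \<and> y \<in> I N k \<omega> ` {1..p}) \<partial>M)
      = (\<integral>\<^sup>+S. of_bool (x \<in> S \<and> y \<in> S) \<partial>distr M (count_space UNIV) (\<lambda>\<omega>. I N k \<omega> ` {1..p}))"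
    by (subst nn_integral_distr[OF meas]) auto
  also have "\<dots> = (\<integral>\<^sup>+S. indicator {S. x \<in> S \<and> y \<in> S} S \<partial>measure_pmf (pmf_of_set ?F))"
    unfolding law_I[OF assms(2,3)] by (intro nn_integral_cong) (auto simp: indicator_def)
  also have "\<dots> = emeasure (measure_pmf (pmf_of_set ?F)) {S. x \<in> S \<and> y \<in> S}"
    by simp
  also have "\<dots> = ennreal (real (card (?F \<inter> {S. x \<in> S \<and> y \<in> S})) / real (card ?F))"
    using ne fin by (rule emeasure_pmf_of_set)
  also have "?F \<inter> {S. x \<in> S \<and> y \<in> S} = {S. S \<subseteq> {1..N} \<and> card S = p \<and> x \<in> S \<and> y \<in> S}" by auto
  also have "card \<dots> = (N - 2) choose (p - 2)"
    using card_subsets_containing_pair[of "{1..N}" x y p] assms by simp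
  finally show ?thesis using assms(1,2) by (simp only: card choose_pair_ratio)
qed

lemma AE_valid_disorder:
  assumes "p \<le> N"
    and sym: "AE \<omega> in M. \<forall>\<sigma>\<in>cube p. \<theta> \<omega> \<sigma> = \<theta> \<omega> (\<lambda>i\<in>{1..p}. - \<sigma> i)"
  shows "AE \<omega> in M. valid_disorder p N (\<lambda>k. \<Theta> k \<omega>) (\<lambda>k. I N k \<omega>)"
proof -
  let ?sym = "\<lambda>f. \<forall>\<sigma>\<in>cube p. f \<sigma> = (f (\<lambda>i\<in>{1..p}. - \<sigma> i) :: real)"
  have neg: "(\<lambda>i\<in>{1..p}. - \<sigma> i) \<in> cube p" if "\<sigma> \<in> cube p" for \<sigma>
    using that unfolding cube_def by (auto simp: PiE_iff)
  have [measurable]: "(\<lambda>f. f \<sigma>) \<in> borel_measurable (fun_space p)" if "\<sigma> \<in> cube p" for \<sigma>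
    unfolding fun_space_def using that by (rule measurable_component_singleton)
  have msym: "{f \<in> space (fun_space p). ?sym f} \<in> sets (fun_space p)"
    using neg by (intro sets.sets_Collect_finite_All borel_measurable_eq) auto
  have "AE \<omega> in M. \<forall>k. k \<ge> 1 \<longrightarrow> I N k \<omega> ` {1..p} \<subseteq> {1..N} \<and> inj_on (I N k \<omega>) {1..p} \<and> ?sym (\<Theta> k \<omega>)"
  proof (unfold AE_all_countable, rule allI, cases)
    fix k :: nat assume k: "k \<ge> 1"
    let ?F = "{S. S \<subseteq> {1..N} \<and> card S = p}"
    have fin: "finite ?F" by (rule finite_subset[of _ "Pow {1..N}"]) auto
    have "card ?F = N choose p" by (simp add: n_subsets)
    then have ne: "?F \<noteq> {}" using assms(1) by (metis card.empty binomial_eq_0_iff not_less)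
    have meas: "(\<lambda>\<omega>. I N k \<omega> ` {1..p}) \<in> M \<rightarrow>\<^sub>M count_space UNIV"
      by (rule measurable_of_source[OF assms(1) _ measurable_clause_source[OF assms(1) k]]) (use k in auto)
    have "AE S in distr M (count_space UNIV) (\<lambda>\<omega>. I N k \<omega> ` {1..p}). S \<subseteq> {1..N} \<and> card S = p"
      unfolding law_I[OF assms(1) k] using fin ne by (simp add: AE_measure_pmf_iff)
    then have "AE \<omega> in M. I N k \<omega> ` {1..p} \<subseteq> {1..N} \<and> card (I N k \<omega> ` {1..p}) = p"
      by (subst (asm) AE_distr_iff[OF meas]) auto
    moreover have "AE f in distr M (fun_space p) (\<Theta> k). ?sym f"
      unfolding law_Theta[OF k] using sym by (subst AE_distr_iff[OF measurable_theta msym]) 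
    then have "AE \<omega> in M. ?sym (\<Theta> k \<omega>)"
      by (subst (asm) AE_distr_iff[OF measurable_Theta[OF k] msym])
    ultimately show "AE \<omega> in M. k \<ge> 1 \<longrightarrow> I N k \<omega> ` {1..p} \<subseteq> {1..N} \<and> inj_on (I N k \<omega>) {1..p} \<and> ?sym (\<Theta> k \<omega>)"
      by eventually_elim (auto intro: eq_card_imp_inj_on)
  qed simp
  then show ?thesis by (simp add: valid_disorder_def)
qed

text \<open>
  The expectation of a trail sum is the trail sum of the expected weight, because the labels along a
  trail are distinct and hence the weights of its steps are independent. The additional factors
  \<open>Y s\<close>, which depend on sources outside the trail, make the induction possible: the first step
  of the trail is moved into them.
\<close>

lemma nn_integral_trails:
  assumes "2 \<le> p" "p \<le> N" "\<beta> > 0"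
    and "finite S" "S \<subseteq> {1..}" "x \<in> {1..N}" "y \<in> {1..N}"
    and "finite T" "T \<subseteq> sources" "T \<inter> (Coupling ` S \<union> Clause ` S) = {}"
    and "\<And>s. s \<in> T \<Longrightarrow> Y s \<in> borel_measurable (source_alg N s)"
    and c: "ennreal c = (\<integral>\<^sup>+\<omega>. ennreal (opening_prob \<beta> p (\<theta> \<omega>)) \<partial>M)
        * ennreal (real p * (real p - 1) / (real N * (real N - 1)))" "0 \<le> c"
  defines "a \<equiv> \<lambda>\<omega> k u v. opening_prob \<beta> p (\<Theta> k \<omega>)
      * of_bool (u \<in> I N k \<omega> ` {1..p} \<and> v \<in> I N k \<omega> ` {1..p})"
  shows "(\<integral>\<^sup>+\<omega>. (\<Prod>s\<in>T. Y s \<omega>) * ennreal (trails (a \<omega>) {1..N} d S x y) \<partial>M)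
    = (\<Prod>s\<in>T. \<integral>\<^sup>+\<omega>. Y s \<omega> \<partial>M) * ennreal (trails (\<lambda>_ _ _. c) {1..N} d S x y)"
  using assms(4-11)
proof (induction d arbitrary: S x T Y)
  case 0
  have "(\<integral>\<^sup>+\<omega>. (\<Prod>s\<in>T. Y s \<omega>) \<partial>M) = (\<Prod>s\<in>T. \<integral>\<^sup>+\<omega>. Y s \<omega> \<partial>M)"
    by (rule nn_integral_prod_sources[OF assms(2)]) (use 0 in auto)
  then show ?case by (cases "x = y") auto
next
  case (Suc d)
  let ?t = "\<lambda>\<omega> k v. trails (a \<omega>) {1..N} d (S - {k}) v y"
  let ?c = "\<lambda>k v. trails (\<lambda>_ _ _. c) {1..N} d (S - {k}) v y"
  let ?b = "\<lambda>k v \<omega>. x \<in> I N k \<omega> ` {1..p} \<and> v \<in> I N k \<omega> ` {1..p}"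
  let ?Y = "\<lambda>\<omega>. \<Prod>s\<in>T. Y s \<omega>" and ?EY = "\<Prod>s\<in>T. \<integral>\<^sup>+\<omega>. Y s \<omega> \<partial>M"
  have q: "0 \<le> opening_prob \<beta> p f" for f by (rule opening_prob_nonneg[OF assms(3)])
  have a0: "0 \<le> a \<omega> k u v" for \<omega> k u v by (simp add: a_def q)
  have t0: "0 \<le> ?t \<omega> k v" "0 \<le> ?c k v" for \<omega> k v
    by (intro trails_nonneg a0 c)+
  have mY [measurable]: "Y s \<in> borel_measurable M" if "s \<in> T" for s
    using measurable_of_source[OF assms(2) _ Suc.prems(8)] that Suc.prems(6) by auto
  have ma [measurable]: "(\<lambda>\<omega>. a \<omega> k u v) \<in> borel_measurable M" if "k \<in> S" for k u v
  proof -
    have k: "k \<ge> 1" using that Suc.prems(2) by auto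
    have [measurable]: "\<Theta> k \<in> M \<rightarrow>\<^sub>M fun_space p" by (rule measurable_Theta[OF k])
    have [measurable]: "(\<lambda>\<omega>. of_bool (u \<in> I N k \<omega> ` {1..p} \<and> v \<in> I N k \<omega> ` {1..p}) :: real) \<in> borel_measurable M"
      by (rule measurable_of_source[OF assms(2) _ measurable_clause_source[OF assms(2) k]]) (use k in auto)
    show ?thesis unfolding a_def by measurable
  qed
  have mt [measurable]: "(\<lambda>\<omega>. ?t \<omega> k v) \<in> borel_measurable M" if "k \<in> S" "v \<in> {1..N}" for k v
    by (rule measurable_trails) (use that in \<open>auto intro: ma\<close>)
  have mYY [measurable]: "?Y \<in> borel_measurable M" by measurable
  have split_ennreal: "ennreal (of_bool (x = y) + (\<Sum>k\<in>S. \<Sum>v\<in>{1..N} - {x}. g k v))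
      = ennreal (of_bool (x = y)) + (\<Sum>k\<in>S. \<Sum>v\<in>{1..N} - {x}. ennreal (g k v))"
    if "\<And>k v. 0 \<le> g k v" for g :: "nat \<Rightarrow> nat \<Rightarrow> real"
    using that by (subst ennreal_plus) (auto simp: sum_ennreal sum_nonneg)
  have one: "(\<integral>\<^sup>+\<omega>. ?Y \<omega> \<partial>M) = ?EY"
    by (rule nn_integral_prod_sources[OF assms(2)]) (use Suc.prems in auto)
  have step: "(\<integral>\<^sup>+\<omega>. ?Y \<omega> * ennreal (a \<omega> k x v * ?t \<omega> k v) \<partial>M) = ?EY * ennreal (c * ?c k v)"
    if k: "k \<in> S" and v: "v \<in> {1..N} - {x}" for k v
  proof -
    have k1: "k \<ge> 1" using k Suc.prems(2) by auto
    \<comment> \<open>The first step uses the sources \<open>Coupling k\<close> and \<open>Clause k\<close>, which no later step can use.\<close>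
    define Y' where "Y' s = (if s = Coupling k then (\<lambda>\<omega>. ennreal (opening_prob \<beta> p (\<Theta> k \<omega>)))
      else if s = Clause k then (\<lambda>\<omega>. of_bool (?b k v \<omega>)) else Y s)" for s
    let ?T = "insert (Coupling k) (insert (Clause k) T)"
    have notin: "Coupling k \<notin> T" "Clause k \<notin> T" using Suc.prems(7) k by auto
    have YT: "(\<Prod>s\<in>T. Y' s \<omega>) = ?Y \<omega>" for \<omega>
      using notin by (intro prod.cong) (auto simp: Y'_def)
    have EYT: "(\<Prod>s\<in>T. \<integral>\<^sup>+\<omega>. Y' s \<omega> \<partial>M) = ?EY"
      using notin by (intro prod.cong) (auto simp: Y'_def)
    have "(\<integral>\<^sup>+\<omega>. ?Y \<omega> * ennreal (a \<omega> k x v * ?t \<omega> k v) \<partial>M)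
        = (\<integral>\<^sup>+\<omega>. (\<Prod>s\<in>?T. Y' s \<omega>) * ennreal (?t \<omega> k v) \<partial>M)"
    proof (rule nn_integral_cong)
      fix \<omega>
      have "(\<Prod>s\<in>?T. Y' s \<omega>) = ennreal (opening_prob \<beta> p (\<Theta> k \<omega>)) * (of_bool (?b k v \<omega>) * ?Y \<omega>)"
        using notin Suc.prems(5) YT[of \<omega>] by (simp add: Y'_def)
      moreover have "ennreal (a \<omega> k x v * ?t \<omega> k v)
          = ennreal (opening_prob \<beta> p (\<Theta> k \<omega>)) * of_bool (?b k v \<omega>) * ennreal (?t \<omega> k v)"
        using t0 q by (auto simp: a_def ennreal_mult)
      ultimately show "?Y \<omega> * ennreal (a \<omega> k x v * ?t \<omega> k v) = (\<Prod>s\<in>?T. Y' s \<omega>) * ennreal (?t \<omega> k v)"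
        by (simp only: mult_ac)
    qed
    also have "\<dots> = (\<Prod>s\<in>?T. \<integral>\<^sup>+\<omega>. Y' s \<omega> \<partial>M) * ennreal (?c k v)"
    proof (rule Suc.IH)
      show "finite (S - {k})" "S - {k} \<subseteq> {1..}" "v \<in> {1..N}" "y \<in> {1..N}" "finite ?T" "?T \<subseteq> sources"
        "?T \<inter> (Coupling ` (S - {k}) \<union> Clause ` (S - {k})) = {}"
        using Suc.prems v k1 by auto
      fix s assume "s \<in> ?T"
      then show "Y' s \<in> borel_measurable (source_alg N s)"
        using Suc.prems(8) measurable_coupling_source[OF k1, of "\<lambda>f. ennreal (opening_prob \<beta> p f)" borel N]
          measurable_clause_source[OF assms(2) k1, of "\<lambda>f. of_bool (x \<in> f ` {1..p} \<and> v \<in> f ` {1..p})" borel]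
        by (auto simp: Y'_def)
    qed
    also have "(\<Prod>s\<in>?T. \<integral>\<^sup>+\<omega>. Y' s \<omega> \<partial>M)
        = (\<integral>\<^sup>+\<omega>. ennreal (opening_prob \<beta> p (\<Theta> k \<omega>)) \<partial>M) * ((\<integral>\<^sup>+\<omega>. of_bool (?b k v \<omega>) \<partial>M) * ?EY)"
      using notin Suc.prems(5) EYT by (simp add: Y'_def)
    also have "(\<integral>\<^sup>+\<omega>. ennreal (opening_prob \<beta> p (\<Theta> k \<omega>)) \<partial>M)
        = (\<integral>\<^sup>+\<omega>. ennreal (opening_prob \<beta> p (\<theta> \<omega>)) \<partial>M)"
      using nn_integral_Theta[OF k1, of "\<lambda>f. ennreal (opening_prob \<beta> p f)"] by simp
    also have "(\<integral>\<^sup>+\<omega>. of_bool (?b k v \<omega>) \<partial>M) = ennreal (real p * (real p - 1) / (real N * (real N - 1)))"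
      using clause_pair_prob[OF assms(1,2) k1] Suc.prems(3) v by auto
    finally show ?thesis
      using t0 c by (simp add: ennreal_mult mult_ac)
  qed
  have "(\<integral>\<^sup>+\<omega>. ?Y \<omega> * ennreal (trails (a \<omega>) {1..N} (Suc d) S x y) \<partial>M)
      = (\<integral>\<^sup>+\<omega>. ?Y \<omega> * ennreal (of_bool (x = y))
          + (\<Sum>k\<in>S. \<Sum>v\<in>{1..N} - {x}. ?Y \<omega> * ennreal (a \<omega> k x v * ?t \<omega> k v)) \<partial>M)"
  proof (rule nn_integral_cong)
    fix \<omega>
    have nn: "0 \<le> a \<omega> k x v * ?t \<omega> k v" for k v using a0 t0 by simp
    have "ennreal (trails (a \<omega>) {1..N} (Suc d) S x y) = ennreal (of_bool (x = y))
          + (\<Sum>k\<in>S. \<Sum>v\<in>{1..N} - {x}. ennreal (a \<omega> k x v * ?t \<omega> k v))"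
      unfolding trails.simps by (rule split_ennreal) (rule nn)
    then show "?Y \<omega> * ennreal (trails (a \<omega>) {1..N} (Suc d) S x y) = ?Y \<omega> * ennreal (of_bool (x = y))
          + (\<Sum>k\<in>S. \<Sum>v\<in>{1..N} - {x}. ?Y \<omega> * ennreal (a \<omega> k x v * ?t \<omega> k v))"
      by (simp only: distrib_left sum_distrib_left)
  qed
  also have "\<dots> = ?EY * ennreal (of_bool (x = y)) + (\<Sum>k\<in>S. \<Sum>v\<in>{1..N} - {x}. ?EY * ennreal (c * ?c k v))"
  proof -
    have m: "(\<lambda>\<omega>. ?Y \<omega> * ennreal (a \<omega> k x v * ?t \<omega> k v)) \<in> borel_measurable M"
      if "k \<in> S" "v \<in> {1..N} - {x}" for k v
      using mYY ma[OF that(1), of x v] mt[OF that(1), of v] that(2)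
      by (intro borel_measurable_times_ennreal measurable_compose[OF _ measurable_ennreal] borel_measurable_times) auto
    have "(\<integral>\<^sup>+\<omega>. (\<Sum>k\<in>S. \<Sum>v\<in>{1..N} - {x}. ?Y \<omega> * ennreal (a \<omega> k x v * ?t \<omega> k v)) \<partial>M)
        = (\<Sum>k\<in>S. \<integral>\<^sup>+\<omega>. (\<Sum>v\<in>{1..N} - {x}. ?Y \<omega> * ennreal (a \<omega> k x v * ?t \<omega> k v)) \<partial>M)"
      by (intro nn_integral_sum borel_measurable_sum m)
    also have "\<dots> = (\<Sum>k\<in>S. \<Sum>v\<in>{1..N} - {x}. ?EY * ennreal (c * ?c k v))"
    proof (rule sum.cong[OF refl])
      fix k assume k: "k \<in> S"
      have "(\<integral>\<^sup>+\<omega>. (\<Sum>v\<in>{1..N} - {x}. ?Y \<omega> * ennreal (a \<omega> k x v * ?t \<omega> k v)) \<partial>M)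
          = (\<Sum>v\<in>{1..N} - {x}. \<integral>\<^sup>+\<omega>. ?Y \<omega> * ennreal (a \<omega> k x v * ?t \<omega> k v) \<partial>M)"
        by (intro nn_integral_sum m k)
      also have "\<dots> = (\<Sum>v\<in>{1..N} - {x}. ?EY * ennreal (c * ?c k v))"
        by (intro sum.cong refl step k)
      finally show "(\<integral>\<^sup>+\<omega>. (\<Sum>v\<in>{1..N} - {x}. ?Y \<omega> * ennreal (a \<omega> k x v * ?t \<omega> k v)) \<partial>M)
          = (\<Sum>v\<in>{1..N} - {x}. ?EY * ennreal (c * ?c k v))" .
    qed
    finally have sums: "(\<integral>\<^sup>+\<omega>. (\<Sum>k\<in>S. \<Sum>v\<in>{1..N} - {x}. ?Y \<omega> * ennreal (a \<omega> k x v * ?t \<omega> k v)) \<partial>M)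
        = (\<Sum>k\<in>S. \<Sum>v\<in>{1..N} - {x}. ?EY * ennreal (c * ?c k v))" .
    have const: "(\<integral>\<^sup>+\<omega>. ?Y \<omega> * ennreal (of_bool (x = y)) \<partial>M) = ?EY * ennreal (of_bool (x = y))"
      using nn_integral_multc[OF mYY] one by simp
    show ?thesis
      unfolding sums[symmetric] const[symmetric]
      by (intro nn_integral_add borel_measurable_sum m borel_measurable_times_ennreal mYY) simp_all
  qed
  also have "\<dots> = ?EY * ennreal (trails (\<lambda>_ _ _. c) {1..N} (Suc d) S x y)"
  proof -
    have "ennreal (trails (\<lambda>_ _ _. c) {1..N} (Suc d) S x y) = ennreal (of_bool (x = y))
          + (\<Sum>k\<in>S. \<Sum>v\<in>{1..N} - {x}. ennreal (c * ?c k v))"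
      unfolding trails.simps by (rule split_ennreal) (use t0 c in auto)
    then show ?thesis by (simp only: distrib_left sum_distrib_left)
  qed
  finally show ?case .
qed

end

section \<open>The uniform measure on the cube\<close>

lemma PiM_uniform_count_measure_cube:
  "PiM {1..N} (\<lambda>_. uniform_count_measure {-1, 1 :: real}) = uniform_count_measure (cube N)"
proof (rule sym)
  interpret prob_space "uniform_count_measure {-1, 1 :: real}"
    by (rule prob_space_uniform_count_measure) auto
  interpret product_sigma_finite "\<lambda>_::nat. uniform_count_measure {-1, 1 :: real}"
    by (simp add: product_sigma_finite_def sigma_finite_measure_axioms)
  have "sets (PiM {1..N} (\<lambda>_. uniform_count_measure {-1, 1 :: real}))
      = sets (PiM {1..N} (\<lambda>_. count_space {-1, 1 :: real}))"
    by (intro sets_PiM_cong) (auto simp: sets_uniform_count_measure_count_space)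
  also have "\<dots> = Pow (cube N)" by (subst count_space_PiM_finite) (auto simp: cube_def)
  finally have sets: "sets (PiM {1..N} (\<lambda>_. uniform_count_measure {-1, 1 :: real})) = Pow (cube N)" .
  show "uniform_count_measure (cube N) = PiM {1..N} (\<lambda>_. uniform_count_measure {-1, 1 :: real})"
  proof (rule PiM_eqI)
    show "sets (uniform_count_measure (cube N)) = sets (PiM {1..N} (\<lambda>_. uniform_count_measure {-1, 1 :: real}))"
      unfolding sets by (rule sets_uniform_count_measure)
    fix A :: "nat \<Rightarrow> real set" assume "\<And>i. i \<in> {1..N} \<Longrightarrow> A i \<in> sets (uniform_count_measure {-1, 1})"
    then have A: "A i \<subseteq> {-1, 1}" if "i \<in> {1..N}" for i
      using that by (simp add: sets_uniform_count_measure)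
    have sub: "PiE {1..N} A \<subseteq> cube N" unfolding cube_def using A by (intro PiE_mono)
    have "emeasure (uniform_count_measure (cube N)) (PiE {1..N} A)
        = ennreal (real (\<Prod>i\<in>{1..N}. card (A i)) / 2 ^ N)"
      using sub by (simp add: emeasure_uniform_count_measure card_PiE card_cube)
    also have "real (\<Prod>i\<in>{1..N}. card (A i)) / 2 ^ N = (\<Prod>i\<in>{1..N}. real (card (A i)) / 2)"
      by (simp add: prod_dividef)
    also have "ennreal \<dots> = (\<Prod>i\<in>{1..N}. ennreal (real (card (A i)) / 2))"
      by (simp add: prod_ennreal)
    also have "\<dots> = (\<Prod>i\<in>{1..N}. emeasure (uniform_count_measure {-1, 1}) (A i))"
      using A by (intro prod.cong) (auto simp: emeasure_uniform_count_measure)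
    finally show "emeasure (uniform_count_measure (cube N)) (PiE {1..N} A)
        = (\<Prod>i\<in>{1..N}. emeasure (uniform_count_measure {-1, 1}) (A i))" .
  qed simp
qed

lemma free_energy_eq_partition_function:
  "free_energy (uniform_count_measure {-1, 1}) N \<beta> (hamiltonian p \<Theta> n I)
    = ln (partition_function \<beta> p N \<Theta> I n / 2 ^ N) / real N"
  unfolding free_energy_def PiM_uniform_count_measure_cube partition_function_def
  by (simp add: integral_uniform_count_measure card_cube)

lemma log_sum_exp_approx_Max:
  fixes h :: "(nat \<Rightarrow> real) \<Rightarrow> real"
  assumes "\<beta> > 0"
  shows "\<bar>ln ((\<Sum>\<sigma>\<in>cube n. exp (\<beta> * h \<sigma>)) / 2 ^ n) / \<beta> - Max (h ` cube n)\<bar> \<le> real n * ln 2 / \<beta>"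
proof -
  let ?m = "Max (h ` cube n)" and ?S = "\<Sum>\<sigma>\<in>cube n. exp (\<beta> * h \<sigma>)"
  have "?m \<in> h ` cube n" by (intro Max_in) auto
  then obtain \<tau> where t: "\<tau> \<in> cube n" "?m = h \<tau>" by (rule imageE)
  have "exp (\<beta> * ?m) \<le> ?S"
    unfolding t(2) by (rule member_le_sum[OF t(1)]) auto
  moreover have "?S \<le> of_nat (card (cube n)) * exp (\<beta> * ?m)"
    using assms by (intro sum_bounded_above) auto
  then have "?S \<le> 2 ^ n * exp (\<beta> * ?m)" by (simp add: card_cube)
  moreover have S: "0 < ?S" by (intro sum_pos) auto
  ultimately have "\<beta> * ?m \<le> ln ?S" "ln ?S \<le> ln (2 ^ n * exp (\<beta> * ?m))"
    by (auto simp: ln_ge_iff simp del: ln_mult)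
  then have "\<beta> * ?m \<le> ln ?S" "ln ?S \<le> real n * ln 2 + \<beta> * ?m"
    by (simp_all add: ln_mult ln_realpow)
  moreover have "ln (?S / 2 ^ n) = ln ?S - real n * ln 2"
    using S by (simp add: ln_div ln_realpow)
  moreover have "0 \<le> real n * ln 2" by simp
  ultimately have "\<bar>ln (?S / 2 ^ n) - \<beta> * ?m\<bar> \<le> real n * ln 2" by linarith
  moreover have "ln (?S / 2 ^ n) / \<beta> - ?m = (ln (?S / 2 ^ n) - \<beta> * ?m) / \<beta>"
    using assms by (simp add: field_simps)
  ultimately show ?thesis using assms by (simp add: abs_divide divide_right_mono)
qed

section \<open>Expectations over the disorder\<close>

context diluted_disorder
begin

lemma measurable_Theta_compose:
  "k \<ge> 1 \<Longrightarrow> f \<in> fun_space p \<rightarrow>\<^sub>M L \<Longrightarrow> (\<lambda>\<omega>. f (\<Theta> k \<omega>)) \<in> M \<rightarrow>\<^sub>M L"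
  by (rule measurable_compose[OF measurable_Theta])

lemma measurable_I_compose:
  assumes "N \<ge> p" "k \<ge> 1" "f \<in> UNIV \<rightarrow> space L"
  shows "(\<lambda>\<omega>. f (I N k \<omega>)) \<in> M \<rightarrow>\<^sub>M L"
  by (rule measurable_of_source[OF assms(1) _ measurable_clause_source[OF assms]]) (use assms in auto)

lemma measurable_clause_weight:
  assumes "N \<ge> p" "k \<ge> 1"
  shows "(\<lambda>\<omega>. opening_prob \<beta> p (\<Theta> k \<omega>) * of_bool (u \<in> I N k \<omega> ` {1..p} \<and> v \<in> I N k \<omega> ` {1..p}))
    \<in> borel_measurable M"
  by (intro borel_measurable_times measurable_Theta_compose measurable_I_compose
      borel_measurable_opening_prob assms) auto

lemma borel_measurable_cycle_weight:
  assumes "N \<ge> p"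
  shows "(\<lambda>\<omega>. cycle_weight \<beta> p N (\<lambda>k. \<Theta> k \<omega>) (\<lambda>k. I N k \<omega>) n) \<in> borel_measurable M"
  unfolding cycle_weight_def
proof (intro borel_measurable_sum borel_measurable_times)
  fix x y assume x: "x \<in> {1..N}"
  show "(\<lambda>\<omega>. of_bool (x \<in> I N (Suc n) \<omega> ` {1..p} \<and> y \<in> I N (Suc n) \<omega> ` {1..p}) :: real) \<in> borel_measurable M"
    by (rule measurable_I_compose[OF assms]) auto
  show "(\<lambda>\<omega>. trails (\<lambda>k u v. opening_prob \<beta> p (\<Theta> k \<omega>)
      * of_bool (u \<in> I N k \<omega> ` {1..p} \<and> v \<in> I N k \<omega> ` {1..p})) {1..N} n {1..n} x y) \<in> borel_measurable M"
    by (rule measurable_trails[OF measurable_clause_weight[OF assms] x]) auto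
qed

lemma nn_integral_opening_prob:
  assumes "\<beta> > 0"
  shows "(\<integral>\<^sup>+\<omega>. ennreal (opening_prob \<beta> p (\<theta> \<omega>)) \<partial>M) = ennreal (\<integral>\<omega>. opening_prob \<beta> p (\<theta> \<omega>) \<partial>M)"
proof (rule nn_integral_eq_integral)
  have "(\<lambda>\<omega>. opening_prob \<beta> p (\<theta> \<omega>)) \<in> borel_measurable M"
    by (rule measurable_compose[OF measurable_theta borel_measurable_opening_prob])
  then show "integrable M (\<lambda>\<omega>. opening_prob \<beta> p (\<theta> \<omega>))"
    by (rule integrable_const_bound[where B=1, rotated])
      (use assms opening_prob_nonneg[OF assms] in \<open>auto simp: opening_prob_def\<close>)
qed (use opening_prob_nonneg[OF assms] in auto)

text \<open>
  By averaging over the two vertices of the new clause, the trail sums with free endpoint come into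
  play, each at most \<open>1 / (1 - r)\<close>. There are \<open>N\<close> starting points, and the probability
  \<open>p (p - 1) / (N (N - 1))\<close> of a given pair leaves one factor \<open>1 / (N - 1)\<close>.
\<close>

lemma nn_integral_cycle_weight:
  assumes "2 \<le> p" "p \<le> N" "\<beta> > 0" "0 \<le> r" "r < 1"
    and Q: "Q = (\<integral>\<omega>. opening_prob \<beta> p (\<theta> \<omega>) \<partial>M)"
    and n: "real n * Q * (real p * (real p - 1)) \<le> r * real N"
  shows "(\<integral>\<^sup>+\<omega>. ennreal (cycle_weight \<beta> p N (\<lambda>k. \<Theta> k \<omega>) (\<lambda>k. I N k \<omega>) n) \<partial>M)
    \<le> ennreal (real p * (real p - 1) / ((real N - 1) * (1 - r)))"
proof -
  let ?b = "\<lambda>\<omega> x y. of_bool (x \<in> I N (Suc n) \<omega> ` {1..p} \<and> y \<in> I N (Suc n) \<omega> ` {1..p})"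
  define w where "w \<omega> k u v = opening_prob \<beta> p (\<Theta> k \<omega>)
      * of_bool (u \<in> I N k \<omega> ` {1..p} \<and> v \<in> I N k \<omega> ` {1..p})" for \<omega> k and u v :: nat
  define \<pi> where "\<pi> = real p * (real p - 1) / (real N * (real N - 1))"
  let ?t = "\<lambda>\<omega>. trails (w \<omega>) {1..N} n {1..n}"
  let ?c = "trails (\<lambda>_ _ _. Q * \<pi>) {1..N} n {1..n}"
  have N: "2 \<le> N" using assms by simp
  have Q0: "0 \<le> Q" unfolding Q by (intro Bochner_Integration.integral_nonneg opening_prob_nonneg assms(3))
  have pi0: "0 \<le> \<pi>" using assms(1) N by (simp add: \<pi>_def)
  have w0: "0 \<le> w \<omega> k u v" for \<omega> k u v by (simp add: w_def opening_prob_nonneg[OF assms(3)])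
  have t0: "0 \<le> ?t \<omega> x y" "0 \<le> ?c x y" for \<omega> x y
    using Q0 pi0 by (intro trails_nonneg w0; simp)+
  have mt: "(\<lambda>\<omega>. ?t \<omega> x y) \<in> borel_measurable M" if "x \<in> {1..N}" for x y
    by (rule measurable_trails[OF _ that])
      (unfold w_def, rule measurable_clause_weight[OF assms(2)], simp)
  have mb: "(\<lambda>\<omega>. ?b \<omega> x y :: ennreal) \<in> borel_measurable M" for x y
    by (rule measurable_I_compose[OF assms(2)]) auto
  have expect: "(\<integral>\<^sup>+\<omega>. ?b \<omega> x y * ennreal (?t \<omega> x y) \<partial>M) = ennreal (\<pi> * ?c x y)"
    if x: "x \<in> {1..N}" and y: "y \<in> {1..N} - {x}" for x y
  proof -
    have "(\<integral>\<^sup>+\<omega>. (\<Prod>s\<in>{Clause (Suc n)}. ?b \<omega> x y) * ennreal (?t \<omega> x y) \<partial>M)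
        = (\<Prod>s\<in>{Clause (Suc n)}. \<integral>\<^sup>+\<omega>. ?b \<omega> x y \<partial>M) * ennreal (?c x y)"
      unfolding w_def
    proof (rule nn_integral_trails[OF assms(1-3)])
      show "ennreal (Q * \<pi>) = (\<integral>\<^sup>+\<omega>. ennreal (opening_prob \<beta> p (\<theta> \<omega>)) \<partial>M)
          * ennreal (real p * (real p - 1) / (real N * (real N - 1)))"
        unfolding nn_integral_opening_prob[OF assms(3)] Q[symmetric] \<pi>_def[symmetric]
        by (rule ennreal_mult[OF Q0 pi0])
      fix s assume "s \<in> {Clause (Suc n)}"
      then show "(\<lambda>\<omega>. ?b \<omega> x y) \<in> borel_measurable (source_alg N s)"
        using measurable_clause_source[OF assms(2), of "Suc n"
            "\<lambda>\<iota>. of_bool (x \<in> \<iota> ` {1..p} \<and> y \<in> \<iota> ` {1..p})" borel] by simp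
    qed (use x y Q0 pi0 in auto)
    moreover have "(\<integral>\<^sup>+\<omega>. ?b \<omega> x y \<partial>M) = ennreal \<pi>"
      using clause_pair_prob[OF assms(1,2), of "Suc n" x y] x y by (auto simp: \<pi>_def)
    ultimately show ?thesis using pi0 t0 by (simp add: ennreal_mult)
  qed
  have row: "(\<Sum>y\<in>{1..N}. ?c x y) \<le> 1 / (1 - r)" if "x \<in> {1..N}" for x
  proof (rule trails_const_sum_le)
    have "real n * Q * (real p * (real p - 1)) / real N \<le> r"
      using n N by (simp add: field_simps)
    moreover have "real n * (real N - 1) * (Q * \<pi>) = real n * Q * (real p * (real p - 1)) / real N"
      using N by (simp add: \<pi>_def field_simps)
    ultimately show "real (card {1..n}) * (real (card {1..N}) - 1) * (Q * \<pi>) \<le> r" by simp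
  qed (use that assms Q0 pi0 in auto)
  have "(\<integral>\<^sup>+\<omega>. ennreal (cycle_weight \<beta> p N (\<lambda>k. \<Theta> k \<omega>) (\<lambda>k. I N k \<omega>) n) \<partial>M)
      = (\<integral>\<^sup>+\<omega>. (\<Sum>x\<in>{1..N}. \<Sum>y\<in>{1..N} - {x}. ?b \<omega> x y * ennreal (?t \<omega> x y)) \<partial>M)"
  proof (rule nn_integral_cong)
    fix \<omega>
    have "?b \<omega> x y * ennreal (?t \<omega> x y) = ennreal (?b \<omega> x y * ?t \<omega> x y)" for x y by simp
    moreover have "0 \<le> ?b \<omega> x y * ?t \<omega> x y" for x y using t0 by simp
    ultimately show "ennreal (cycle_weight \<beta> p N (\<lambda>k. \<Theta> k \<omega>) (\<lambda>k. I N k \<omega>) n)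
        = (\<Sum>x\<in>{1..N}. \<Sum>y\<in>{1..N} - {x}. ?b \<omega> x y * ennreal (?t \<omega> x y))"
      unfolding cycle_weight_def w_def[symmetric] by (simp only: sum_ennreal sum_nonneg)
  qed
  also have "\<dots> = (\<Sum>x\<in>{1..N}. \<Sum>y\<in>{1..N} - {x}. \<integral>\<^sup>+\<omega>. ?b \<omega> x y * ennreal (?t \<omega> x y) \<partial>M)"
    using mt mb
    by (subst nn_integral_sum; (intro sum.cong refl nn_integral_sum borel_measurable_sum
        borel_measurable_times_ennreal measurable_compose[OF _ measurable_ennreal])?) auto
  also have "\<dots> = (\<Sum>x\<in>{1..N}. \<Sum>y\<in>{1..N} - {x}. ennreal (\<pi> * ?c x y))"
    by (intro sum.cong refl expect)
  also have "\<dots> = ennreal (\<Sum>x\<in>{1..N}. \<Sum>y\<in>{1..N} - {x}. \<pi> * ?c x y)"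
    using pi0 t0 by (simp add: sum_ennreal sum_nonneg)
  also have "\<dots> \<le> ennreal (\<Sum>x\<in>{1..N}. \<pi> * (1 / (1 - r)))"
  proof (intro ennreal_leI sum_mono)
    fix x assume x: "x \<in> {1..N}"
    have "(\<Sum>y\<in>{1..N} - {x}. \<pi> * ?c x y) \<le> (\<Sum>y\<in>{1..N}. \<pi> * ?c x y)"
      using pi0 t0 by (intro sum_mono2) auto
    also have "\<dots> \<le> \<pi> * (1 / (1 - r))"
      unfolding sum_distrib_left[symmetric] by (intro mult_left_mono row x pi0)
    finally show "(\<Sum>y\<in>{1..N} - {x}. \<pi> * ?c x y) \<le> \<pi> * (1 / (1 - r))" .
  qed
  also have "(\<Sum>x\<in>{1..N}. \<pi> * (1 / (1 - r))) = real p * (real p - 1) / ((real N - 1) * (1 - r))"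
    using N by (simp add: \<pi>_def)
  finally show ?thesis .
qed

lemma nn_integral_K:
  assumes "p \<le> N"
  shows "(\<integral>\<^sup>+\<omega>. f (K N \<omega>) \<partial>M) = (\<integral>\<^sup>+n. f n \<partial>measure_pmf (poisson_pmf (\<alpha> * real N)))"
  unfolding law_K[OF assms, symmetric] by (subst nn_integral_distr[OF measurable_K[OF assms]]) auto

text \<open>
  Wald's identity: the number of clauses is independent of the functions that are summed.
\<close>

lemma nn_integral_sum_between:
  assumes "p \<le> N" and f: "f \<in> borel_measurable (fun_space p)"
  shows "(\<integral>\<^sup>+\<omega>. (\<Sum>k\<in>{min m (K N \<omega>)<..max m (K N \<omega>)}. f (\<Theta> k \<omega>)) \<partial>M)
    = (\<integral>\<^sup>+\<omega>. ennreal \<bar>real (K N \<omega>) - real m\<bar> \<partial>M) * (\<integral>\<^sup>+\<omega>. f (\<theta> \<omega>) \<partial>M)"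
proof -
  let ?B = "\<lambda>n. {min m n<..max m n}"
  have card: "ennreal \<bar>real n - real m\<bar> = of_nat (card (?B n))" for n
    by (simp add: ennreal_of_nat_eq_real_of_nat min_def max_def)
  have mK: "(\<lambda>\<omega>. of_bool (K N \<omega> = n) :: ennreal) \<in> borel_measurable M" for n
    by (rule measurable_compose[OF measurable_K[OF assms(1)]]) simp
  have expand: "g (K N \<omega>) = (\<Sum>n. of_bool (K N \<omega> = n) * g n)" for g :: "nat \<Rightarrow> ennreal" and \<omega>
    by (subst suminf_finite[of "{K N \<omega>}"]) auto
  have mf: "(\<lambda>\<omega>. f (\<Theta> k \<omega>)) \<in> borel_measurable M" if "k \<in> ?B n" for k n
    using that by (intro measurable_Theta_compose f) auto
  have expect: "(\<integral>\<^sup>+\<omega>. of_bool (K N \<omega> = n) * (\<Sum>k\<in>?B n. f (\<Theta> k \<omega>)) \<partial>M)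
      = (\<integral>\<^sup>+\<omega>. of_bool (K N \<omega> = n) * ennreal \<bar>real n - real m\<bar> \<partial>M) * (\<integral>\<^sup>+\<omega>. f (\<theta> \<omega>) \<partial>M)" for n
  proof -
    have one: "(\<integral>\<^sup>+\<omega>. of_bool (K N \<omega> = n) * f (\<Theta> k \<omega>) \<partial>M)
        = (\<integral>\<^sup>+\<omega>. of_bool (K N \<omega> = n) \<partial>M) * (\<integral>\<^sup>+\<omega>. f (\<theta> \<omega>) \<partial>M)" if k: "k \<in> ?B n" for k
    proof -
      have k1: "k \<ge> 1" using k by auto
      define Y where "Y s = (if s = Count then (\<lambda>\<omega>. of_bool (K N \<omega> = n)) else (\<lambda>\<omega>. f (\<Theta> k \<omega>)))" for s
      have "(\<integral>\<^sup>+\<omega>. (\<Prod>s\<in>{Count, Coupling k}. Y s \<omega>) \<partial>M) = (\<Prod>s\<in>{Count, Coupling k}. \<integral>\<^sup>+\<omega>. Y s \<omega> \<partial>M)"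
      proof (rule nn_integral_prod_sources[OF assms(1)])
        fix s assume "s \<in> {Count, Coupling k}"
        then show "Y s \<in> borel_measurable (source_alg N s)"
          using measurable_coupling_source[OF k1 f, of N]
            measurable_count_source[of "\<lambda>i. of_bool (i = n)" borel N]
          by (auto simp: Y_def)
      qed (use k1 in auto)
      then show ?thesis using nn_integral_Theta[OF k1 f] by (simp add: Y_def)
    qed
    have "(\<integral>\<^sup>+\<omega>. of_bool (K N \<omega> = n) * (\<Sum>k\<in>?B n. f (\<Theta> k \<omega>)) \<partial>M)
        = (\<integral>\<^sup>+\<omega>. (\<Sum>k\<in>?B n. of_bool (K N \<omega> = n) * f (\<Theta> k \<omega>)) \<partial>M)"
      by (simp only: sum_distrib_left)
    also have "\<dots> = (\<Sum>k\<in>?B n. \<integral>\<^sup>+\<omega>. of_bool (K N \<omega> = n) * f (\<Theta> k \<omega>) \<partial>M)"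
      by (intro nn_integral_sum borel_measurable_times_ennreal mK mf)
    also have "\<dots> = (\<Sum>k\<in>?B n. (\<integral>\<^sup>+\<omega>. of_bool (K N \<omega> = n) \<partial>M) * (\<integral>\<^sup>+\<omega>. f (\<theta> \<omega>) \<partial>M))"
      by (intro sum.cong refl one)
    finally show ?thesis by (simp only: card nn_integral_multc[OF mK] sum_constant mult_ac)
  qed
  have "(\<integral>\<^sup>+\<omega>. (\<Sum>k\<in>?B (K N \<omega>). f (\<Theta> k \<omega>)) \<partial>M)
      = (\<integral>\<^sup>+\<omega>. (\<Sum>n. of_bool (K N \<omega> = n) * (\<Sum>k\<in>?B n. f (\<Theta> k \<omega>))) \<partial>M)"
    by (rule nn_integral_cong) (rule expand)
  also have "\<dots> = (\<Sum>n. \<integral>\<^sup>+\<omega>. of_bool (K N \<omega> = n) * (\<Sum>k\<in>?B n. f (\<Theta> k \<omega>)) \<partial>M)"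
    by (intro nn_integral_suminf borel_measurable_times_ennreal borel_measurable_sum mK mf)
  also have "\<dots> = (\<Sum>n. \<integral>\<^sup>+\<omega>. of_bool (K N \<omega> = n) * ennreal \<bar>real n - real m\<bar> \<partial>M) * (\<integral>\<^sup>+\<omega>. f (\<theta> \<omega>) \<partial>M)"
    by (simp only: expect ennreal_suminf_multc)
  also have "(\<Sum>n. \<integral>\<^sup>+\<omega>. of_bool (K N \<omega> = n) * ennreal \<bar>real n - real m\<bar> \<partial>M)
      = (\<integral>\<^sup>+\<omega>. (\<Sum>n. of_bool (K N \<omega> = n) * ennreal \<bar>real n - real m\<bar>) \<partial>M)"
    by (intro nn_integral_suminf[symmetric] borel_measurable_times_ennreal mK) simp
  also have "\<dots> = (\<integral>\<^sup>+\<omega>. ennreal \<bar>real (K N \<omega>) - real m\<bar> \<partial>M)"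
    by (rule nn_integral_cong) (rule expand[symmetric])
  finally show ?thesis .
qed

text \<open>
  The variance of a Poisson variable equals its mean, so \<open>K N\<close> is typically at distance of order
  \<open>sqrt (\<alpha> * N)\<close> from \<open>\<alpha> * N\<close>.
\<close>

lemma nn_integral_abs_K_diff:
  assumes "p \<le> N" "N \<ge> 1" "\<alpha> > 0"
  shows "(\<integral>\<^sup>+\<omega>. ennreal \<bar>real (K N \<omega>) - real m\<bar> \<partial>M)
    \<le> ennreal (2 * sqrt (\<alpha> * real N) + \<bar>real m - \<alpha> * real N\<bar>)"
proof -
  let ?r = "\<alpha> * real N"
  have r: "0 < ?r" using assms by simp
  have m: "(\<lambda>\<omega>. real (K N \<omega>) - ?r) \<in> borel_measurable M"
    by (rule measurable_compose[OF measurable_K[OF assms(1)]]) simp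
  have "(\<integral>\<^sup>+\<omega>. ennreal ((real (K N \<omega>) - ?r)\<^sup>2) \<partial>M) = ennreal ?r"
    using nn_integral_K[OF assms(1), of "\<lambda>n. ennreal ((real n - ?r)\<^sup>2)"] poisson_second_moment[OF r] by simp
  then have *: "(\<integral>\<^sup>+\<omega>. ennreal \<bar>real (K N \<omega>) - ?r\<bar> \<partial>M) \<le> ennreal (2 * sqrt ?r)"
    using nn_integral_abs_le_of_second_moment[OF m prob_space_axioms _ r] by simp
  have "(\<integral>\<^sup>+\<omega>. ennreal \<bar>real (K N \<omega>) - real m\<bar> \<partial>M)
      \<le> (\<integral>\<^sup>+\<omega>. ennreal \<bar>real (K N \<omega>) - ?r\<bar> + ennreal \<bar>real m - ?r\<bar> \<partial>M)"
    by (intro nn_integral_mono) (simp flip: ennreal_plus)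
  also have "\<dots> = (\<integral>\<^sup>+\<omega>. ennreal \<bar>real (K N \<omega>) - ?r\<bar> \<partial>M) + ennreal \<bar>real m - ?r\<bar>"
    using m by (subst nn_integral_add) (auto simp: emeasure_space_1)
  also have "\<dots> \<le> ennreal (2 * sqrt ?r) + ennreal \<bar>real m - ?r\<bar>"
    by (intro add_right_mono *)
  finally show ?thesis using r by (simp add: ennreal_plus)
qed

section \<open>The error of the free energy\<close>

text \<open>
  The argument of \<open>\<Theta> k\<close> is random too, but it takes finitely many values, over which the term is
  expanded.
\<close>

lemma measurable_hamiltonian:
  assumes "p \<le> N" "\<sigma> \<in> cube N"
  shows "(\<lambda>\<omega>. hamiltonian p (\<lambda>k. \<Theta> k \<omega>) n (\<lambda>k. I N k \<omega>) \<sigma>) \<in> borel_measurable M"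
  unfolding hamiltonian_def
proof (rule borel_measurable_sum)
  fix k assume "k \<in> {1..n}"
  then have k: "k \<ge> 1" by simp
  let ?r = "\<lambda>\<omega>. \<lambda>i\<in>{1..p}. \<sigma> (I N k \<omega> i)"
  have "(\<lambda>\<omega>. \<Sum>\<tau>\<in>cube p. of_bool (?r \<omega> = \<tau>) * \<Theta> k \<omega> \<tau>) \<in> borel_measurable M"
  proof (intro borel_measurable_sum borel_measurable_times)
    fix \<tau> assume t: "\<tau> \<in> cube p"
    have "(\<lambda>\<omega>. of_bool ((\<lambda>\<iota>. (\<lambda>i\<in>{1..p}. \<sigma> (\<iota> i))) (I N k \<omega>) = \<tau>) :: real) \<in> borel_measurable M"
      by (rule measurable_I_compose[OF assms(1) k, where f="\<lambda>\<iota>. of_bool ((\<lambda>i\<in>{1..p}. \<sigma> (\<iota> i)) = \<tau>)"]) auto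
    then show "(\<lambda>\<omega>. of_bool (?r \<omega> = \<tau>) :: real) \<in> borel_measurable M" by simp
    show "(\<lambda>\<omega>. \<Theta> k \<omega> \<tau>) \<in> borel_measurable M"
      by (rule measurable_Theta_compose[OF k]) (use t in \<open>auto simp: fun_space_def intro: measurable_component_singleton\<close>)
  qed
  moreover have "(\<Sum>\<tau>\<in>cube p. of_bool (?r \<omega> = \<tau>) * \<Theta> k \<omega> \<tau>) = \<Theta> k \<omega> (?r \<omega>)" if w: "\<omega> \<in> space M" for \<omega>
  proof -
    have "I N k \<omega> ` {1..p} \<subseteq> {1..N}"
      using measurable_space[OF measurable_I[OF assms(1) k] w] by (auto simp: space_PiM)
    then have "?r \<omega> \<in> cube p" by (rule restrict_in_cube[OF assms(2)])
    moreover have "(\<Sum>\<tau>\<in>cube p. of_bool (x = \<tau>) * h \<tau>) = h x" if "x \<in> cube p" for x and h :: "(nat \<Rightarrow> real) \<Rightarrow> real"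
    proof -
      have "(\<Sum>\<tau>\<in>cube p. of_bool (x = \<tau>) * h \<tau>) = (\<Sum>\<tau>\<in>cube p. if x = \<tau> then h \<tau> else 0)"
        by (intro sum.cong) auto
      then show ?thesis using that by simp
    qed
    ultimately show ?thesis by blast
  qed
  ultimately show "(\<lambda>\<omega>. \<Theta> k \<omega> (?r \<omega>)) \<in> borel_measurable M"
    by (simp cong: measurable_cong)
qed

lemma measurable_hamiltonian_K:
  assumes "p \<le> N" "\<sigma> \<in> cube N"
  shows "(\<lambda>\<omega>. hamiltonian p (\<lambda>k. \<Theta> k \<omega>) (K N \<omega>) (\<lambda>k. I N k \<omega>) \<sigma>) \<in> borel_measurable M"
  by (rule measurable_compose_countable[OF measurable_hamiltonian[OF assms] measurable_K[OF assms(1)]])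

lemma measurable_log_partition_function:
  assumes "p \<le> N"
  shows "(\<lambda>\<omega>. ln (partition_function \<beta> p N (\<lambda>k. \<Theta> k \<omega>) (\<lambda>k. I N k \<omega>) (K N \<omega>) / 2 ^ N)) \<in> borel_measurable M"
proof -
  note [measurable] = measurable_hamiltonian_K[OF assms]
  show ?thesis unfolding partition_function_def by measurable
qed

lemma measurable_ground_state_energy:
  assumes "p \<le> N"
  shows "(\<lambda>\<omega>. ground_state_energy N (hamiltonian p (\<lambda>k. \<Theta> k \<omega>) (K N \<omega>) (\<lambda>k. I N k \<omega>))) \<in> borel_measurable M"
  unfolding ground_state_energy_def
  by (intro borel_measurable_times borel_measurable_const borel_measurable_Max measurable_hamiltonian_K[OF assms]) auto

lemma measurable_theta_compose: "f \<in> fun_space p \<rightarrow>\<^sub>M L \<Longrightarrow> (\<lambda>\<omega>. f (\<theta> \<omega>)) \<in> M \<rightarrow>\<^sub>M L"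
  by (rule measurable_compose[OF measurable_theta])

lemma integral_Theta:
  fixes f :: "((nat \<Rightarrow> real) \<Rightarrow> real) \<Rightarrow> real"
  assumes "k \<ge> 1" and f: "f \<in> borel_measurable (fun_space p)"
  shows "(\<integral>\<omega>. f (\<Theta> k \<omega>) \<partial>M) = (\<integral>\<omega>. f (\<theta> \<omega>) \<partial>M)"
    and "integrable M (\<lambda>\<omega>. f (\<Theta> k \<omega>)) \<longleftrightarrow> integrable M (\<lambda>\<omega>. f (\<theta> \<omega>))"
  unfolding integral_distr[OF measurable_Theta[OF assms(1)] f, symmetric]
    integral_distr[OF measurable_theta f, symmetric]
    integrable_distr_eq[OF measurable_Theta[OF assms(1)] f, symmetric]
    integrable_distr_eq[OF measurable_theta f, symmetric] law_Theta[OF assms(1)] by (rule refl)+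

text \<open>
  Centered independent terms are orthogonal, and the variance is at most the second moment.
\<close>

lemma second_moment_sum_le:
  fixes f :: "((nat \<Rightarrow> real) \<Rightarrow> real) \<Rightarrow> real"
  assumes "p \<le> N" and f: "f \<in> borel_measurable (fun_space p)"
    and sq: "integrable M (\<lambda>\<omega>. (f (\<theta> \<omega>))\<^sup>2)"
  shows "(\<integral>\<^sup>+\<omega>. ennreal ((\<Sum>k=1..m. f (\<Theta> k \<omega>) - (\<integral>\<omega>. f (\<theta> \<omega>) \<partial>M))\<^sup>2) \<partial>M)
    \<le> ennreal (real m * (\<integral>\<omega>. (f (\<theta> \<omega>))\<^sup>2 \<partial>M))"
proof -
  define e where "e = (\<integral>\<omega>. f (\<theta> \<omega>) \<partial>M)"
  define g where "g h = f h - e" for h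
  have int: "integrable M (\<lambda>\<omega>. f (\<theta> \<omega>))"
    by (rule square_integrable_imp_integrable[OF measurable_theta_compose[OF f] sq])
  have g: "g \<in> borel_measurable (fun_space p)" unfolding g_def using f by measurable
  then have g2: "(\<lambda>h. (g h)\<^sup>2) \<in> borel_measurable (fun_space p)" by measurable
  have intg: "integrable M (\<lambda>\<omega>. g (\<Theta> k \<omega>))" "(\<integral>\<omega>. g (\<Theta> k \<omega>) \<partial>M) = 0" if "k \<ge> 1" for k
    unfolding integral_Theta[OF that g] using int by (simp_all add: g_def e_def prob_space)
  have var: "(\<integral>\<omega>. (g (\<theta> \<omega>))\<^sup>2 \<partial>M) = (\<integral>\<omega>. (f (\<theta> \<omega>))\<^sup>2 \<partial>M) - e\<^sup>2"
    unfolding g_def e_def by (rule variance_eq[OF int sq])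
  have intg2: "integrable M (\<lambda>\<omega>. (g (\<theta> \<omega>))\<^sup>2)"
    unfolding g_def power2_diff using int sq by (intro Bochner_Integration.integrable_add Bochner_Integration.integrable_diff) auto
  have prod: "integrable M (\<lambda>\<omega>. g (\<Theta> k \<omega>) * g (\<Theta> l \<omega>)) \<and>
      (\<integral>\<omega>. g (\<Theta> k \<omega>) * g (\<Theta> l \<omega>) \<partial>M) \<le> of_bool (k = l) * (\<integral>\<omega>. (f (\<theta> \<omega>))\<^sup>2 \<partial>M)"
    if k: "k \<ge> 1" and l: "l \<ge> 1" for k l
  proof (cases "k = l")
    case True
    then show ?thesis
      using integral_Theta[OF k g2] intg2 var by (simp add: power2_eq_square)
  next
    case False
    define Y where "Y s = (if s = Coupling k then (\<lambda>\<omega>. g (\<Theta> k \<omega>)) else (\<lambda>\<omega>. g (\<Theta> l \<omega>)))" for s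
    have ind: "indep_vars (\<lambda>_. borel) Y {Coupling k, Coupling l}"
    proof (rule indep_vars_sources[OF assms(1)])
      fix s assume "s \<in> {Coupling k, Coupling l}"
      then show "Y s \<in> borel_measurable (source_alg N s)"
        using measurable_coupling_source[OF k g, of N] measurable_coupling_source[OF l g, of N] by (auto simp: Y_def)
    qed (use k l in auto)
    have iY: "integrable M (Y s)" if "s \<in> {Coupling k, Coupling l}" for s
      using that intg(1)[OF k] intg(1)[OF l] by (auto simp: Y_def)
    have prod: "(\<Prod>s\<in>{Coupling k, Coupling l}. Y s \<omega>) = g (\<Theta> k \<omega>) * g (\<Theta> l \<omega>)" for \<omega>
      using False by (simp add: Y_def)
    have zero: "(\<Prod>s\<in>{Coupling k, Coupling l}. \<integral>\<omega>. Y s \<omega> \<partial>M) = 0"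
      using False intg(2)[OF k] by (simp add: Y_def)
    have fin: "finite {Coupling k, Coupling l}" by simp
    show ?thesis
      using indep_vars_lebesgue_integral[OF fin ind iY] indep_vars_integrable[OF fin ind iY] False
      unfolding prod zero by simp
  qed
  have sq_eq: "(\<Sum>k=1..m. g (\<Theta> k \<omega>))\<^sup>2 = (\<Sum>k=1..m. \<Sum>l=1..m. g (\<Theta> k \<omega>) * g (\<Theta> l \<omega>))" for \<omega>
    by (simp only: power2_eq_square sum_product)
  have "integrable M (\<lambda>\<omega>. (\<Sum>k=1..m. g (\<Theta> k \<omega>))\<^sup>2)"
    unfolding sq_eq using prod by (intro Bochner_Integration.integrable_sum) auto
  then have nn: "(\<integral>\<^sup>+\<omega>. ennreal ((\<Sum>k=1..m. g (\<Theta> k \<omega>))\<^sup>2) \<partial>M) = ennreal (\<integral>\<omega>. (\<Sum>k=1..m. g (\<Theta> k \<omega>))\<^sup>2 \<partial>M)"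
    by (rule nn_integral_eq_integral) simp
  have "(\<integral>\<omega>. (\<Sum>k=1..m. g (\<Theta> k \<omega>))\<^sup>2 \<partial>M) = (\<Sum>k=1..m. \<Sum>l=1..m. \<integral>\<omega>. g (\<Theta> k \<omega>) * g (\<Theta> l \<omega>) \<partial>M)"
    unfolding sq_eq using prod
    by (subst Bochner_Integration.integral_sum; (intro Bochner_Integration.integrable_sum sum.cong refl Bochner_Integration.integral_sum)?) auto
  also have "\<dots> \<le> (\<Sum>k=1..m. \<Sum>l=1..m. of_bool (k = l) * (\<integral>\<omega>. (f (\<theta> \<omega>))\<^sup>2 \<partial>M))"
    by (intro sum_mono) (use prod in auto)
  also have "\<dots> = real m * (\<integral>\<omega>. (f (\<theta> \<omega>))\<^sup>2 \<partial>M)"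
    by (simp add: of_bool_def if_distrib sum.delta' if_distribR cong: if_cong)
  finally have "(\<integral>\<^sup>+\<omega>. ennreal ((\<Sum>k=1..m. g (\<Theta> k \<omega>))\<^sup>2) \<partial>M) \<le> ennreal (real m * (\<integral>\<omega>. (f (\<theta> \<omega>))\<^sup>2 \<partial>M))"
    unfolding nn by (rule ennreal_leI)
  then show ?thesis unfolding g_def e_def .
qed

text \<open>
  The four terms of the bound are the cost of the clauses between \<open>m = \<lfloor>(1 - \<epsilon>) \<alpha> N\<rfloor>\<close> and
  \<open>K N\<close>, the cycles and the truncation among the first \<open>m\<close> clauses, the fluctuations in the law of
  large numbers, and the difference between \<open>m\<close> and \<open>\<alpha> N\<close>. Stopping at \<open>m\<close> makes the trail sums
  converge with ratio \<open>1 - \<epsilon>\<close> even when the model is exactly critical.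
\<close>

lemma nn_integral_log_partition_function_error:
  assumes "2 \<le> p" "p \<le> N" "\<beta> > 0" "\<alpha> > 0" "0 < \<epsilon>" "\<epsilon> < 1" "R > 0"
    and sq: "integrable M (\<lambda>\<omega>. (sup_norm p (\<theta> \<omega>))\<^sup>2)"
    and sym: "AE \<omega> in M. \<forall>\<sigma>\<in>cube p. \<theta> \<omega> \<sigma> = \<theta> \<omega> (\<lambda>i\<in>{1..p}. - \<sigma> i)"
    and subcritical: "(\<integral>\<omega>. opening_prob \<beta> p (\<theta> \<omega>) \<partial>M) * (\<alpha> * real p * (real p - 1)) \<le> 1"
  defines "s1 \<equiv> \<integral>\<omega>. sup_norm p (\<theta> \<omega>) \<partial>M"
    and "s2 \<equiv> \<integral>\<omega>. (sup_norm p (\<theta> \<omega>))\<^sup>2 \<partial>M"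
    and "e \<equiv> \<integral>\<omega>. log_mean_exp \<beta> p (\<theta> \<omega>) \<partial>M"
    and "n \<equiv> real N"
  shows "(\<integral>\<^sup>+\<omega>. ennreal \<bar>ln (partition_function \<beta> p N (\<lambda>k. \<Theta> k \<omega>) (\<lambda>k. I N k \<omega>) (K N \<omega>) / 2 ^ N) - \<alpha> * n * e\<bar> \<partial>M)
    \<le> ennreal (\<beta> * s1 * (2 * sqrt (\<alpha> * n) + (\<epsilon> * \<alpha> * n + 1))
        + \<alpha> * n * (2 * \<beta> / R * s2 + exp (2 * \<beta> * R) * (real p * (real p - 1) / ((n - 1) * \<epsilon>)))
        + 2 * sqrt (\<alpha> * n * (\<beta>\<^sup>2 * s2 + 1))
        + (\<epsilon> * \<alpha> * n + 1) * \<bar>e\<bar>)"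
proof -
  let ?Q = "\<integral>\<omega>. opening_prob \<beta> p (\<theta> \<omega>) \<partial>M"
  let ?s = "\<lambda>k \<omega>. sup_norm p (\<Theta> k \<omega>)" and ?L = "\<lambda>k \<omega>. log_mean_exp \<beta> p (\<Theta> k \<omega>)"
  let ?cw = "\<lambda>k \<omega>. cycle_weight \<beta> p N (\<lambda>k. \<Theta> k \<omega>) (\<lambda>k. I N k \<omega>) k"
  let ?F = "\<lambda>\<omega>. ln (partition_function \<beta> p N (\<lambda>k. \<Theta> k \<omega>) (\<lambda>k. I N k \<omega>) (K N \<omega>) / 2 ^ N)"
  define m where "m = nat \<lfloor>(1 - \<epsilon>) * \<alpha> * n\<rfloor>"
  let ?B = "\<lambda>\<omega>. {min m (K N \<omega>)<..max m (K N \<omega>)}"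
  define d where "d = \<epsilon> * \<alpha> * n + 1"
  define w where "w = real p * (real p - 1) / ((n - 1) * \<epsilon>)"
  have n: "n \<ge> 2" "n > 0" using assms(1,2) by (simp_all add: n_def)
  have x0: "0 \<le> (1 - \<epsilon>) * \<alpha> * n" using assms n by simp
  have m_le: "real m \<le> (1 - \<epsilon>) * \<alpha> * n" unfolding m_def by (rule of_nat_floor[OF x0])
  have m_ge: "(1 - \<epsilon>) * \<alpha> * n - 1 \<le> real m" unfolding m_def using x0 by linarith
  have "(1 - \<epsilon>) * \<alpha> * n = \<alpha> * n - \<epsilon> * \<alpha> * n" by (simp add: algebra_simps)
  moreover have pos: "0 < \<epsilon> * \<alpha> * n" "0 < \<alpha> * n" using assms n by simp_all
  ultimately have m_an: "real m \<le> \<alpha> * n" "\<bar>real m - \<alpha> * n\<bar> \<le> d"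
    using m_le m_ge unfolding d_def by linarith+
  have s1: "integrable M (\<lambda>\<omega>. sup_norm p (\<theta> \<omega>))"
    by (rule square_integrable_imp_integrable[OF measurable_theta_compose[OF borel_measurable_sup_norm] sq])
  have s1_0: "0 \<le> s1" "0 \<le> s2" unfolding s1_def s2_def
    by (simp_all add: Bochner_Integration.integral_nonneg sup_norm_nonneg)
  have d0: "0 \<le> d" and w0: "0 \<le> w" using pos n assms by (simp_all add: d_def w_def)
  have L2: "(log_mean_exp \<beta> p f)\<^sup>2 \<le> \<beta>\<^sup>2 * (sup_norm p f)\<^sup>2" for f
    using power_mono[OF abs_log_mean_exp_le[OF assms(3), of p f] abs_ge_zero, of 2]
    by (simp add: power_mult_distrib)
  have mL2: "(\<lambda>\<omega>. (log_mean_exp \<beta> p (\<theta> \<omega>))\<^sup>2) \<in> borel_measurable M"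
    by (intro borel_measurable_power measurable_theta_compose borel_measurable_log_mean_exp)
  have Lsq: "integrable M (\<lambda>\<omega>. (log_mean_exp \<beta> p (\<theta> \<omega>))\<^sup>2)"
    by (rule Bochner_Integration.integrable_bound[OF integrable_mult_right[OF sq, of "\<beta>\<^sup>2"] mL2]) (use L2 in auto)
  have Lsq_le: "(\<integral>\<omega>. (log_mean_exp \<beta> p (\<theta> \<omega>))\<^sup>2 \<partial>M) \<le> \<beta>\<^sup>2 * s2"
    unfolding s2_def integral_mult_right_zero[symmetric]
    by (rule integral_mono[OF Lsq integrable_mult_right[OF sq]]) (rule L2)
  have ms: "(\<lambda>\<omega>. ennreal (?s k \<omega>)) \<in> borel_measurable M" if "k \<ge> 1" for k
    by (intro measurable_compose[OF _ measurable_ennreal] measurable_Theta_compose that borel_measurable_sup_norm)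
  define A1 where "A1 \<omega> = ennreal \<beta> * (\<Sum>k\<in>?B \<omega>. ennreal (?s k \<omega>))" for \<omega>
  define A2 where "A2 \<omega> = (\<Sum>k=1..m. ennreal (2 * \<beta> / R) * ennreal ((?s k \<omega>)\<^sup>2)
      + ennreal (exp (2 * \<beta> * R)) * ennreal (?cw (k - 1) \<omega>))" for \<omega>
  define A3 where "A3 \<omega> = ennreal \<bar>\<Sum>k=1..m. ?L k \<omega> - e\<bar>" for \<omega>
  have mB: "(\<lambda>\<omega>. \<Sum>k\<in>?B \<omega>. ennreal (?s k \<omega>)) \<in> borel_measurable M"
    by (rule measurable_compose_countable[OF _ measurable_K[OF assms(2)], of "\<lambda>i \<omega>. \<Sum>k\<in>{min m i<..max m i}. ennreal (?s k \<omega>)"])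
      (intro borel_measurable_sum ms, auto)
  have mA1: "A1 \<in> borel_measurable M"
    unfolding A1_def by (intro borel_measurable_times_ennreal mB) simp
  have ms2: "(\<lambda>\<omega>. ennreal ((?s k \<omega>)\<^sup>2)) \<in> borel_measurable M" if "k \<ge> 1" for k
    by (intro measurable_compose[OF _ measurable_ennreal] borel_measurable_power measurable_Theta_compose that borel_measurable_sup_norm)
  have mcw: "(\<lambda>\<omega>. ennreal (?cw k \<omega>)) \<in> borel_measurable M" for k
    by (intro measurable_compose[OF _ measurable_ennreal] borel_measurable_cycle_weight assms(2))
  have mA2k: "(\<lambda>\<omega>. ennreal (2 * \<beta> / R) * ennreal ((?s k \<omega>)\<^sup>2)
      + ennreal (exp (2 * \<beta> * R)) * ennreal (?cw (k - 1) \<omega>)) \<in> borel_measurable M" if "k \<ge> 1" for k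
    by (intro borel_measurable_add borel_measurable_times_ennreal ms2 mcw that) simp_all
  have mA2: "A2 \<in> borel_measurable M"
    unfolding A2_def by (intro borel_measurable_sum mA2k) simp
  have mD: "(\<lambda>\<omega>. \<Sum>k=1..m. ?L k \<omega> - e) \<in> borel_measurable M"
    by (intro borel_measurable_sum borel_measurable_diff measurable_Theta_compose borel_measurable_log_mean_exp) simp_all
  have mA3: "A3 \<in> borel_measurable M"
    unfolding A3_def by (intro measurable_compose[OF _ measurable_ennreal] borel_measurable_abs mD)
  have "AE \<omega> in M. ennreal \<bar>?F \<omega> - \<alpha> * n * e\<bar> \<le> A1 \<omega> + A2 \<omega> + A3 \<omega> + ennreal (d * \<bar>e\<bar>)"
    using AE_valid_disorder[OF assms(2) sym]
  proof eventually_elim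
    case (elim \<omega>)
    let ?b = "\<Sum>k\<in>?B \<omega>. ?s k \<omega>"
    let ?c = "\<Sum>k=1..m. 2 * \<beta> / R * (?s k \<omega>)\<^sup>2 + exp (2 * \<beta> * R) * ?cw (k - 1) \<omega>"
    have b0: "0 \<le> ?b" by (intro sum_nonneg sup_norm_nonneg)
    have cw0: "0 \<le> ?cw k \<omega>" for k by (rule cycle_weight_nonneg[OF assms(3)])
    have c0: "0 \<le> ?c" using assms cw0 by (intro sum_nonneg add_nonneg_nonneg mult_nonneg_nonneg) auto
    have "\<bar>?F \<omega> - (\<Sum>k=1..m. ?L k \<omega>)\<bar> \<le> \<beta> * ?b + ?c"
      by (rule abs_ln_partition_function_diff_le[OF assms(3) elim assms(7)])
    moreover have "(\<Sum>k=1..m. ?L k \<omega> - e) = (\<Sum>k=1..m. ?L k \<omega>) - real m * e"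
      by (simp add: sum_subtractf)
    moreover have "\<bar>real m * e - \<alpha> * n * e\<bar> \<le> d * \<bar>e\<bar>"
      using mult_right_mono[OF m_an(2), of "\<bar>e\<bar>"] by (simp add: abs_mult[symmetric] left_diff_distrib)
    ultimately have "\<bar>?F \<omega> - \<alpha> * n * e\<bar> \<le> \<beta> * ?b + ?c + \<bar>\<Sum>k=1..m. ?L k \<omega> - e\<bar> + d * \<bar>e\<bar>"
      by linarith
    then have "ennreal \<bar>?F \<omega> - \<alpha> * n * e\<bar> \<le> ennreal (\<beta> * ?b + ?c + \<bar>\<Sum>k=1..m. ?L k \<omega> - e\<bar> + d * \<bar>e\<bar>)"
      by (rule ennreal_leI)
    also have "\<dots> = ennreal (\<beta> * ?b) + ennreal ?c + A3 \<omega> + ennreal (d * \<bar>e\<bar>)"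
      using b0 c0 d0 assms(3) by (simp add: A3_def ennreal_plus)
    also have "ennreal (\<beta> * ?b) = A1 \<omega>"
      using b0 assms(3) by (simp add: A1_def ennreal_mult sum_ennreal sup_norm_nonneg)
    also have "ennreal ?c = A2 \<omega>"
    proof -
      have "ennreal ?c = (\<Sum>k=1..m. ennreal (2 * \<beta> / R * (?s k \<omega>)\<^sup>2 + exp (2 * \<beta> * R) * ?cw (k - 1) \<omega>))"
        using assms cw0 by (intro sum_ennreal[symmetric] add_nonneg_nonneg mult_nonneg_nonneg) auto
      also have "\<dots> = A2 \<omega>"
        unfolding A2_def
      proof (intro sum.cong refl)
        fix k
        have "0 \<le> 2 * \<beta> / R" using assms by simp
        then show "ennreal (2 * \<beta> / R * (?s k \<omega>)\<^sup>2 + exp (2 * \<beta> * R) * ?cw (k - 1) \<omega>)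
            = ennreal (2 * \<beta> / R) * ennreal ((?s k \<omega>)\<^sup>2) + ennreal (exp (2 * \<beta> * R)) * ennreal (?cw (k - 1) \<omega>)"
          using cw0[of "k - 1"]
          by (simp only: ennreal_plus ennreal_mult mult_nonneg_nonneg exp_ge_zero zero_le_power2)
      qed
      finally show ?thesis .
    qed
    finally show ?case .
  qed
  then have "(\<integral>\<^sup>+\<omega>. ennreal \<bar>?F \<omega> - \<alpha> * n * e\<bar> \<partial>M)
      \<le> (\<integral>\<^sup>+\<omega>. A1 \<omega> + A2 \<omega> + A3 \<omega> + ennreal (d * \<bar>e\<bar>) \<partial>M)"
    by (rule nn_integral_mono_AE)
  also have "\<dots> = (\<integral>\<^sup>+\<omega>. A1 \<omega> \<partial>M) + (\<integral>\<^sup>+\<omega>. A2 \<omega> \<partial>M) + (\<integral>\<^sup>+\<omega>. A3 \<omega> \<partial>M) + ennreal (d * \<bar>e\<bar>)"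
    using mA1 mA2 mA3 by (simp add: nn_integral_add emeasure_space_1)
  also have "\<dots> \<le> ennreal (\<beta> * s1 * (2 * sqrt (\<alpha> * n) + d)) + ennreal (\<alpha> * n * (2 * \<beta> / R * s2 + exp (2 * \<beta> * R) * w))
      + ennreal (2 * sqrt (\<alpha> * n * (\<beta>\<^sup>2 * s2 + 1))) + ennreal (d * \<bar>e\<bar>)"
  proof (intro add_mono order_refl)
    have "(\<integral>\<^sup>+\<omega>. A1 \<omega> \<partial>M) = ennreal \<beta> * ((\<integral>\<^sup>+\<omega>. ennreal \<bar>real (K N \<omega>) - real m\<bar> \<partial>M) * ennreal s1)"
      unfolding A1_def using nn_integral_cmult[OF mB, of "ennreal \<beta>"]
        nn_integral_sum_between[OF assms(2), of "\<lambda>f. ennreal (sup_norm p f)" m]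
        nn_integral_eq_integral[OF s1] by (simp add: s1_def sup_norm_nonneg)
    also have "\<dots> \<le> ennreal \<beta> * (ennreal (2 * sqrt (\<alpha> * n) + d) * ennreal s1)"
    proof (intro mult_left_mono mult_right_mono)
      have "(\<integral>\<^sup>+\<omega>. ennreal \<bar>real (K N \<omega>) - real m\<bar> \<partial>M) \<le> ennreal (2 * sqrt (\<alpha> * n) + \<bar>real m - \<alpha> * n\<bar>)"
        unfolding n_def using assms n by (intro nn_integral_abs_K_diff) (auto simp: n_def)
      also have "\<dots> \<le> ennreal (2 * sqrt (\<alpha> * n) + d)"
        using m_an(2) by (intro ennreal_leI) simp
      finally show "(\<integral>\<^sup>+\<omega>. ennreal \<bar>real (K N \<omega>) - real m\<bar> \<partial>M) \<le> ennreal (2 * sqrt (\<alpha> * n) + d)" .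
    qed simp_all
    also have "\<dots> = ennreal (\<beta> * s1 * (2 * sqrt (\<alpha> * n) + d))"
    proof -
      have "0 \<le> 2 * sqrt (\<alpha> * n) + d" using d0 pos by simp
      then have "ennreal \<beta> * (ennreal (2 * sqrt (\<alpha> * n) + d) * ennreal s1) = ennreal (\<beta> * ((2 * sqrt (\<alpha> * n) + d) * s1))"
        using assms(3) s1_0 by (simp only: ennreal_mult mult_nonneg_nonneg less_imp_le)
      then show ?thesis by (simp only: mult_ac)
    qed
    finally show "(\<integral>\<^sup>+\<omega>. A1 \<omega> \<partial>M) \<le> ennreal (\<beta> * s1 * (2 * sqrt (\<alpha> * n) + d))" .
  next
    have k_le: "(\<integral>\<^sup>+\<omega>. ennreal (2 * \<beta> / R) * ennreal ((?s k \<omega>)\<^sup>2)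
        + ennreal (exp (2 * \<beta> * R)) * ennreal (?cw (k - 1) \<omega>) \<partial>M)
        \<le> ennreal (2 * \<beta> / R * s2 + exp (2 * \<beta> * R) * w)" if k: "k \<in> {1..m}" for k
    proof -
      have k1: "k \<ge> 1" using k by simp
      have "(\<integral>\<^sup>+\<omega>. ennreal ((?s k \<omega>)\<^sup>2) \<partial>M) = (\<integral>\<^sup>+\<omega>. ennreal ((sup_norm p (\<theta> \<omega>))\<^sup>2) \<partial>M)"
        using borel_measurable_sup_norm
        by (intro nn_integral_Theta[OF k1, of "\<lambda>f. ennreal ((sup_norm p f)\<^sup>2)"]) measurable
      also have "\<dots> = ennreal s2" unfolding s2_def by (rule nn_integral_eq_integral[OF sq]) simp
      finally have 1: "(\<integral>\<^sup>+\<omega>. ennreal ((?s k \<omega>)\<^sup>2) \<partial>M) = ennreal s2" .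
      have 2: "(\<integral>\<^sup>+\<omega>. ennreal (?cw (k - 1) \<omega>) \<partial>M) \<le> ennreal w"
      proof -
        have Q0: "0 \<le> ?Q" by (intro Bochner_Integration.integral_nonneg opening_prob_nonneg assms(3))
        have "real (k - 1) * ?Q * (real p * (real p - 1)) \<le> (1 - \<epsilon>) * \<alpha> * n * ?Q * (real p * (real p - 1))"
          using k m_le Q0 assms(1) by (intro mult_right_mono) auto
        also have "\<dots> = (?Q * (\<alpha> * real p * (real p - 1))) * ((1 - \<epsilon>) * n)" by (simp add: mult_ac)
        also have "\<dots> \<le> 1 * ((1 - \<epsilon>) * n)" using subcritical assms(6) n by (intro mult_right_mono) auto
        finally show ?thesis
          using nn_integral_cycle_weight[OF assms(1-3), of "1 - \<epsilon>" ?Q "k - 1"] assms(5,6)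
          by (simp add: w_def n_def)
      qed
      have "(\<integral>\<^sup>+\<omega>. ennreal (2 * \<beta> / R) * ennreal ((?s k \<omega>)\<^sup>2)
          + ennreal (exp (2 * \<beta> * R)) * ennreal (?cw (k - 1) \<omega>) \<partial>M)
          = ennreal (2 * \<beta> / R) * ennreal s2 + ennreal (exp (2 * \<beta> * R)) * (\<integral>\<^sup>+\<omega>. ennreal (?cw (k - 1) \<omega>) \<partial>M)"
        using ms2[OF k1] mcw[of "k - 1"] 1 by (simp add: nn_integral_add nn_integral_cmult)
      also have "\<dots> \<le> ennreal (2 * \<beta> / R) * ennreal s2 + ennreal (exp (2 * \<beta> * R)) * ennreal w"
        by (intro add_left_mono mult_left_mono 2) simp
      also have "\<dots> = ennreal (2 * \<beta> / R * s2 + exp (2 * \<beta> * R) * w)"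
      proof -
        have "0 \<le> 2 * \<beta> / R" using assms by simp
        then show ?thesis
          using s1_0 w0 by (simp only: ennreal_plus ennreal_mult mult_nonneg_nonneg exp_ge_zero)
      qed
      finally show ?thesis .
    qed
    have "(\<integral>\<^sup>+\<omega>. A2 \<omega> \<partial>M) = (\<Sum>k=1..m. \<integral>\<^sup>+\<omega>. ennreal (2 * \<beta> / R) * ennreal ((?s k \<omega>)\<^sup>2)
        + ennreal (exp (2 * \<beta> * R)) * ennreal (?cw (k - 1) \<omega>) \<partial>M)"
      unfolding A2_def by (intro nn_integral_sum mA2k) simp
    also have "\<dots> \<le> (\<Sum>k=1..m. ennreal (2 * \<beta> / R * s2 + exp (2 * \<beta> * R) * w))"
      by (intro sum_mono k_le)
    also have "\<dots> = ennreal (real m * (2 * \<beta> / R * s2 + exp (2 * \<beta> * R) * w))"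
      by (simp only: sum_constant card_atLeastAtMost add_diff_cancel_right' ennreal_of_nat_eq_real_of_nat
          ennreal_mult'[OF of_nat_0_le_iff] Suc_eq_plus1)
    also have "\<dots> \<le> ennreal (\<alpha> * n * (2 * \<beta> / R * s2 + exp (2 * \<beta> * R) * w))"
      using m_an(1) assms(3,7) s1_0 w0 by (intro ennreal_leI mult_right_mono) auto
    finally show "(\<integral>\<^sup>+\<omega>. A2 \<omega> \<partial>M) \<le> ennreal (\<alpha> * n * (2 * \<beta> / R * s2 + exp (2 * \<beta> * R) * w))" .
  next
    have "(\<integral>\<^sup>+\<omega>. ennreal ((\<Sum>k=1..m. ?L k \<omega> - e)\<^sup>2) \<partial>M) \<le> ennreal (real m * (\<integral>\<omega>. (log_mean_exp \<beta> p (\<theta> \<omega>))\<^sup>2 \<partial>M))"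
      unfolding e_def by (rule second_moment_sum_le[OF assms(2) borel_measurable_log_mean_exp Lsq])
    also have "\<dots> \<le> ennreal (\<alpha> * n * (\<beta>\<^sup>2 * s2 + 1))"
      using m_an(1) Lsq_le pos s1_0 by (intro ennreal_leI mult_mono) auto
    finally show "(\<integral>\<^sup>+\<omega>. A3 \<omega> \<partial>M) \<le> ennreal (2 * sqrt (\<alpha> * n * (\<beta>\<^sup>2 * s2 + 1)))"
      unfolding A3_def using pos s1_0
      by (intro nn_integral_abs_le_of_second_moment[OF mD prob_space_axioms]) (auto intro!: mult_pos_pos add_nonneg_pos)
  qed
  also have "\<dots> = ennreal (\<beta> * s1 * (2 * sqrt (\<alpha> * n) + d) + \<alpha> * n * (2 * \<beta> / R * s2 + exp (2 * \<beta> * R) * w)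
      + 2 * sqrt (\<alpha> * n * (\<beta>\<^sup>2 * s2 + 1)) + d * \<bar>e\<bar>)"
    using assms(3,4,7) n s1_0 d0 w0 by (simp add: ennreal_plus)
  finally show ?thesis by (simp only: d_def w_def)
qed

end

section \<open>Convergence\<close>

lemma tendsto_L1I:
  assumes "finite_measure M"
    and meas: "\<forall>\<^sub>F N in sequentially. X N \<in> borel_measurable M"
    and bound: "\<And>e. e > 0 \<Longrightarrow> \<forall>\<^sub>F N in sequentially. (\<integral>\<^sup>+\<omega>. ennreal \<bar>X N \<omega> - c\<bar> \<partial>M) \<le> ennreal e"
  shows "tendsto_L1 M X c"
proof -
  interpret finite_measure M by fact
  have int: "integrable M (\<lambda>\<omega>. X N \<omega> - c)"
    if "X N \<in> borel_measurable M" "(\<integral>\<^sup>+\<omega>. ennreal \<bar>X N \<omega> - c\<bar> \<partial>M) \<le> ennreal e" for N e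
  proof (rule integrableI_bounded)
    show "(\<lambda>\<omega>. X N \<omega> - c) \<in> borel_measurable M" using that(1) by measurable
    show "(\<integral>\<^sup>+\<omega>. ennreal (norm (X N \<omega> - c)) \<partial>M) < \<infinity>"
      unfolding real_norm_def using that(2) by (rule le_less_trans) simp
  qed
  have "\<forall>\<^sub>F N in sequentially. integrable M (X N)"
    using meas bound[of 1, simplified]
  proof eventually_elim
    case (elim N)
    have "integrable M (\<lambda>\<omega>. (X N \<omega> - c) + c)"
      by (intro Bochner_Integration.integrable_add int[where e=1]) (use elim in auto)
    then show ?case by simp
  qed
  moreover have "(\<lambda>N. \<integral>\<omega>. \<bar>X N \<omega> - c\<bar> \<partial>M) \<longlonglongrightarrow> 0"
  proof (rule tendstoI)
    fix e :: real assume e: "e > 0"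
    then have "e / 2 > 0" by simp
    from meas bound[OF this] show "\<forall>\<^sub>F N in sequentially. dist (\<integral>\<omega>. \<bar>X N \<omega> - c\<bar> \<partial>M) 0 < e"
    proof eventually_elim
      case (elim N)
      have "ennreal (\<integral>\<omega>. \<bar>X N \<omega> - c\<bar> \<partial>M) = (\<integral>\<^sup>+\<omega>. ennreal \<bar>X N \<omega> - c\<bar> \<partial>M)"
        by (rule nn_integral_eq_integral[symmetric]) (use int[OF elim] in auto)
      then have "ennreal (\<integral>\<omega>. \<bar>X N \<omega> - c\<bar> \<partial>M) \<le> ennreal (e / 2)" using elim(2) by (simp only:)
      then have "(\<integral>\<omega>. \<bar>X N \<omega> - c\<bar> \<partial>M) \<le> e / 2"
        by (rule ennreal_le_iff[THEN iffD1, rotated]) (use e in simp)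
      moreover have "0 \<le> (\<integral>\<omega>. \<bar>X N \<omega> - c\<bar> \<partial>M)" by simp
      ultimately show ?case using e by (simp add: dist_real_def)
    qed
  qed
  ultimately show ?thesis unfolding tendsto_L1_def by blast
qed

context diluted_disorder
begin

text \<open>
  Divided by \<open>N\<close>, the preceding bound tends to a multiple of \<open>\<epsilon>\<close> plus a multiple of \<open>1 / R\<close>: the
  cycles contribute \<open>exp (2 * \<beta> * R) / \<epsilon>\<close>, which is large but suppressed by \<open>1 / (N - 1)\<close>. So \<open>\<epsilon>\<close>
  and \<open>R\<close> can be fixed before \<open>N\<close> grows.
\<close>

lemma log_partition_function_converges:
  assumes "2 \<le> p" "\<beta> > 0" "\<alpha> > 0" "\<eta> > 0"
    and sq: "integrable M (\<lambda>\<omega>. (sup_norm p (\<theta> \<omega>))\<^sup>2)"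
    and sym: "AE \<omega> in M. \<forall>\<sigma>\<in>cube p. \<theta> \<omega> \<sigma> = \<theta> \<omega> (\<lambda>i\<in>{1..p}. - \<sigma> i)"
    and subcritical: "(\<integral>\<omega>. opening_prob \<beta> p (\<theta> \<omega>) \<partial>M) * (\<alpha> * real p * (real p - 1)) \<le> 1"
  defines "e \<equiv> \<integral>\<omega>. log_mean_exp \<beta> p (\<theta> \<omega>) \<partial>M"
  shows "\<forall>\<^sub>F N in sequentially.
    (\<integral>\<^sup>+\<omega>. ennreal \<bar>ln (partition_function \<beta> p N (\<lambda>k. \<Theta> k \<omega>) (\<lambda>k. I N k \<omega>) (K N \<omega>) / 2 ^ N) / real N
      - \<alpha> * e\<bar> \<partial>M) \<le> ennreal \<eta>"
proof -
  define s1 where "s1 = (\<integral>\<omega>. sup_norm p (\<theta> \<omega>) \<partial>M)"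
  define s2 where "s2 = (\<integral>\<omega>. (sup_norm p (\<theta> \<omega>))\<^sup>2 \<partial>M)"
  have s0: "0 \<le> s1" "0 \<le> s2" unfolding s1_def s2_def
    by (simp_all add: Bochner_Integration.integral_nonneg sup_norm_nonneg)
  define a where "a = \<beta> * s1 * \<alpha> + \<alpha> * \<bar>e\<bar>"
  have a0: "0 \<le> a" using s0 assms by (simp add: a_def)
  \<comment> \<open>Each of the two terms that survive in the limit is made at most \<open>\<eta> / 4\<close>.\<close>
  define \<epsilon> where "\<epsilon> = min (1 / 2) (\<eta> / (4 * (a + 1)))"
  define R where "R = 8 * \<alpha> * \<beta> * s2 / \<eta> + 1"
  have eps: "0 < \<epsilon>" "\<epsilon> < 1" using a0 assms(4) by (auto simp: \<epsilon>_def)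
  have "\<epsilon> * a \<le> \<eta> / (4 * (a + 1)) * a" using a0 by (intro mult_right_mono) (auto simp: \<epsilon>_def)
  also have "\<dots> \<le> \<eta> / 4" using a0 assms(4) by (simp add: field_simps)
  finally have eps_a: "\<epsilon> * a \<le> \<eta> / 4" .
  have R: "R > 0" using s0 assms by (auto simp: R_def intro!: add_nonneg_pos)
  have "8 * \<alpha> * \<beta> * s2 / \<eta> \<le> R" by (simp add: R_def)
  then have R_s2: "\<alpha> * (2 * \<beta> / R * s2) \<le> \<eta> / 4"
    using R assms(4) by (simp add: field_simps)
  define E where "E = exp (2 * \<beta> * R) * (real p * (real p - 1) / \<epsilon>)"
  define V where "V = \<beta>\<^sup>2 * s2 + 1"
  define b where "b N = \<beta> * s1 * (2 * sqrt \<alpha> * inverse (sqrt (real N)) + (\<epsilon> * \<alpha> + inverse (real N)))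
      + \<alpha> * (2 * \<beta> / R * s2 + E * inverse (real N - 1))
      + 2 * sqrt (\<alpha> * V) * inverse (sqrt (real N)) + (\<epsilon> * \<alpha> + inverse (real N)) * \<bar>e\<bar>" for N
  have inv_sqrt: "(\<lambda>N. inverse (sqrt (real N))) \<longlonglongrightarrow> 0"
    by (intro tendsto_inverse_0_at_top filterlim_compose[OF sqrt_at_top] filterlim_real_sequentially)
  have inv: "(\<lambda>N. inverse (real N)) \<longlonglongrightarrow> 0"
    by (intro tendsto_inverse_0_at_top filterlim_real_sequentially)
  have inv1: "(\<lambda>N. inverse (real N - 1)) \<longlonglongrightarrow> 0"
    using filterlim_tendsto_add_at_top[OF tendsto_const[of "-1::real"] filterlim_real_sequentially]
    by (intro tendsto_inverse_0_at_top) (simp add: add.commute)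
  have "b \<longlonglongrightarrow> \<beta> * s1 * (2 * sqrt \<alpha> * 0 + (\<epsilon> * \<alpha> + 0)) + \<alpha> * (2 * \<beta> / R * s2 + E * 0)
      + 2 * sqrt (\<alpha> * V) * 0 + (\<epsilon> * \<alpha> + 0) * \<bar>e\<bar>"
    unfolding b_def by (intro tendsto_intros inv_sqrt inv inv1)
  moreover have "\<beta> * s1 * (2 * sqrt \<alpha> * 0 + (\<epsilon> * \<alpha> + 0)) + \<alpha> * (2 * \<beta> / R * s2 + E * 0)
      + 2 * sqrt (\<alpha> * V) * 0 + (\<epsilon> * \<alpha> + 0) * \<bar>e\<bar> = \<epsilon> * a + \<alpha> * (2 * \<beta> / R * s2)"
    by (simp add: a_def algebra_simps)
  moreover have "\<epsilon> * a + \<alpha> * (2 * \<beta> / R * s2) < \<eta>" using eps_a R_s2 assms(4) by linarith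
  ultimately have "\<forall>\<^sub>F N in sequentially. b N < \<eta>" by (simp only: order_tendstoD(2))
  then show ?thesis using eventually_ge_at_top[of p]
  proof eventually_elim
    case (elim N)
    define n where "n = real N"
    have n: "n \<ge> 2" "n > 0" using elim(2) assms(1) by (simp_all add: n_def)
    let ?F = "\<lambda>\<omega>. ln (partition_function \<beta> p N (\<lambda>k. \<Theta> k \<omega>) (\<lambda>k. I N k \<omega>) (K N \<omega>) / 2 ^ N)"
    let ?b = "\<beta> * s1 * (2 * sqrt (\<alpha> * n) + (\<epsilon> * \<alpha> * n + 1))
        + \<alpha> * n * (2 * \<beta> / R * s2 + exp (2 * \<beta> * R) * (real p * (real p - 1) / ((n - 1) * \<epsilon>)))
        + 2 * sqrt (\<alpha> * n * (\<beta>\<^sup>2 * s2 + 1)) + (\<epsilon> * \<alpha> * n + 1) * \<bar>e\<bar>"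
    have m: "(\<lambda>\<omega>. ennreal \<bar>?F \<omega> - \<alpha> * n * e\<bar>) \<in> borel_measurable M"
      using measurable_log_partition_function[OF elim(2), of \<beta>] by measurable
    have "\<bar>x / n - \<alpha> * e\<bar> = 1 / n * \<bar>x - \<alpha> * n * e\<bar>" for x
    proof -
      have "x / n - \<alpha> * e = 1 / n * (x - \<alpha> * n * e)" using n by (simp add: field_simps)
      then show ?thesis using n by (simp only: abs_mult) simp
    qed
    then have "(\<integral>\<^sup>+\<omega>. ennreal \<bar>?F \<omega> / n - \<alpha> * e\<bar> \<partial>M)
        = (\<integral>\<^sup>+\<omega>. ennreal (1 / n) * ennreal \<bar>?F \<omega> - \<alpha> * n * e\<bar> \<partial>M)"
      by (simp only: ennreal_mult'' abs_ge_zero)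
    also have "\<dots> = ennreal (1 / n) * (\<integral>\<^sup>+\<omega>. ennreal \<bar>?F \<omega> - \<alpha> * n * e\<bar> \<partial>M)"
      by (rule nn_integral_cmult[OF m])
    also have "\<dots> \<le> ennreal (1 / n) * ennreal ?b"
      unfolding n_def s1_def s2_def e_def
      by (intro mult_left_mono nn_integral_log_partition_function_error[OF assms(1) elim(2) assms(2,3) eps R sq sym subcritical]) simp
    also have "\<dots> = ennreal (?b / n)" using n by (subst ennreal_mult'[symmetric]) simp_all
    also have "?b / n = b N"
    proof -
      have sq: "sqrt n / n = inverse (sqrt n)" using n by (simp add: field_simps)
      have t1: "sqrt (\<alpha> * n) / n = sqrt \<alpha> * inverse (sqrt n)"
        by (simp only: real_sqrt_mult times_divide_eq_right[symmetric] sq)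
      have t2: "sqrt (\<alpha> * n * V) / n = sqrt (\<alpha> * V) * inverse (sqrt n)"
        unfolding real_sqrt_mult sq[symmetric] by (simp add: mult_ac)
      have t3: "(\<epsilon> * \<alpha> * n + 1) / n = \<epsilon> * \<alpha> + inverse n" using n by (simp add: field_simps)
      have t4: "exp (2 * \<beta> * R) * (real p * (real p - 1) / ((n - 1) * \<epsilon>)) = E * inverse (n - 1)"
        by (simp add: E_def field_simps)
      have split: "(x * (2 * y + z) + \<alpha> * n * u + 2 * v + z * w) / n
          = x * (2 * (y / n) + z / n) + \<alpha> * u + 2 * (v / n) + z / n * w" for x y z u v w
        using n by (simp add: field_simps)
      show ?thesis
        unfolding V_def[symmetric] b_def n_def[symmetric] split t1 t2 t3 t4 by (simp only: mult.assoc)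
    qed
    also have "ennreal (b N) \<le> ennreal \<eta>" using elim(1) by (intro ennreal_leI) simp
    finally show ?case unfolding n_def .
  qed
qed

lemma integrable_log_mean_exp:
  assumes "\<beta> > 0" "integrable M (\<lambda>\<omega>. sup_norm p (\<theta> \<omega>))"
  shows "integrable M (\<lambda>\<omega>. log_mean_exp \<beta> p (\<theta> \<omega>))"
  by (rule Bochner_Integration.integrable_bound[OF integrable_mult_right[OF assms(2), of \<beta>]
        measurable_theta_compose[OF borel_measurable_log_mean_exp]])
    (use abs_log_mean_exp_le[OF assms(1)] assms(1) sup_norm_nonneg in \<open>auto simp: abs_mult\<close>)

text \<open>
  The opening probability is at most \<open>1\<close> and at most \<open>2 * \<beta> * s\<close>, where \<open>s\<close> is the sup norm; the
  second bound lies below the integrand \<open>6 * \<beta> * s * exp (4 * \<beta> * s)\<close>.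
\<close>

lemma opening_prob_le_hypothesis:
  assumes "\<beta> > 0"
  shows "ennreal (\<integral>\<omega>. opening_prob \<beta> p (\<theta> \<omega>) \<partial>M)
    \<le> min 1 (ennreal (6 * \<beta>) * (\<integral>\<^sup>+\<omega>. ennreal (sup_norm p (\<theta> \<omega>) * exp (4 * \<beta> * sup_norm p (\<theta> \<omega>))) \<partial>M))"
proof (rule min.boundedI)
  let ?s = "\<lambda>\<omega>. sup_norm p (\<theta> \<omega>)"
  have "(\<integral>\<^sup>+\<omega>. ennreal (opening_prob \<beta> p (\<theta> \<omega>)) \<partial>M) \<le> (\<integral>\<^sup>+\<omega>. 1 \<partial>M)"
    by (intro nn_integral_mono) (simp add: opening_prob_def)
  then show "ennreal (\<integral>\<omega>. opening_prob \<beta> p (\<theta> \<omega>) \<partial>M) \<le> 1"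
    by (simp add: nn_integral_opening_prob[OF assms] emeasure_space_1)
  have "opening_prob \<beta> p f \<le> 6 * \<beta> * (sup_norm p f * exp (4 * \<beta> * sup_norm p f))" for f
  proof -
    let ?x = "\<beta> * sup_norm p f"
    have x: "0 \<le> ?x" using assms sup_norm_nonneg[of p f] by simp
    have "opening_prob \<beta> p f \<le> 2 * ?x"
      using exp_ge_add_one_self[of "- 2 * ?x"] by (simp add: opening_prob_def mult.assoc)
    also have "\<dots> \<le> 6 * ?x * 1" using x by simp
    also have "\<dots> \<le> 6 * ?x * exp (4 * ?x)" using x by (intro mult_left_mono) auto
    finally show ?thesis by (simp only: mult_ac)
  qed
  then have "(\<integral>\<^sup>+\<omega>. ennreal (opening_prob \<beta> p (\<theta> \<omega>)) \<partial>M)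
      \<le> (\<integral>\<^sup>+\<omega>. ennreal (6 * \<beta>) * ennreal (?s \<omega> * exp (4 * \<beta> * ?s \<omega>)) \<partial>M)"
    using assms sup_norm_nonneg by (intro nn_integral_mono) (simp add: ennreal_mult'[symmetric] ennreal_leI)
  also have "\<dots> = ennreal (6 * \<beta>) * (\<integral>\<^sup>+\<omega>. ennreal (?s \<omega> * exp (4 * \<beta> * ?s \<omega>)) \<partial>M)"
  proof (rule nn_integral_cmult)
    note [measurable] = measurable_theta_compose[OF borel_measurable_sup_norm]
    show "(\<lambda>\<omega>. ennreal (?s \<omega> * exp (4 * \<beta> * ?s \<omega>))) \<in> borel_measurable M" by measurable
  qed
  finally show "ennreal (\<integral>\<omega>. opening_prob \<beta> p (\<theta> \<omega>) \<partial>M)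
      \<le> ennreal (6 * \<beta>) * (\<integral>\<^sup>+\<omega>. ennreal (?s \<omega> * exp (4 * \<beta> * ?s \<omega>)) \<partial>M)"
    by (simp only: nn_integral_opening_prob[OF assms])
qed

lemma expected_log_mean_exp_approx_Max:
  assumes "\<beta> > 0" and s1: "integrable M (\<lambda>\<omega>. sup_norm p (\<theta> \<omega>))"
  shows "\<bar>(\<integral>\<omega>. log_mean_exp \<beta> p (\<theta> \<omega>) \<partial>M) / \<beta> - (\<integral>\<omega>. Max (\<theta> \<omega> ` cube p) \<partial>M)\<bar> \<le> real p * ln 2 / \<beta>"
proof -
  let ?l = "\<lambda>\<omega>. log_mean_exp \<beta> p (\<theta> \<omega>) / \<beta>" and ?m = "\<lambda>\<omega>. Max (\<theta> \<omega> ` cube p)"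
  let ?c = "real p * ln 2 / \<beta>"
  have il: "integrable M ?l" using integrable_log_mean_exp[OF assms] by simp
  have approx: "\<bar>?l \<omega> - ?m \<omega>\<bar> \<le> ?c" for \<omega>
    using log_sum_exp_approx_Max[OF assms(1), where n=p and h="\<theta> \<omega>"] by (simp add: log_mean_exp_def)
  have im: "integrable M ?m"
  proof (rule Bochner_Integration.integrable_bound)
    show "integrable M (\<lambda>\<omega>. \<bar>?l \<omega>\<bar> + ?c)" by (intro Bochner_Integration.integrable_add integrable_abs il) simp
    show "?m \<in> borel_measurable M"
    proof (intro borel_measurable_Max)
      fix \<sigma> assume "\<sigma> \<in> cube p"
      then show "(\<lambda>\<omega>. \<theta> \<omega> \<sigma>) \<in> borel_measurable M"
        by (intro measurable_theta_compose) (auto simp: fun_space_def intro: measurable_component_singleton)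
    qed simp
    have "\<bar>?m \<omega>\<bar> \<le> \<bar>\<bar>?l \<omega>\<bar> + ?c\<bar>" for \<omega> using approx[of \<omega>] by linarith
    then show "AE \<omega> in M. norm (?m \<omega>) \<le> norm (\<bar>?l \<omega>\<bar> + ?c)" by simp
  qed
  have "\<bar>\<integral>\<omega>. ?l \<omega> - ?m \<omega> \<partial>M\<bar> \<le> (\<integral>\<omega>. \<bar>?l \<omega> - ?m \<omega>\<bar> \<partial>M)" by (rule integral_abs_bound)
  also have "\<dots> \<le> (\<integral>\<omega>. ?c \<partial>M)"
    using il im approx by (intro integral_mono) auto
  finally show ?thesis using il im by (simp add: prob_space)
qed

end

theorem proposition1p3:
  fixes M :: "'a measure" and p :: nat and \<alpha> :: real
    and \<theta> :: "'a \<Rightarrow> (nat \<Rightarrow> real) \<Rightarrow> real"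
    and \<Theta> :: "nat \<Rightarrow> 'a \<Rightarrow> (nat \<Rightarrow> real) \<Rightarrow> real"
    and K :: "nat \<Rightarrow> 'a \<Rightarrow> nat"
    and I :: "nat \<Rightarrow> nat \<Rightarrow> 'a \<Rightarrow> nat \<Rightarrow> nat"
    and \<nu> :: "real measure"
    and H :: "nat \<Rightarrow> 'a \<Rightarrow> (nat \<Rightarrow> real) \<Rightarrow> real"
  assumes "p \<ge> 2" and "\<alpha> > 0"
    and "diluted_disorder M p \<alpha> \<theta> \<Theta> K I"
    and "\<nu> = uniform_count_measure {-1, 1}"
    and "H = (\<lambda>N \<omega>. hamiltonian p (\<lambda>k. \<Theta> k \<omega>) (K N \<omega>) (\<lambda>k. I N k \<omega>))"
    and "integrable M (\<lambda>\<omega>. (sup_norm p (\<theta> \<omega>))\<^sup>2)"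
    and "integrable M (\<lambda>\<omega>. Lip p (\<theta> \<omega>))"
    and "perm_invariant_law p M \<theta>"
    and "AE \<omega> in M. \<forall>\<sigma>\<in>cube p. \<theta> \<omega> \<sigma> = \<theta> \<omega> (\<lambda>i\<in>{1..p}. - \<sigma> i)"
  shows "(\<forall>\<beta>::real. \<beta> > 0 \<longrightarrow>
            min 1 (ennreal (6 * \<beta>) *
                (\<integral>\<^sup>+\<omega>. ennreal (sup_norm p (\<theta> \<omega>) * exp (4 * \<beta> * sup_norm p (\<theta> \<omega>))) \<partial>M))
              * ennreal (\<alpha> * real p * (real p - 1)) \<le> 1 \<longrightarrow>
            tendsto_L1 M (\<lambda>N \<omega>. free_energy \<nu> N \<beta> (H N \<omega>))
              (\<alpha> * (\<integral>\<omega>. ln (\<Sum>\<sigma>\<in>cube p. exp (\<beta> * \<theta> \<omega> \<sigma>)) \<partial>M) - \<alpha> * real p * ln 2))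
       \<and> (\<alpha> * real p * (real p - 1) \<le> 1 \<longrightarrow>
            tendsto_L1 M (\<lambda>N \<omega>. ground_state_energy N (H N \<omega>))
              (\<alpha> * (\<integral>\<omega>. Max (\<theta> \<omega> ` cube p) \<partial>M)))"
proof (intro conjI allI impI)
  interpret diluted_disorder M p \<alpha> \<theta> \<Theta> K I by fact
  note sq = assms(6) and sym = assms(9)
  have s1: "integrable M (\<lambda>\<omega>. sup_norm p (\<theta> \<omega>))"
    by (rule square_integrable_imp_integrable[OF measurable_theta_compose[OF borel_measurable_sup_norm] sq])
  let ?F = "\<lambda>\<beta> N \<omega>. ln (partition_function \<beta> p N (\<lambda>k. \<Theta> k \<omega>) (\<lambda>k. I N k \<omega>) (K N \<omega>) / 2 ^ N)"
  let ?e = "\<lambda>\<beta>. \<integral>\<omega>. log_mean_exp \<beta> p (\<theta> \<omega>) \<partial>M"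
  let ?Q = "\<lambda>\<beta>. \<integral>\<omega>. opening_prob \<beta> p (\<theta> \<omega>) \<partial>M"
  let ?c = "\<alpha> * real p * (real p - 1)"
  have c0: "0 \<le> ?c" using assms(1,2) by simp
  have Q0: "0 \<le> ?Q \<beta>" if "\<beta> > 0" for \<beta>
    by (intro Bochner_Integration.integral_nonneg opening_prob_nonneg that)
  {
    fix \<beta> :: real
    assume b: "\<beta> > 0"
      and hyp: "min 1 (ennreal (6 * \<beta>) *
                (\<integral>\<^sup>+\<omega>. ennreal (sup_norm p (\<theta> \<omega>) * exp (4 * \<beta> * sup_norm p (\<theta> \<omega>))) \<partial>M))
              * ennreal ?c \<le> 1"
    have "ennreal (?Q \<beta> * ?c) = ennreal (?Q \<beta>) * ennreal ?c"
      by (rule ennreal_mult[OF Q0[OF b] c0])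
    also have "\<dots> \<le> 1"
      by (rule order_trans[OF mult_right_mono[OF opening_prob_le_hypothesis[OF b]] hyp]) simp
    finally have subcritical: "?Q \<beta> * ?c \<le> 1" by (simp only: ennreal_le_1)
    have il: "integrable M (\<lambda>\<omega>. log_mean_exp \<beta> p (\<theta> \<omega>))" by (rule integrable_log_mean_exp[OF b s1])
    have "ln (\<Sum>\<sigma>\<in>cube p. exp (\<beta> * \<theta> \<omega> \<sigma>)) = log_mean_exp \<beta> p (\<theta> \<omega>) + real p * ln 2" for \<omega>
    proof -
      have "0 < (\<Sum>\<sigma>\<in>cube p. exp (\<beta> * \<theta> \<omega> \<sigma>))" by (intro sum_pos) auto
      then show ?thesis by (simp add: log_mean_exp_def ln_div ln_realpow)
    qed
    then have "(\<integral>\<omega>. ln (\<Sum>\<sigma>\<in>cube p. exp (\<beta> * \<theta> \<omega> \<sigma>)) \<partial>M) = ?e \<beta> + real p * ln 2"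
      using il by (simp add: prob_space)
    then have lim: "\<alpha> * (\<integral>\<omega>. ln (\<Sum>\<sigma>\<in>cube p. exp (\<beta> * \<theta> \<omega> \<sigma>)) \<partial>M) - \<alpha> * real p * ln 2 = \<alpha> * ?e \<beta>"
      by (simp add: algebra_simps)
    have F: "(\<lambda>N \<omega>. free_energy \<nu> N \<beta> (H N \<omega>)) = (\<lambda>N \<omega>. ?F \<beta> N \<omega> / real N)"
      unfolding assms(4,5) free_energy_eq_partition_function ..
    show "tendsto_L1 M (\<lambda>N \<omega>. free_energy \<nu> N \<beta> (H N \<omega>))
              (\<alpha> * (\<integral>\<omega>. ln (\<Sum>\<sigma>\<in>cube p. exp (\<beta> * \<theta> \<omega> \<sigma>)) \<partial>M) - \<alpha> * real p * ln 2)"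
      unfolding lim F
    proof (rule tendsto_L1I[OF finite_measure_axioms])
      show "\<forall>\<^sub>F N in sequentially. (\<lambda>\<omega>. ?F \<beta> N \<omega> / real N) \<in> borel_measurable M"
        using eventually_ge_at_top[of p]
        by eventually_elim (intro borel_measurable_divide measurable_log_partition_function, simp_all)
    qed (rule log_partition_function_converges[OF assms(1) b assms(2) _ sq sym subcritical])
  }
  assume crit: "?c \<le> 1"
  show "tendsto_L1 M (\<lambda>N \<omega>. ground_state_energy N (H N \<omega>)) (\<alpha> * (\<integral>\<omega>. Max (\<theta> \<omega> ` cube p) \<partial>M))"
  proof (rule tendsto_L1I[OF finite_measure_axioms])
    show "\<forall>\<^sub>F N in sequentially. (\<lambda>\<omega>. ground_state_energy N (H N \<omega>)) \<in> borel_measurable M"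
      unfolding assms(5) using eventually_ge_at_top[of p]
      by eventually_elim (rule measurable_ground_state_energy)
  next
    fix \<eta> :: real assume eta: "\<eta> > 0"
    let ?k = "(1 + \<alpha> * real p) * ln 2"
    let ?m = "\<integral>\<omega>. Max (\<theta> \<omega> ` cube p) \<partial>M"
    \<comment> \<open>The error of replacing the maximum by the free energy over \<open>\<beta>\<close> is at most \<open>?k / \<beta>\<close>, hence at most \<open>\<eta> / 2\<close>;
      with \<open>\<beta> \<ge> 1\<close> the error of the free energy does not grow when it is divided by \<open>\<beta>\<close>.\<close>
    define \<beta> where "\<beta> = 2 * ?k / \<eta> + 1"
    have k0: "0 \<le> ?k" using assms(2) by simp
    have b: "\<beta> \<ge> 1" "\<beta> > 0" using k0 eta by (auto simp: \<beta>_def intro!: add_nonneg_pos)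
    have "2 * ?k / \<eta> \<le> \<beta>" by (simp add: \<beta>_def)
    then have kb: "?k / \<beta> \<le> \<eta> / 2" using eta b by (simp add: field_simps)
    have "?Q \<beta> \<le> 1"
      using opening_prob_le_hypothesis[OF b(2)] by (simp add: ennreal_le_1)
    then have subcritical: "?Q \<beta> * ?c \<le> 1" using mult_mono[OF _ crit, of "?Q \<beta>" 1] c0 by simp
    have "\<eta> / 2 > 0" using eta by simp
    from log_partition_function_converges[OF assms(1) b(2) assms(2) this sq sym subcritical] eventually_ge_at_top[of p]
    show "\<forall>\<^sub>F N in sequentially. (\<integral>\<^sup>+\<omega>. ennreal \<bar>ground_state_energy N (H N \<omega>) - \<alpha> * ?m\<bar> \<partial>M) \<le> ennreal \<eta>"
    proof eventually_elim
      case (elim N)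
      have n: "real N > 0" using elim(2) assms(1) by simp
      have pt: "\<bar>ground_state_energy N (H N \<omega>) - \<alpha> * ?m\<bar> \<le> \<bar>?F \<beta> N \<omega> / real N - \<alpha> * ?e \<beta>\<bar> + \<eta> / 2" for \<omega>
      proof -
        have "\<bar>?F \<beta> N \<omega> / \<beta> - Max (H N \<omega> ` cube N)\<bar> \<le> real N * ln 2 / \<beta>"
          unfolding partition_function_def assms(5) by (rule log_sum_exp_approx_Max[OF b(2)])
        from divide_right_mono[OF this, of "real N"] n
        have "\<bar>?F \<beta> N \<omega> / \<beta> - Max (H N \<omega> ` cube N)\<bar> / \<bar>real N\<bar> \<le> ln 2 / \<beta>" by simp
        then have 1: "\<bar>?F \<beta> N \<omega> / real N / \<beta> - ground_state_energy N (H N \<omega>)\<bar> \<le> ln 2 / \<beta>"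
          unfolding abs_divide[symmetric] ground_state_energy_def
          by (simp add: diff_divide_distrib divide_divide_eq_left mult.commute)
        have "\<alpha> * \<bar>?e \<beta> / \<beta> - ?m\<bar> \<le> \<alpha> * (real p * ln 2 / \<beta>)"
          using expected_log_mean_exp_approx_Max[OF b(2) s1] assms(2) by (intro mult_left_mono) auto
        moreover have "\<alpha> * \<bar>?e \<beta> / \<beta> - ?m\<bar> = \<bar>\<alpha> * ?e \<beta> / \<beta> - \<alpha> * ?m\<bar>"
          using assms(2) abs_mult_pos'[of \<alpha> "?e \<beta> / \<beta> - ?m"] by (simp add: right_diff_distrib)
        ultimately have 2: "\<bar>\<alpha> * ?e \<beta> / \<beta> - \<alpha> * ?m\<bar> \<le> \<alpha> * (real p * ln 2 / \<beta>)" by simp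
        have "\<bar>?F \<beta> N \<omega> / real N / \<beta> - \<alpha> * ?e \<beta> / \<beta>\<bar> = \<bar>?F \<beta> N \<omega> / real N - \<alpha> * ?e \<beta>\<bar> / \<beta>"
          unfolding diff_divide_distrib[symmetric] abs_divide using b by (simp only: abs_of_pos)
        also have "\<dots> \<le> \<bar>?F \<beta> N \<omega> / real N - \<alpha> * ?e \<beta>\<bar> / 1"
          using b by (intro divide_left_mono) auto
        finally have 3: "\<bar>?F \<beta> N \<omega> / real N / \<beta> - \<alpha> * ?e \<beta> / \<beta>\<bar> \<le> \<bar>?F \<beta> N \<omega> / real N - \<alpha> * ?e \<beta>\<bar>" by simp
        have "ln 2 / \<beta> + \<alpha> * (real p * ln 2 / \<beta>) = ?k / \<beta>" using b by (simp add: field_simps)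
        then show ?thesis using 1 2 3 kb by linarith
      qed
      have m: "(\<lambda>\<omega>. ennreal \<bar>?F \<beta> N \<omega> / real N - \<alpha> * ?e \<beta>\<bar>) \<in> borel_measurable M"
        using measurable_log_partition_function[OF elim(2), of \<beta>] by measurable
      have "(\<integral>\<^sup>+\<omega>. ennreal \<bar>ground_state_energy N (H N \<omega>) - \<alpha> * ?m\<bar> \<partial>M)
          \<le> (\<integral>\<^sup>+\<omega>. ennreal \<bar>?F \<beta> N \<omega> / real N - \<alpha> * ?e \<beta>\<bar> + ennreal (\<eta> / 2) \<partial>M)"
        using pt eta by (intro nn_integral_mono) (simp add: ennreal_leI flip: ennreal_plus)
      also have "\<dots> = (\<integral>\<^sup>+\<omega>. ennreal \<bar>?F \<beta> N \<omega> / real N - \<alpha> * ?e \<beta>\<bar> \<partial>M) + ennreal (\<eta> / 2)"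
        using m by (simp add: nn_integral_add emeasure_space_1)
      also have "\<dots> \<le> ennreal (\<eta> / 2) + ennreal (\<eta> / 2)" by (intro add_right_mono elim(1))
      also have "\<dots> = ennreal \<eta>" using eta by (simp flip: ennreal_plus)
      finally show ?case .
    qed
  qed
qed

end
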